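(* Let $L$ be a finite-dimensional solvable Lie algebra of solvability index $3$ over a field $F$. Then $L$ is minimal non-$\mathcal{N}(\leq 2)$ if and only if it is minimal non-(nilpotent-by-abelian) of type I.
   Context: All Lie algebras are finite-dimensional and solvable over a field $F$. The solvability index (derived length) of $L$ is the smallest $r$ with $L^{(r)}=0$, where $L^{(0)}=L$, $L^{(i+1)}=[L^{(i)},L^{(i)}]$. $N(L)$ is the nilradical of $L$; the upper nilpotent series is $N_0(L)=0$, $N_i(L)/N_{i-1}(L)=N(L/N_{i-1}(L))$, and the nilpotent length of $L$ is the smallest integer $m$ with $N_m(L)=L$. $\mathcal{N}(\leq 2)$ is the class of Lie algebras of nilpotent length $\leq 2$. For a class $\mathcal{X}$, $L$ is minimal non-$\mathcal{X}$ if every proper subalgebra of $L$, but not $L$ itself, belongs to $\mathcal{X}$. $L$ is nilpotent-by-abelian if $[L,L]$ is nilpotent. $\phi(L)$, the Frattini subalgebra, is the intersection of the maximal subalgebras of $L$ (an ideal, since $L$ is solvable); $\dot{+}$ denotes a direct sum of vector spaces. A minimal non-(nilpotent-by-abelian) Lie algebra $L$ is of type I if $F$ has characteristic $p>0$ and $\overline{L}=L/\phi(L)$ has the form $\overline{L}=A\dot{+}B$, where $A$ is the unique minimal ideal of $\overline{L}$, $\dim A\geq 2$, $A^2=0$, and $B$ is a subalgebra with $B=M\dot{+}Fx$, where $M$ is a minimal ideal of $B$ such that $M^2=0$. *)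

theory Defs
  imports "HOL-Algebra.QuotRing" "Jordan_Normal_Form.Missing_VectorSpace"
begin

text \<open>
  A Lie algebra over \<open>F\<close> is a vector space carried by a \<^typ>\<open>('f, 'a) module\<close> record, whose
  \<^const>\<open>mult\<close> field is the Lie bracket: \<open>x \<otimes>\<^bsub>L\<^esub> y\<close> is $[x,y]$. (The locale
  \<^locale>\<open>module\<close> imposes nothing on \<^const>\<open>mult\<close> and \<^const>\<open>one\<close>; the latter is never used.)
  A subalgebra \<open>S\<close> is a subset of the carrier and is viewed as a Lie algebra in its own right as
  \<open>L\<lparr>carrier := S\<rparr>\<close>.
\<close>

locale lie_algebra = vectorspace F L for F and L (structure) +
  assumes bracket_closed: "\<lbrakk>x \<in> carrier L; y \<in> carrier L\<rbrakk> \<Longrightarrow> x \<otimes> y \<in> carrier L"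
    and bracket_add_left: "\<lbrakk>x \<in> carrier L; y \<in> carrier L; z \<in> carrier L\<rbrakk>
      \<Longrightarrow> (x \<oplus> y) \<otimes> z = x \<otimes> z \<oplus> y \<otimes> z"
    and bracket_add_right: "\<lbrakk>x \<in> carrier L; y \<in> carrier L; z \<in> carrier L\<rbrakk>
      \<Longrightarrow> x \<otimes> (y \<oplus> z) = x \<otimes> y \<oplus> x \<otimes> z"
    and bracket_smult_left: "\<lbrakk>c \<in> carrier F; x \<in> carrier L; y \<in> carrier L\<rbrakk>
      \<Longrightarrow> (c \<odot> x) \<otimes> y = c \<odot> (x \<otimes> y)"
    and bracket_smult_right: "\<lbrakk>c \<in> carrier F; x \<in> carrier L; y \<in> carrier L\<rbrakk>
      \<Longrightarrow> x \<otimes> (c \<odot> y) = c \<odot> (x \<otimes> y)"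
    and bracket_self: "x \<in> carrier L \<Longrightarrow> x \<otimes> x = \<zero>"
    and jacobi: "\<lbrakk>x \<in> carrier L; y \<in> carrier L; z \<in> carrier L\<rbrakk>
      \<Longrightarrow> x \<otimes> (y \<otimes> z) \<oplus> y \<otimes> (z \<otimes> x) \<oplus> z \<otimes> (x \<otimes> y) = \<zero>"

definition lie_subalgebra ::
    "('f, 'r) ring_scheme \<Rightarrow> 'a set \<Rightarrow> ('f, 'a, 'm) module_scheme \<Rightarrow> bool" where
  "lie_subalgebra F S L \<longleftrightarrow> subspace F S L \<and> (\<forall>x\<in>S. \<forall>y\<in>S. x \<otimes>\<^bsub>L\<^esub> y \<in> S)"

definition lie_ideal ::
    "('f, 'r) ring_scheme \<Rightarrow> 'a set \<Rightarrow> ('f, 'a, 'm) module_scheme \<Rightarrow> bool" where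
  "lie_ideal F I L \<longleftrightarrow> subspace F I L \<and> (\<forall>x\<in>carrier L. \<forall>y\<in>I. x \<otimes>\<^bsub>L\<^esub> y \<in> I)"

text \<open>
  The operations on cosets are unions of cosets, as in \<^const>\<open>rcoset_mult\<close>. For scalar
  multiplication the elementwise image would be wrong at the scalar 0, where it yields the set
  containing only 0 instead of the coset \<open>I\<close>. The value of \<^const>\<open>one\<close> is irrelevant.
\<close>
definition lie_quotient ::
    "('f, 'a, 'm) module_scheme \<Rightarrow> 'a set \<Rightarrow> ('f, 'a set) module" where
  "lie_quotient L I =
    \<lparr>carrier = a_rcosets\<^bsub>L\<^esub> I, mult = rcoset_mult L I, one = I, zero = I, add = set_add L,
     smult = (\<lambda>c X. \<Union>x\<in>X. I +>\<^bsub>L\<^esub> (c \<odot>\<^bsub>L\<^esub> x))\<rparr>"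

definition lie_product ::
    "('f, 'r) ring_scheme \<Rightarrow> ('f, 'a, 'm) module_scheme \<Rightarrow> 'a set \<Rightarrow> 'a set \<Rightarrow> 'a set" where
  "lie_product F L S T = module.span F L {x \<otimes>\<^bsub>L\<^esub> y | x y. x \<in> S \<and> y \<in> T}"

primrec derived_series ::
    "('f, 'r) ring_scheme \<Rightarrow> ('f, 'a, 'm) module_scheme \<Rightarrow> nat \<Rightarrow> 'a set" where
  "derived_series F L 0 = carrier L"
| "derived_series F L (Suc i) = lie_product F L (derived_series F L i) (derived_series F L i)"

definition lie_solvable ::
    "('f, 'r) ring_scheme \<Rightarrow> ('f, 'a, 'm) module_scheme \<Rightarrow> bool" where
  "lie_solvable F L \<longleftrightarrow> (\<exists>r. derived_series F L r = {\<zero>\<^bsub>L\<^esub>})"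

definition solvability_index ::
    "('f, 'r) ring_scheme \<Rightarrow> ('f, 'a, 'm) module_scheme \<Rightarrow> nat" where
  "solvability_index F L = (LEAST r. derived_series F L r = {\<zero>\<^bsub>L\<^esub>})"

primrec lower_central_series ::
    "('f, 'r) ring_scheme \<Rightarrow> ('f, 'a, 'm) module_scheme \<Rightarrow> nat \<Rightarrow> 'a set" where
  "lower_central_series F L 0 = carrier L"
| "lower_central_series F L (Suc i) = lie_product F L (carrier L) (lower_central_series F L i)"

definition lie_nilpotent ::
    "('f, 'r) ring_scheme \<Rightarrow> ('f, 'a, 'm) module_scheme \<Rightarrow> bool" where
  "lie_nilpotent F L \<longleftrightarrow> (\<exists>n. lower_central_series F L n = {\<zero>\<^bsub>L\<^esub>})"

definition nilpotent_ideal ::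
    "('f, 'r) ring_scheme \<Rightarrow> 'a set \<Rightarrow> ('f, 'a, 'm) module_scheme \<Rightarrow> bool" where
  "nilpotent_ideal F I L \<longleftrightarrow> lie_ideal F I L \<and> lie_nilpotent F (L\<lparr>carrier := I\<rparr>)"

text \<open>The largest nilpotent ideal; it exists when \<open>L\<close> is finite-dimensional.\<close>
definition nilradical ::
    "('f, 'r) ring_scheme \<Rightarrow> ('f, 'a, 'm) module_scheme \<Rightarrow> 'a set" where
  "nilradical F L =
    (THE N. nilpotent_ideal F N L \<and> (\<forall>I. nilpotent_ideal F I L \<longrightarrow> I \<subseteq> N))"

text \<open>
  The requirement $N_{i+1}(L)/N_i(L) = N(L/N_i(L))$ says that $N_{i+1}(L)$ is the preimage in
  $L$ of the nilradical of $L/N_i(L)$.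
\<close>
primrec upper_nilpotent_series ::
    "('f, 'r) ring_scheme \<Rightarrow> ('f, 'a, 'm) module_scheme \<Rightarrow> nat \<Rightarrow> 'a set" where
  "upper_nilpotent_series F L 0 = {\<zero>\<^bsub>L\<^esub>}"
| "upper_nilpotent_series F L (Suc i) =
    {x \<in> carrier L. upper_nilpotent_series F L i +>\<^bsub>L\<^esub> x
       \<in> nilradical F (lie_quotient L (upper_nilpotent_series F L i))}"

definition nilpotent_length ::
    "('f, 'r) ring_scheme \<Rightarrow> ('f, 'a, 'm) module_scheme \<Rightarrow> nat" where
  "nilpotent_length F L = (LEAST m. upper_nilpotent_series F L m = carrier L)"

text \<open>
  The class $\mathcal{N}(\leq m)$. The first conjunct makes \<^const>\<open>nilpotent_length\<close> meaningful;
  it holds for every solvable \<open>L\<close>.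
\<close>
definition nilpotent_length_le ::
    "('f, 'r) ring_scheme \<Rightarrow> nat \<Rightarrow> ('f, 'a, 'm) module_scheme \<Rightarrow> bool" where
  "nilpotent_length_le F m L \<longleftrightarrow>
    (\<exists>k. upper_nilpotent_series F L k = carrier L) \<and> nilpotent_length F L \<le> m"

definition nilpotent_by_abelian ::
    "('f, 'r) ring_scheme \<Rightarrow> ('f, 'a, 'm) module_scheme \<Rightarrow> bool" where
  "nilpotent_by_abelian F L \<longleftrightarrow>
    lie_nilpotent F (L\<lparr>carrier := lie_product F L (carrier L) (carrier L)\<rparr>)"

definition minimal_non ::
    "('f, 'r) ring_scheme \<Rightarrow> (('f, 'a, 'm) module_scheme \<Rightarrow> bool)
      \<Rightarrow> ('f, 'a, 'm) module_scheme \<Rightarrow> bool" where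
  "minimal_non F X L \<longleftrightarrow>
    (\<forall>S. lie_subalgebra F S L \<and> S \<noteq> carrier L \<longrightarrow> X (L\<lparr>carrier := S\<rparr>)) \<and> \<not> X L"

definition maximal_subalgebra ::
    "('f, 'r) ring_scheme \<Rightarrow> 'a set \<Rightarrow> ('f, 'a, 'm) module_scheme \<Rightarrow> bool" where
  "maximal_subalgebra F M L \<longleftrightarrow> lie_subalgebra F M L \<and> M \<noteq> carrier L \<and>
    (\<forall>S. lie_subalgebra F S L \<and> M \<subseteq> S \<longrightarrow> S = M \<or> S = carrier L)"

definition frattini ::
    "('f, 'r) ring_scheme \<Rightarrow> ('f, 'a, 'm) module_scheme \<Rightarrow> 'a set" where
  "frattini F L = {x \<in> carrier L. \<forall>M. maximal_subalgebra F M L \<longrightarrow> x \<in> M}"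

definition minimal_ideal ::
    "('f, 'r) ring_scheme \<Rightarrow> 'a set \<Rightarrow> ('f, 'a, 'm) module_scheme \<Rightarrow> bool" where
  "minimal_ideal F A L \<longleftrightarrow> lie_ideal F A L \<and> A \<noteq> {\<zero>\<^bsub>L\<^esub>} \<and>
    (\<forall>I. lie_ideal F I L \<and> I \<subseteq> A \<longrightarrow> I = {\<zero>\<^bsub>L\<^esub>} \<or> I = A)"

text \<open>\<open>V\<close> is the direct sum of its subspaces \<open>U\<close> and \<open>W\<close>.\<close>
definition is_direct_sum ::
    "('f, 'a, 'm) module_scheme \<Rightarrow> 'a set \<Rightarrow> 'a set \<Rightarrow> 'a set \<Rightarrow> bool" where
  "is_direct_sum L V U W \<longleftrightarrow> V = U <+>\<^bsub>L\<^esub> W \<and> U \<inter> W = {\<zero>\<^bsub>L\<^esub>}"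

definition characteristic :: "('f, 'r) ring_scheme \<Rightarrow> nat" where
  "characteristic F = (if \<exists>n::nat. n > 0 \<and> [n] \<cdot>\<^bsub>F\<^esub> \<one>\<^bsub>F\<^esub> = \<zero>\<^bsub>F\<^esub>
     then LEAST n. n > 0 \<and> [n] \<cdot>\<^bsub>F\<^esub> \<one>\<^bsub>F\<^esub> = \<zero>\<^bsub>F\<^esub> else 0)"

text \<open>The conditions which, for a minimal non-(nilpotent-by-abelian) \<open>L\<close>, define type I.\<close>
definition type_I ::
    "('f, 'r) ring_scheme \<Rightarrow> ('f, 'a, 'm) module_scheme \<Rightarrow> bool" where
  "type_I F L \<longleftrightarrow> characteristic F > 0 \<and>
    (let Q = lie_quotient L (frattini F L) in
      \<exists>A B M x.
        minimal_ideal F A Q \<and> (\<forall>A'. minimal_ideal F A' Q \<longrightarrow> A' = A) \<and>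
        vectorspace.dim F (Q\<lparr>carrier := A\<rparr>) \<ge> 2 \<and>
        lie_product F Q A A = {\<zero>\<^bsub>Q\<^esub>} \<and>
        lie_subalgebra F B Q \<and> is_direct_sum Q (carrier Q) A B \<and>
        minimal_ideal F M (Q\<lparr>carrier := B\<rparr>) \<and>
        lie_product F Q M M = {\<zero>\<^bsub>Q\<^esub>} \<and>
        x \<in> B \<and> x \<noteq> \<zero>\<^bsub>Q\<^esub> \<and>
        is_direct_sum Q B M {c \<odot>\<^bsub>Q\<^esub> x | c. c \<in> carrier F})"

end

theory Submission
  imports Defs
begin

text \<open>
  Put $Q = L/\phi(L)$. An ideal of $L$ containing $\phi(L)$ is nilpotent as soon as it is nilpotent
  modulo $\phi(L)$, so the question is about $Q$ and preimages of ideals of $Q$.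

  If $L$ is minimal non-$\mathcal{N}(\leq 2)$, then $Q$ has a unique minimal ideal $A$, complemented
  by a subalgebra $C$ acting faithfully and irreducibly on $A$; as $L^{(3)} = 0$, the derived algebra
  of $C$ is abelian, while $C$ is not nilpotent. Pick $x \in C$ with $\mathrm{ad}\,x$ not nilpotent
  and a minimal ideal $M$ of $C$ inside the Fitting one-component of $\mathrm{ad}\,x$ on $[C,C]$,
  so that $[x,M] = M$. Were $A + M + Fx$ proper, it would have nilpotent length at most 2 and $M$
  would act nilpotently on $A$, contradicting faithfulness; hence $C = M + Fx$. In characteristic 0,
  Jacobson's lemma makes every element of $M = [x,M]$ act nilpotently on $A$, the same contradiction.
  A maximal subalgebra of $Q$ containing $A$ meets $C$ in an abelian subalgebra, and one not
  containing $A$ is a complement of $A$ and has nilpotent length at most 2; in either case its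
  preimage in $L$ has nilpotent derived algebra.

  Conversely, in type I a nilpotent ideal of $Q$ lies in $A$, so $L \in \mathcal{N}(\leq 2)$ would
  force $C$ to be nilpotent, hence abelian, and the derived algebra of $L$ to be nilpotent.
\<close>

text \<open>The obstacle is that neither the field nor its characteristic is restricted, so
  exponentials of \<open>ad a\<close> and eigenvectors are not at hand. The former are replaced by
  \<open>1 - ad a\<close>, with a in an ideal whose derived algebra is factored out, where it is
  already an automorphism; the latter by annihilated vectors: whatever acts nilpotently on A kills a
  non-zero vector, and irreducibility spreads this over A. C has abelian derived algebra for the
  following reason: Q'' is 0 or contains A, and [Q'',Q''] = 0, so Q'' centralises A, and the
  faithful C meets it in 0. A is the only minimal ideal because for two of them, A and A', the
  algebra Q would embed in the product of Q/A and Q/A', which are isomorphic to proper subalgebras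
  and so have nilpotent length at most 2. The bound dim A \<ge> 2 reflects that operators on a line
  commute, whereas M = [x,M] acts faithfully. All this happens on subsets of one carrier, with
  ideals and nilpotency relative to a subset; nilradicals and cosets enter only in the final
  translation.\<close>

context lie_algebra
begin

section \<open>Subspaces, their sums and lines\<close>

abbreviation sub where "sub W \<equiv> subspace F W L"

lemma subD:
  assumes "sub W"
  shows sub_subset: "W \<subseteq> carrier L"
    and sub_zero: "\<zero> \<in> W"
    and sub_add: "\<And>x y. x \<in> W \<Longrightarrow> y \<in> W \<Longrightarrow> x \<oplus> y \<in> W"
    and sub_smult: "\<And>c x. c \<in> carrier F \<Longrightarrow> x \<in> W \<Longrightarrow> c \<odot> x \<in> W"
  using assms unfolding subspace_def submodule_def by auto

lemma sub_carrier: "sub W \<Longrightarrow> x \<in> W \<Longrightarrow> x \<in> carrier L"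
  using sub_subset by blast

lemma sub_neg: "sub W \<Longrightarrow> x \<in> W \<Longrightarrow> \<ominus> x \<in> W"
  by (metis R.add.inv_closed R.one_closed sub_carrier sub_smult smult_minus_1)

lemma sub_minus: "sub W \<Longrightarrow> x \<in> W \<Longrightarrow> y \<in> W \<Longrightarrow> x \<ominus> y \<in> W"
  by (simp add: M.minus_eq sub_add sub_neg)

lemma subI:
  assumes "W \<subseteq> carrier L" "\<zero> \<in> W"
    and "\<And>x y. x \<in> W \<Longrightarrow> y \<in> W \<Longrightarrow> x \<oplus> y \<in> W"
    and "\<And>c x. c \<in> carrier F \<Longrightarrow> x \<in> W \<Longrightarrow> c \<odot> x \<in> W"
  shows "sub W"
  using assms vectorspace_axioms module_axioms unfolding subspace_def submodule_def by auto

lemma sub_whole: "sub (carrier L)"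
  by (rule subI) auto

lemma sub_trivial: "sub {\<zero>}"
  by (rule subI) auto

lemma sub_Int: "sub U \<Longrightarrow> sub W \<Longrightarrow> sub (U \<inter> W)"
  by (rule subI) (auto simp: sub_zero sub_add sub_smult dest: sub_carrier)

abbreviation subspace_plus (infixl "\<boxplus>" 65) where "U \<boxplus> W \<equiv> set_add L U W"

lemma set_add_iff: "x \<in> U \<boxplus> W \<longleftrightarrow> (\<exists>u\<in>U. \<exists>w\<in>W. x = u \<oplus> w)"
  unfolding set_add_def set_mult_def by auto

lemma set_addI: "u \<in> U \<Longrightarrow> w \<in> W \<Longrightarrow> u \<oplus> w \<in> U \<boxplus> W"
  using set_add_iff by blast

lemma sub_plus:
  assumes "sub U" "sub W"
  shows "sub (U \<boxplus> W)"
proof (rule subI)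
  show "U \<boxplus> W \<subseteq> carrier L"
    using sub_carrier[OF assms(1)] sub_carrier[OF assms(2)] by (auto simp: set_add_iff)
  show "\<zero> \<in> U \<boxplus> W"
    using set_addI[OF sub_zero[OF assms(1)] sub_zero[OF assms(2)]] by simp
next
  fix x y assume "x \<in> U \<boxplus> W" "y \<in> U \<boxplus> W"
  then obtain u w u' w' where *: "u \<in> U" "w \<in> W" "u' \<in> U" "w' \<in> W" "x = u \<oplus> w" "y = u' \<oplus> w'"
    unfolding set_add_iff by blast
  have "x \<oplus> y = (u \<oplus> u') \<oplus> (w \<oplus> w')"
    using * assms by (simp add: sub_carrier M.a_ac)
  then show "x \<oplus> y \<in> U \<boxplus> W"
    using * assms by (metis set_addI sub_add)
next
  fix c x assume c: "c \<in> carrier F" and "x \<in> U \<boxplus> W"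
  then obtain u w where *: "u \<in> U" "w \<in> W" "x = u \<oplus> w"
    unfolding set_add_iff by blast
  then have "c \<odot> x = c \<odot> u \<oplus> c \<odot> w"
    using c assms by (simp add: sub_carrier smult_r_distr)
  then show "c \<odot> x \<in> U \<boxplus> W"
    using * c assms by (metis set_addI sub_smult)
qed

lemma plus_left: "sub U \<Longrightarrow> sub W \<Longrightarrow> U \<subseteq> U \<boxplus> W"
  using set_addI[OF _ sub_zero[of W], of _ U] sub_carrier[of U] by (metis M.r_zero subsetI)

lemma plus_right: "sub U \<Longrightarrow> sub W \<Longrightarrow> W \<subseteq> U \<boxplus> W"
  using set_addI[OF sub_zero[of U], of _ W] sub_carrier[of W] by (metis M.l_zero subsetI)

lemma plus_least: "sub V \<Longrightarrow> U \<subseteq> V \<Longrightarrow> W \<subseteq> V \<Longrightarrow> U \<boxplus> W \<subseteq> V"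
  using sub_add by (auto simp: set_add_iff subset_iff)

lemma plus_mono: "U \<subseteq> U' \<Longrightarrow> W \<subseteq> W' \<Longrightarrow> U \<boxplus> W \<subseteq> U' \<boxplus> W'"
  unfolding subset_iff set_add_iff by blast

lemma plus_eq_right: "sub U \<Longrightarrow> sub W \<Longrightarrow> U \<subseteq> W \<Longrightarrow> U \<boxplus> W = W"
  by (simp add: plus_least plus_right subset_antisym)

text \<open>Written as a set of multiples, not as a span, so that it matches the summand Fx in
  \<open>type_I\<close> literally.\<close>

definition line where "line x = {c \<odot> x | c. c \<in> carrier F}"

lemma sub_line:
  assumes x: "x \<in> carrier L"
  shows "sub (line x)"
proof (rule subI)
  show "line x \<subseteq> carrier L" using x by (auto simp: line_def)
  have "\<zero> = \<zero>\<^bsub>F\<^esub> \<odot> x" using x by simp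
  then show "\<zero> \<in> line x" unfolding line_def using R.zero_closed by blast
next
  fix a b assume "a \<in> line x" "b \<in> line x"
  then obtain c d where "c \<in> carrier F" "d \<in> carrier F" "a = c \<odot> x" "b = d \<odot> x"
    unfolding line_def by blast
  then have "a \<oplus> b = (c \<oplus>\<^bsub>F\<^esub> d) \<odot> x" "c \<oplus>\<^bsub>F\<^esub> d \<in> carrier F"
    using x by (simp_all add: smult_l_distr)
  then show "a \<oplus> b \<in> line x" unfolding line_def by blast
next
  fix c a assume "c \<in> carrier F" "a \<in> line x"
  then obtain d where "c \<in> carrier F" "d \<in> carrier F" "a = d \<odot> x" unfolding line_def by blast
  then have "c \<odot> a = (c \<otimes>\<^bsub>F\<^esub> d) \<odot> x" "c \<otimes>\<^bsub>F\<^esub> d \<in> carrier F"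
    using x by (simp_all add: smult_assoc1)
  then show "c \<odot> a \<in> line x" unfolding line_def by blast
qed

lemma line_self: "x \<in> carrier L \<Longrightarrow> x \<in> line x"
  unfolding line_def using smult_one by force

lemma line_least: "sub W \<Longrightarrow> x \<in> W \<Longrightarrow> line x \<subseteq> W"
  by (auto simp: line_def sub_smult)

lemma smult_cancel:
  assumes "sub W" "x \<in> carrier L" "c \<in> carrier F" "c \<noteq> \<zero>\<^bsub>F\<^esub>" "c \<odot> x \<in> W"
  shows "x \<in> W"
proof -
  have "inv\<^bsub>F\<^esub> c \<in> carrier F" using assms by simp
  moreover have "x = inv\<^bsub>F\<^esub> c \<odot> (c \<odot> x)"
    using mult_inverse assms by blast
  ultimately show ?thesis using assms sub_smult by metis
qed

lemma minus_add_cancel: "x \<in> carrier L \<Longrightarrow> y \<in> carrier L \<Longrightarrow> x \<ominus> y \<oplus> y = x"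
  by (simp add: M.minus_eq M.a_assoc M.l_neg)

lemma add_minus_cancel: "x \<in> carrier L \<Longrightarrow> y \<in> carrier L \<Longrightarrow> x \<oplus> y \<ominus> y = x"
  by (simp add: M.minus_eq M.a_assoc M.r_neg)

lemma sub_diff_iff:
  assumes "sub W" "x \<in> carrier L" "y \<in> W"
  shows "x \<oplus> y \<in> W \<longleftrightarrow> x \<in> W" "y \<oplus> x \<in> W \<longleftrightarrow> x \<in> W" "x \<ominus> y \<in> W \<longleftrightarrow> x \<in> W"
proof -
  show *: "x \<oplus> y \<in> W \<longleftrightarrow> x \<in> W"
    using assms sub_add sub_minus add_minus_cancel sub_carrier by metis
  then show "y \<oplus> x \<in> W \<longleftrightarrow> x \<in> W"
    using assms sub_carrier M.add.m_comm by metis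
  show "x \<ominus> y \<in> W \<longleftrightarrow> x \<in> W"
    using assms sub_add sub_minus minus_add_cancel sub_carrier by metis
qed

subsection \<open>Brackets of subspaces\<close>

lemma bracket_zero [simp]:
  assumes "x \<in> carrier L" shows "x \<otimes> \<zero> = \<zero>" "\<zero> \<otimes> x = \<zero>"
proof -
  have "x \<otimes> (\<zero>\<^bsub>F\<^esub> \<odot> \<zero>) = \<zero>\<^bsub>F\<^esub> \<odot> (x \<otimes> \<zero>)"
    using assms by (intro bracket_smult_right) auto
  then show "x \<otimes> \<zero> = \<zero>" using assms by (simp add: bracket_closed)
  have "(\<zero>\<^bsub>F\<^esub> \<odot> \<zero>) \<otimes> x = \<zero>\<^bsub>F\<^esub> \<odot> (\<zero> \<otimes> x)"
    using assms by (intro bracket_smult_left) auto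
  then show "\<zero> \<otimes> x = \<zero>" using assms by (simp add: bracket_closed)
qed

lemma bracket_neg:
  assumes "x \<in> carrier L" "y \<in> carrier L"
  shows "x \<otimes> \<ominus> y = \<ominus> (x \<otimes> y)" "\<ominus> x \<otimes> y = \<ominus> (x \<otimes> y)"
  using assms bracket_smult_left[of "\<ominus>\<^bsub>F\<^esub> \<one>\<^bsub>F\<^esub>" x y] bracket_smult_right[of "\<ominus>\<^bsub>F\<^esub> \<one>\<^bsub>F\<^esub>" x y]
  by (simp_all add: smult_minus_1 bracket_closed)

lemma bracket_minus:
  assumes "x \<in> carrier L" "y \<in> carrier L" "z \<in> carrier L"
  shows "x \<otimes> (y \<ominus> z) = x \<otimes> y \<ominus> x \<otimes> z" "(x \<ominus> y) \<otimes> z = x \<otimes> z \<ominus> y \<otimes> z"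
  using assms by (simp_all add: M.minus_eq bracket_add_left bracket_add_right bracket_neg)

lemma anticomm:
  assumes x: "x \<in> carrier L" and y: "y \<in> carrier L"
  shows "x \<otimes> y = \<ominus> (y \<otimes> x)"
proof -
  have "\<zero> = (x \<oplus> y) \<otimes> (x \<oplus> y)" using x y by (simp add: bracket_self)
  also have "\<dots> = x \<otimes> y \<oplus> y \<otimes> x"
    using x y by (simp add: bracket_add_left bracket_add_right bracket_closed bracket_self[OF x]
        bracket_self[OF y] M.a_comm)
  finally show ?thesis using x y M.minus_equality[of "x \<otimes> y" "y \<otimes> x"] by (simp add: bracket_closed)
qed

text \<open>Bracketing with \<open>x\<close> is a derivation. In this shape the Jacobi identity
  feeds the later inductions without any cyclic permutation to undo.\<close>

lemma jacobi_left:
  assumes "x \<in> carrier L" "y \<in> carrier L" "z \<in> carrier L"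
  shows "x \<otimes> (y \<otimes> z) = (x \<otimes> y) \<otimes> z \<oplus> y \<otimes> (x \<otimes> z)"
proof -
  have *: "x \<otimes> y \<in> carrier L" "x \<otimes> z \<in> carrier L" "y \<otimes> z \<in> carrier L"
    using assms bracket_closed by auto
  have "x \<otimes> (y \<otimes> z) \<oplus> (y \<otimes> (z \<otimes> x) \<oplus> z \<otimes> (x \<otimes> y)) = \<zero>"
    using jacobi[OF assms] assms * by (simp add: M.a_assoc bracket_closed)
  moreover have "y \<otimes> (z \<otimes> x) = \<ominus> (y \<otimes> (x \<otimes> z))"
    using anticomm[of z x] bracket_neg(1)[of y "x \<otimes> z"] assms * by simp
  moreover have "z \<otimes> (x \<otimes> y) = \<ominus> ((x \<otimes> y) \<otimes> z)"
    using anticomm assms * by blast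
  ultimately have "x \<otimes> (y \<otimes> z) \<oplus> \<ominus> ((x \<otimes> y) \<otimes> z \<oplus> y \<otimes> (x \<otimes> z)) = \<zero>"
    using assms * by (simp add: M.minus_add M.a_comm bracket_closed)
  then show ?thesis
    using assms * by (metis M.add.m_closed M.minus_eq bracket_closed minus_other_side)
qed

lemma jacobi_right:
  assumes "x \<in> carrier L" "y \<in> carrier L" "z \<in> carrier L"
  shows "(x \<otimes> y) \<otimes> z = x \<otimes> (y \<otimes> z) \<ominus> y \<otimes> (x \<otimes> z)"
  using jacobi_left[OF assms] assms by (simp add: add_minus_cancel bracket_closed)

abbreviation br where "br X Y \<equiv> lie_product F L X Y"

lemma br_in:
  assumes "X \<subseteq> carrier L" "Y \<subseteq> carrier L" "x \<in> X" "y \<in> Y"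
  shows "x \<otimes> y \<in> br X Y"
proof -
  have "{x \<otimes> y | x y. x \<in> X \<and> y \<in> Y} \<subseteq> carrier L"
    using assms(1,2) by (auto intro: bracket_closed)
  from span_mem[OF this] show ?thesis
    unfolding lie_product_def using assms(3,4) by blast
qed

lemma br_sub:
  assumes "X \<subseteq> carrier L" "Y \<subseteq> carrier L"
  shows "sub (br X Y)"
  unfolding lie_product_def using assms by (intro span_is_subspace) (auto intro: bracket_closed)

lemma br_least:
  assumes "sub W" "\<And>x y. x \<in> X \<Longrightarrow> y \<in> Y \<Longrightarrow> x \<otimes> y \<in> W"
  shows "br X Y \<subseteq> W"
  unfolding lie_product_def using assms by (intro span_is_subset) auto

lemma br_mono:
  assumes "X \<subseteq> X'" "Y \<subseteq> Y'"
  shows "br X Y \<subseteq> br X' Y'"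
  unfolding lie_product_def using assms by (intro span_is_monotone) auto

lemma br_commute_le:
  assumes "X \<subseteq> carrier L" "Y \<subseteq> carrier L"
  shows "br X Y \<subseteq> br Y X"
proof (rule br_least[OF br_sub[OF assms(2,1)]])
  fix x y assume "x \<in> X" "y \<in> Y"
  then show "x \<otimes> y \<in> br Y X"
    using assms anticomm[of x y] br_in[OF assms(2,1)] sub_neg[OF br_sub[OF assms(2,1)]]
    by (metis subsetD)
qed

lemma br_commute: "X \<subseteq> carrier L \<Longrightarrow> Y \<subseteq> carrier L \<Longrightarrow> br X Y = br Y X"
  using br_commute_le by blast

lemma br_plus_left:
  assumes "sub W" "sub X" "sub Y" "sub V" "br X V \<subseteq> W" "br Y V \<subseteq> W"
  shows "br (X \<boxplus> Y) V \<subseteq> W"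
proof (rule br_least[OF assms(1)])
  fix z v assume "z \<in> X \<boxplus> Y" and v: "v \<in> V"
  then obtain x y where *: "x \<in> X" "y \<in> Y" "z = x \<oplus> y" unfolding set_add_iff by blast
  have "x \<otimes> v \<in> W" "y \<otimes> v \<in> W"
    using br_in[OF sub_subset[OF assms(2)] sub_subset[OF assms(4)] *(1) v]
      br_in[OF sub_subset[OF assms(3)] sub_subset[OF assms(4)] *(2) v] assms(5,6) by auto
  moreover have "x \<in> carrier L" "y \<in> carrier L" "v \<in> carrier L"
    using * v assms(2-4) sub_carrier by metis+
  ultimately show "z \<otimes> v \<in> W"
    using *(3) assms(1) by (simp add: bracket_add_left sub_add)
qed

lemma br_plus_right:
  assumes "sub W" "sub X" "sub Y" "sub V" "br V X \<subseteq> W" "br V Y \<subseteq> W"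
  shows "br V (X \<boxplus> Y) \<subseteq> W"
  using br_plus_left[OF assms(1-4)] br_commute assms sub_subset sub_plus by metis

lemma sub_preimage:
  assumes "sub V" "sub W" "a \<in> carrier L"
  shows "sub {z \<in> V. a \<otimes> z \<in> W}"
proof (rule subI)
  show "{z \<in> V. a \<otimes> z \<in> W} \<subseteq> carrier L" using assms sub_carrier by blast
  show "\<zero> \<in> {z \<in> V. a \<otimes> z \<in> W}" using assms by (simp add: sub_zero)
  show "x \<oplus> y \<in> {z \<in> V. a \<otimes> z \<in> W}"
    if "x \<in> {z \<in> V. a \<otimes> z \<in> W}" "y \<in> {z \<in> V. a \<otimes> z \<in> W}" for x y
    using that assms sub_carrier[OF assms(1)] by (simp add: bracket_add_right sub_add)
  show "c \<odot> x \<in> {z \<in> V. a \<otimes> z \<in> W}"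
    if "c \<in> carrier F" "x \<in> {z \<in> V. a \<otimes> z \<in> W}" for c x
    using that assms sub_carrier[OF assms(1)] by (simp add: bracket_smult_right sub_smult)
qed

text \<open>Annihilators and centralisers are instances: for \<open>W = {\<zero>}\<close> this is
  the part of \<open>V\<close> annihilated by \<open>N\<close>, and for a larger \<open>W\<close>
  the part that centralises a factor.\<close>

lemma sub_transporter:
  assumes V: "sub V" and W: "sub W" and N: "N \<subseteq> carrier L"
  shows "sub {z \<in> V. \<forall>a\<in>N. a \<otimes> z \<in> W}"
proof (rule subI)
  note s = sub_preimage[OF V W subsetD[OF N]]
  show "{z \<in> V. \<forall>a\<in>N. a \<otimes> z \<in> W} \<subseteq> carrier L" using sub_subset[OF V] by blast
  show "\<zero> \<in> {z \<in> V. \<forall>a\<in>N. a \<otimes> z \<in> W}" using sub_zero[OF s] sub_zero[OF V] by simp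
  show "x \<oplus> y \<in> {z \<in> V. \<forall>a\<in>N. a \<otimes> z \<in> W}"
    if "x \<in> {z \<in> V. \<forall>a\<in>N. a \<otimes> z \<in> W}" "y \<in> {z \<in> V. \<forall>a\<in>N. a \<otimes> z \<in> W}" for x y
    using that sub_add[OF s, of _ x y] sub_add[OF V] by simp
  show "c \<odot> x \<in> {z \<in> V. \<forall>a\<in>N. a \<otimes> z \<in> W}"
    if "c \<in> carrier F" "x \<in> {z \<in> V. \<forall>a\<in>N. a \<otimes> z \<in> W}" for c x
    using that sub_smult[OF s, of _ c x] sub_smult[OF V] by simp
qed

text \<open>By the derivation rule \<open>a\<close> acts on one factor of a product at a time, and
  linearity extends this from products to their span. Invariance of \<open>br\<close> under an
  element that acts on both factors reduces to this.\<close>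

lemma bracket_br:
  assumes a: "a \<in> carrier L" and U: "U \<subseteq> carrier L" and V: "V \<subseteq> carrier L" and W: "sub W"
    and l: "\<And>u v. u \<in> U \<Longrightarrow> v \<in> V \<Longrightarrow> (a \<otimes> u) \<otimes> v \<in> W"
    and r: "\<And>u v. u \<in> U \<Longrightarrow> v \<in> V \<Longrightarrow> u \<otimes> (a \<otimes> v) \<in> W"
    and z: "z \<in> br U V"
  shows "a \<otimes> z \<in> W"
proof -
  have "br U V \<subseteq> {z \<in> carrier L. a \<otimes> z \<in> W}"
  proof (rule br_least[OF sub_preimage[OF sub_whole W a]])
    fix u v assume uv: "u \<in> U" "v \<in> V"
    then have "u \<in> carrier L" "v \<in> carrier L" using U V by auto
    moreover from this have "a \<otimes> (u \<otimes> v) \<in> W"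
      using jacobi_left[OF a] sub_add[OF W l[OF uv] r[OF uv]] by simp
    ultimately show "u \<otimes> v \<in> {z \<in> carrier L. a \<otimes> z \<in> W}" by (simp add: bracket_closed)
  qed
  then show ?thesis using z by blast
qed

lemma br_line_line:
  assumes "x \<in> carrier L" "sub W"
  shows "br (line x) (line x) \<subseteq> W"
proof (rule br_least[OF assms(2)])
  fix a b assume "a \<in> line x" "b \<in> line x"
  then have "a \<otimes> b = \<zero>" using assms
    by (auto simp: line_def bracket_smult_left bracket_smult_right bracket_self)
  then show "a \<otimes> b \<in> W" using sub_zero[OF assms(2)] by simp
qed

lemma br_line_left:
  assumes "x \<in> carrier L" "sub W" "sub V" "\<And>v. v \<in> V \<Longrightarrow> x \<otimes> v \<in> W"
  shows "br (line x) V \<subseteq> W"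
proof (rule br_least[OF assms(2)])
  fix a v assume "a \<in> line x" and v: "v \<in> V"
  then obtain c where "c \<in> carrier F" "a = c \<odot> x" unfolding line_def by blast
  then show "a \<otimes> v \<in> W"
    using bracket_smult_left[of c x v] sub_smult[OF assms(2) _ assms(4)[OF v]] assms(1)
      sub_carrier[OF assms(3) v] by simp
qed

subsection \<open>Subalgebras and ideals of subalgebras\<close>

abbreviation alg where "alg S \<equiv> lie_subalgebra F S L"

text \<open>Ideals relative to a subset of the one ambient carrier, so that ideals of a subalgebra
  and ideals of \<open>L\<close> can be added and intersected freely. \<open>restrict_idl\<close>
  recovers the notion on the restricted record.\<close>

definition idl where
  "idl S I \<longleftrightarrow> sub I \<and> I \<subseteq> S \<and> (\<forall>x\<in>S. \<forall>y\<in>I. x \<otimes> y \<in> I)"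

lemma algD:
  shows alg_sub: "alg S \<Longrightarrow> sub S"
    and alg_bracket: "alg S \<Longrightarrow> x \<in> S \<Longrightarrow> y \<in> S \<Longrightarrow> x \<otimes> y \<in> S"
  by (auto simp: lie_subalgebra_def)

lemma idlD:
  shows idl_sub: "idl S I \<Longrightarrow> sub I"
    and idl_subset: "idl S I \<Longrightarrow> I \<subseteq> S"
    and idl_bracket: "idl S I \<Longrightarrow> x \<in> S \<Longrightarrow> y \<in> I \<Longrightarrow> x \<otimes> y \<in> I"
  by (auto simp: idl_def)

lemma idlI:
  assumes "sub I" "I \<subseteq> S" "\<And>x y. x \<in> S \<Longrightarrow> y \<in> I \<Longrightarrow> x \<otimes> y \<in> I"
  shows "idl S I"
  using assms unfolding idl_def by simp

lemma algI:
  assumes "sub S" "\<And>x y. x \<in> S \<Longrightarrow> y \<in> S \<Longrightarrow> x \<otimes> y \<in> S"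
  shows "alg S"
  using assms unfolding lie_subalgebra_def by simp

lemma idlD2:
  assumes "idl S I" "sub S" "x \<in> S" "y \<in> I"
  shows "y \<otimes> x \<in> I"
  using anticomm[OF sub_carrier[OF idl_sub[OF assms(1)] assms(4)] sub_carrier[OF assms(2,3)]]
    sub_neg[OF idl_sub[OF assms(1)] idl_bracket[OF assms(1,3,4)]] by simp

lemma alg_br: "alg S \<Longrightarrow> br S S \<subseteq> S"
  by (rule br_least[OF alg_sub alg_bracket])

lemma idl_br: "idl S I \<Longrightarrow> br S I \<subseteq> I"
  by (rule br_least[OF idl_sub idl_bracket])

lemma idl_br': "idl S I \<Longrightarrow> sub S \<Longrightarrow> br I S \<subseteq> I"
  by (rule br_least[OF idl_sub idlD2])

lemma alg_whole: "alg (carrier L)"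
  by (simp add: lie_subalgebra_def sub_whole bracket_closed)

lemma lie_ideal_iff: "lie_ideal F I L \<longleftrightarrow> idl (carrier L) I"
  unfolding lie_ideal_def idl_def using sub_subset[of I] by metis

lemma idl_alg: "idl S I \<Longrightarrow> alg I"
  by (metis algI idlD subsetD)

lemma idl_restrict: "idl S I \<Longrightarrow> I \<subseteq> T \<Longrightarrow> T \<subseteq> S \<Longrightarrow> idl T I"
  unfolding idl_def by (meson subsetD)

lemma idl_Int: "idl S I \<Longrightarrow> idl S J \<Longrightarrow> idl S (I \<inter> J)"
  by (rule idlI) (simp_all add: sub_Int idl_sub idl_bracket idl_subset le_infI1)

lemma idl_plus:
  assumes "idl S I" "idl S J" "sub S"
  shows "idl S (I \<boxplus> J)"
  unfolding idl_def
proof (intro conjI ballI)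
  show "sub (I \<boxplus> J)" using assms idl_sub sub_plus by metis
  show "I \<boxplus> J \<subseteq> S" using assms idl_subset plus_least by metis
  fix x y assume x: "x \<in> S" and "y \<in> I \<boxplus> J"
  then obtain u w where *: "u \<in> I" "w \<in> J" "y = u \<oplus> w" unfolding set_add_iff by blast
  have "x \<in> carrier L" "u \<in> carrier L" "w \<in> carrier L"
    using * x assms idl_sub sub_carrier by metis+
  then have "x \<otimes> y = x \<otimes> u \<oplus> x \<otimes> w" using * bracket_add_right by simp
  then show "x \<otimes> y \<in> I \<boxplus> J"
    using set_addI[OF idl_bracket[OF assms(1) x *(1)] idl_bracket[OF assms(2) x *(2)]] by simp
qed

lemma idl_trivial: "sub S \<Longrightarrow> idl S {\<zero>}"
  by (rule idlI) (simp_all add: sub_trivial sub_zero sub_carrier[of S])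

lemma idl_self: "alg S \<Longrightarrow> idl S S"
  by (rule idlI[OF alg_sub subset_refl alg_bracket])

lemma idl_plus_alg:
  assumes "idl T I" "alg S" "S \<subseteq> T" "alg T"
  shows "alg (I \<boxplus> S)"
  unfolding lie_subalgebra_def
proof (intro conjI ballI)
  show "sub (I \<boxplus> S)" using assms idl_sub alg_sub sub_plus by metis
  fix x y assume "x \<in> I \<boxplus> S" "y \<in> I \<boxplus> S"
  then obtain u w u' w' where *: "u \<in> I" "w \<in> S" "x = u \<oplus> w" "u' \<in> I" "w' \<in> S" "y = u' \<oplus> w'"
    unfolding set_add_iff by blast
  have car: "u \<in> carrier L" "w \<in> carrier L" "u' \<in> carrier L" "w' \<in> carrier L"
    using * assms idl_sub alg_sub sub_carrier by metis+
  have "u' \<in> T" "w' \<in> T" using *(4,5) assms(3) idl_subset[OF assms(1)] by auto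
  then have y: "y \<in> T" using *(6) sub_add[OF alg_sub[OF assms(4)]] by simp
  have w: "w \<in> T" using *(2) assms(3) by auto
  \<comment> \<open>Only the last summand is free of elements of \<open>I\<close>; the other two are
    absorbed by the ideal.\<close>
  have "x \<otimes> y = (u \<otimes> y \<oplus> w \<otimes> u') \<oplus> w \<otimes> w'"
    using * car by (simp add: bracket_add_left bracket_add_right bracket_closed M.a_ac)
  moreover have "u \<otimes> y \<oplus> w \<otimes> u' \<in> I"
    using idlD2[OF assms(1) alg_sub[OF assms(4)] y *(1)] idl_bracket[OF assms(1) w *(4)]
      sub_add[OF idl_sub[OF assms(1)]] by blast
  moreover have "w \<otimes> w' \<in> S" using alg_bracket[OF assms(2) *(2,5)] .
  ultimately show "x \<otimes> y \<in> I \<boxplus> S" using set_addI by simp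
qed

lemma br_idl:
  assumes "idl S I" "idl S J" "sub S"
  shows "idl S (br I J)"
proof -
  have I: "sub I" "I \<subseteq> S" and J: "sub J" "J \<subseteq> S" using assms idl_sub idl_subset by metis+
  have sb: "sub (br I J)" using I J br_sub sub_subset by blast
  have "I \<subseteq> carrier L" "J \<subseteq> carrier L" using I J sub_subset by auto
  note brI = br_in[OF this]
  have "br I J \<subseteq> I" by (rule br_least[OF I(1)]) (use idlD2[OF assms(1,3)] J in blast)
  moreover have "x \<otimes> y \<in> br I J" if x: "x \<in> S" and y: "y \<in> br I J" for x y
  proof -
    have xc: "x \<in> carrier L" using x assms(3) sub_carrier by blast
    show ?thesis
    proof (rule bracket_br[OF xc \<open>I \<subseteq> carrier L\<close> \<open>J \<subseteq> carrier L\<close> sb _ _ y])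
      fix u w assume u: "u \<in> I" and w: "w \<in> J"
      show "(x \<otimes> u) \<otimes> w \<in> br I J" using brI[OF idl_bracket[OF assms(1) x u] w] .
      show "u \<otimes> (x \<otimes> w) \<in> br I J" using brI[OF u idl_bracket[OF assms(2) x w]] .
    qed
  qed
  ultimately show ?thesis unfolding idl_def using sb I by blast
qed

subsection \<open>Iterated brackets and nilpotency\<close>

text \<open>The nested brackets [X,[X,...,[X,V]]]. With \<open>X = V = S\<close> they are the lower
  central series of \<open>S\<close>; with \<open>V\<close> a space on which \<open>X\<close> acts
  they measure nilpotency of the action. One notion for both lets results on actions yield results
  on algebras.\<close>

definition bpow where "bpow X n V = ((br X) ^^ n) V"

lemma bpow_0 [simp]: "bpow X 0 V = V"
  and bpow_Suc: "bpow X (Suc n) V = br X (bpow X n V)"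
  by (simp_all add: bpow_def)

lemma bpow_add: "bpow X (m + n) V = bpow X m (bpow X n V)"
  by (simp add: bpow_def funpow_add)

lemma bpow_subset: "X \<subseteq> carrier L \<Longrightarrow> V \<subseteq> carrier L \<Longrightarrow> bpow X n V \<subseteq> carrier L"
  by (induction n) (auto simp: bpow_Suc dest: sub_carrier[OF br_sub])

lemma bpow_sub: "X \<subseteq> carrier L \<Longrightarrow> sub V \<Longrightarrow> sub (bpow X n V)"
  by (cases n) (simp_all add: bpow_Suc br_sub bpow_subset sub_subset)

lemma bpow_mono: "X \<subseteq> X' \<Longrightarrow> V \<subseteq> V' \<Longrightarrow> bpow X n V \<subseteq> bpow X' n V'"
  by (induction n) (simp_all add: bpow_Suc br_mono)

lemma bpow_invariant: "sub W \<Longrightarrow> br X W \<subseteq> W \<Longrightarrow> V \<subseteq> W \<Longrightarrow> bpow X n V \<subseteq> W"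
proof (induction n)
  case (Suc n)
  then show ?case using br_mono[of X X "bpow X n V" W] unfolding bpow_Suc by blast
qed simp

lemma bpow_decr:
  assumes "sub V" "br X V \<subseteq> V" "m \<le> n"
  shows "bpow X n V \<subseteq> bpow X m V"
proof -
  have "bpow X n V = bpow X m (bpow X (n - m) V)" using assms bpow_add[of X m "n - m"] by simp
  also have "\<dots> \<subseteq> bpow X m V" by (intro bpow_mono bpow_invariant) (use assms in auto)
  finally show ?thesis .
qed

text \<open>Inclusion in \<open>{\<zero>}\<close>, for an arbitrary set \<open>S\<close>, makes the
  notion hereditary by plain monotonicity; for a subspace it amounts to equality.\<close>

definition nilp where "nilp S \<longleftrightarrow> (\<exists>n. bpow S n S \<subseteq> {\<zero>})"

lemma nilp_mono: "nilp S \<Longrightarrow> T \<subseteq> S \<Longrightarrow> nilp T"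
  unfolding nilp_def using bpow_mono by blast

text \<open>A single bracket with \<open>I\<close> moves \<open>S\<close> into \<open>I\<close>,
  after which nilpotency of \<open>I\<close> takes over; hence the exponent
  \<open>n + 1\<close>.\<close>

lemma idl_nilp_acts:
  assumes "idl S I" "sub S" "nilp I"
  shows "\<exists>n. bpow I n S \<subseteq> {\<zero>}"
proof -
  obtain n where n: "bpow I n I \<subseteq> {\<zero>}" using assms nilp_def by blast
  have "br I S \<subseteq> I" using idl_br'[OF assms(1,2)] .
  then have "bpow I (n + 1) S \<subseteq> bpow I n I"
    unfolding bpow_add by (intro bpow_mono) (simp_all add: bpow_Suc)
  then show ?thesis using n by blast
qed

text \<open>Modulo \<open>U'\<close>, the sum \<open>X + Y\<close> acts on \<open>U\<close> through \<open>Y\<close>.\<close>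
lemma bpow_plus_le:
  assumes "sub X" "sub Y" "sub U" "sub U'"
    and "br X U \<subseteq> U'" "U' \<subseteq> U" "br Y U \<subseteq> U" "br Y U' \<subseteq> U'"
  shows "bpow (X \<boxplus> Y) n U \<subseteq> bpow Y n U \<boxplus> U'"
proof (induction n)
  case 0
  show ?case using assms plus_left by simp
next
  case (Suc n)
  have Yn: "sub (bpow Y n U)" "sub (bpow Y (Suc n) U)" using assms bpow_sub sub_subset by blast+
  have YnU: "bpow Y n U \<subseteq> U" using bpow_invariant assms by blast
  have W: "sub (bpow Y (Suc n) U \<boxplus> U')" using Yn assms sub_plus by blast
  have U'W: "U' \<subseteq> bpow Y (Suc n) U \<boxplus> U'" using plus_right Yn assms by blast
  have YW: "bpow Y (Suc n) U \<subseteq> bpow Y (Suc n) U \<boxplus> U'" using plus_left Yn assms by blast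
  have XV: "br X V \<subseteq> bpow Y (Suc n) U \<boxplus> U'" if "V \<subseteq> U" for V
    using br_mono[of X X V U] that assms(5) U'W by blast
  have "br (X \<boxplus> Y) (bpow Y n U) \<subseteq> bpow Y (Suc n) U \<boxplus> U'"
    by (rule br_plus_left[OF W assms(1,2) Yn(1)]) (use XV YnU YW in \<open>auto simp: bpow_Suc\<close>)
  moreover have "br (X \<boxplus> Y) U' \<subseteq> bpow Y (Suc n) U \<boxplus> U'"
    by (rule br_plus_left[OF W assms(1,2,4)]) (use XV assms U'W in auto)
  ultimately have "br (X \<boxplus> Y) (bpow Y n U \<boxplus> U') \<subseteq> bpow Y (Suc n) U \<boxplus> U'"
    using W Yn assms by (intro br_plus_right sub_plus) auto
  then show ?case using br_mono[OF subset_refl Suc.IH] unfolding bpow_Suc by blast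
qed

text \<open>\<open>Y\<close> normalises \<open>H\<close> and hence preserves the filtration of \<open>V\<close> by the iterated brackets
  with \<open>H\<close>; on its factors \<open>H + Y\<close> acts through \<open>Y\<close>.\<close>
lemma nilp_acts_plus:
  assumes H: "sub H" and Y: "sub Y" and V: "sub V"
    and YH: "br Y H \<subseteq> H" and YV: "br Y V \<subseteq> V" and HV: "br H V \<subseteq> V"
    and h: "bpow H h V \<subseteq> {\<zero>}" and y: "bpow Y y V \<subseteq> {\<zero>}"
  shows "\<exists>n. bpow (H \<boxplus> Y) n V \<subseteq> {\<zero>}"
proof -
  have Hc: "H \<subseteq> carrier L" and Yc: "Y \<subseteq> carrier L" using H Y sub_subset by auto
  have subk: "sub (bpow H k V)" for k using bpow_sub V Hc by blast
  have inv: "br Y (bpow H k V) \<subseteq> bpow H k V" for k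
  proof (induction k)
    case (Suc k)
    let ?V = "bpow H k V"
    have kc: "?V \<subseteq> carrier L" using subk sub_subset by blast
    have S: "sub (br H ?V)" using br_sub Hc kc by blast
    note brI = br_in[OF Hc kc]
    show ?case unfolding bpow_Suc
    proof (rule br_least[OF S])
      fix a z assume a: "a \<in> Y" and z: "z \<in> br H ?V"
      have ac: "a \<in> carrier L" using a Yc by blast
      show "a \<otimes> z \<in> br H ?V"
      proof (rule bracket_br[OF ac Hc kc S _ _ z])
        fix u w assume u: "u \<in> H" and w: "w \<in> ?V"
        have *: "a \<otimes> u \<in> H" "a \<otimes> w \<in> ?V"
          using br_in[OF Yc Hc a u] YH br_in[OF Yc kc a w] Suc.IH by auto
        show "(a \<otimes> u) \<otimes> w \<in> br H ?V" using brI[OF *(1) w] .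
        show "u \<otimes> (a \<otimes> w) \<in> br H ?V" using brI[OF u *(2)] .
      qed
    qed
  qed (simp add: YV)
  have step: "bpow (H \<boxplus> Y) y (bpow H k V) \<subseteq> bpow H (Suc k) V" for k
  proof -
    have dec: "bpow H (Suc k) V \<subseteq> bpow H k V" using bpow_decr[OF V HV] by simp
    have "bpow (H \<boxplus> Y) y (bpow H k V) \<subseteq> bpow Y y (bpow H k V) \<boxplus> bpow H (Suc k) V"
      by (rule bpow_plus_le) (use H Y subk dec inv in \<open>auto simp: bpow_Suc simp flip: bpow_Suc\<close>)
    moreover have "bpow Y y (bpow H k V) \<subseteq> bpow H (Suc k) V"
      using bpow_mono[of Y Y "bpow H k V" V y] bpow_invariant[OF V HV subset_refl] y
        sub_zero[OF subk] by blast
    ultimately show ?thesis using plus_least[OF subk subset_refl] by (meson plus_least subk subset_refl subset_trans)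
  qed
  have "\<exists>n. bpow (H \<boxplus> Y) n V \<subseteq> bpow H k V" for k
  proof (induction k)
    case 0
    show ?case by (rule exI[of _ 0]) simp
  next
    case (Suc k)
    then obtain n where "bpow (H \<boxplus> Y) n V \<subseteq> bpow H k V" by blast
    then have "bpow (H \<boxplus> Y) (y + n) V \<subseteq> bpow H (Suc k) V"
      unfolding bpow_add using step[of k] bpow_mono[OF subset_refl, of _ "bpow H k V" "H \<boxplus> Y" y]
      by blast
    then show ?case by blast
  qed
  from this[of h] show ?thesis using h by blast
qed

text \<open>Both ideals act nilpotently on the whole of \<open>S\<close>, and \<open>J\<close>
  normalises \<open>I\<close>, so \<open>nilp_acts_plus\<close> applies with \<open>V = S\<close>.
  This is what makes a largest nilpotent ideal exist.\<close>

lemma nilp_plus: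
  assumes S: "sub S" and I: "idl S I" "nilp I" and J: "idl S J" "nilp J"
  shows "nilp (I \<boxplus> J)"
proof -
  have sI: "sub I" "I \<subseteq> S" and sJ: "sub J" "J \<subseteq> S" using I J idl_sub idl_subset by metis+
  obtain m n where m: "bpow I m S \<subseteq> {\<zero>}" and n: "bpow J n S \<subseteq> {\<zero>}"
    using idl_nilp_acts[OF I(1) S I(2)] idl_nilp_acts[OF J(1) S J(2)] by blast
  have "br I S \<subseteq> S" "br J S \<subseteq> S"
    using idl_br'[OF I(1) S] idl_br'[OF J(1) S] sI sJ by auto
  moreover have "br J I \<subseteq> I" by (rule br_least[OF sI(1)]) (use idl_bracket[OF I(1)] sJ in blast)
  ultimately obtain k where "bpow (I \<boxplus> J) k S \<subseteq> {\<zero>}"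
    using nilp_acts_plus[OF sI(1) sJ(1) S _ _ _ m n] by blast
  moreover have "I \<boxplus> J \<subseteq> S" using sI sJ S plus_least by blast
  ultimately show ?thesis unfolding nilp_def using bpow_mono[OF subset_refl, of "I \<boxplus> J" S] by blast
qed

section \<open>Powers of a single adjoint map\<close>

definition ad where "ad x n y = (((\<otimes>) x) ^^ n) y"

lemma ad_0 [simp]: "ad x 0 y = y"
  and ad_Suc: "ad x (Suc n) y = x \<otimes> ad x n y"
  and ad_Suc2: "ad x (Suc n) y = ad x n (x \<otimes> y)"
  by (simp_all add: ad_def funpow_swap1)

lemma ad_ad: "ad x m (ad x n y) = ad x (m + n) y"
  by (simp add: ad_def funpow_add)

lemma ad_closed: "x \<in> carrier L \<Longrightarrow> y \<in> carrier L \<Longrightarrow> ad x n y \<in> carrier L"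
  by (induction n) (simp_all add: ad_Suc bracket_closed)

lemma ad_add:
  "x \<in> carrier L \<Longrightarrow> y \<in> carrier L \<Longrightarrow> z \<in> carrier L \<Longrightarrow> ad x n (y \<oplus> z) = ad x n y \<oplus> ad x n z"
  by (induction n) (simp_all add: ad_Suc bracket_add_right ad_closed)

lemma ad_minus:
  "x \<in> carrier L \<Longrightarrow> y \<in> carrier L \<Longrightarrow> z \<in> carrier L \<Longrightarrow> ad x n (y \<ominus> z) = ad x n y \<ominus> ad x n z"
  by (induction n) (simp_all add: ad_Suc bracket_minus ad_closed)

lemma ad_smult:
  "x \<in> carrier L \<Longrightarrow> y \<in> carrier L \<Longrightarrow> c \<in> carrier F \<Longrightarrow> ad x n (c \<odot> y) = c \<odot> ad x n y"
  by (induction n) (simp_all add: ad_Suc bracket_smult_right ad_closed)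

lemma ad_zero: "x \<in> carrier L \<Longrightarrow> ad x n \<zero> = \<zero>"
  by (induction n) (simp_all add: ad_Suc)

lemma br_line:
  assumes x: "x \<in> carrier L" and V: "sub V"
  shows "br (line x) V = (\<lambda>v. x \<otimes> v) ` V"
proof
  have "sub ((\<lambda>v. x \<otimes> v) ` V)"
  proof (rule subI)
    show "(\<lambda>v. x \<otimes> v) ` V \<subseteq> carrier L" using x sub_carrier[OF V] bracket_closed by blast
    show "\<zero> \<in> (\<lambda>v. x \<otimes> v) ` V" using x sub_zero[OF V] bracket_zero(1)[OF x] by (metis imageI)
  next
    fix a b assume "a \<in> (\<lambda>v. x \<otimes> v) ` V" "b \<in> (\<lambda>v. x \<otimes> v) ` V"
    then obtain u v where "u \<in> V" "v \<in> V" "a = x \<otimes> u" "b = x \<otimes> v" by blast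
    moreover from this have "a \<oplus> b = x \<otimes> (u \<oplus> v)"
      using x sub_carrier[OF V] bracket_add_right by simp
    ultimately show "a \<oplus> b \<in> (\<lambda>v. x \<otimes> v) ` V" using sub_add[OF V] by simp
  next
    fix c a assume "c \<in> carrier F" "a \<in> (\<lambda>v. x \<otimes> v) ` V"
    then obtain u where "u \<in> V" "a = x \<otimes> u" "c \<in> carrier F" by blast
    moreover from this have "c \<odot> a = x \<otimes> (c \<odot> u)"
      using x sub_carrier[OF V] bracket_smult_right by simp
    ultimately show "c \<odot> a \<in> (\<lambda>v. x \<otimes> v) ` V" using sub_smult[OF V] by simp
  qed
  then show "br (line x) V \<subseteq> (\<lambda>v. x \<otimes> v) ` V"
    by (rule br_line_left[OF x _ V]) simp
  show "(\<lambda>v. x \<otimes> v) ` V \<subseteq> br (line x) V"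
    using br_in[OF sub_subset[OF sub_line[OF x]] sub_subset[OF V] line_self[OF x]] by blast
qed

lemma bpow_line:
  assumes x: "x \<in> carrier L" and V: "sub V"
  shows "bpow (line x) n V = ad x n ` V"
proof (induction n)
  case (Suc n)
  have "sub (bpow (line x) n V)" using bpow_sub[OF sub_subset[OF sub_line[OF x]] V] .
  then show ?case using br_line[OF x] Suc by (simp add: bpow_Suc ad_Suc image_image)
qed simp

section \<open>Derived series and solvability\<close>

primrec der where
  "der S 0 = S"
| "der S (Suc n) = br (der S n) (der S n)"

lemma der_derived_series: "derived_series F L n = der (carrier L) n"
  by (induction n) simp_all

lemma der_mono: "S \<subseteq> T \<Longrightarrow> der S n \<subseteq> der T n"
  by (induction n) (simp_all add: br_mono)

lemma der_Suc2: "der S (Suc n) = der (br S S) n"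
  by (induction n) simp_all

lemma der_idl: "alg S \<Longrightarrow> idl S (der S n)"
  by (induction n) (simp_all add: idl_self br_idl alg_sub)

lemma der_subset: "alg S \<Longrightarrow> der S n \<subseteq> S"
  using idl_subset[OF der_idl] .

definition solv where "solv S \<longleftrightarrow> (\<exists>n. der S n \<subseteq> {\<zero>})"

lemma solv_mono: "solv S \<Longrightarrow> T \<subseteq> S \<Longrightarrow> solv T"
  unfolding solv_def using der_mono[of T S] by (meson subset_trans)

text \<open>If \<open>A\<close> is perfect modulo \<open>K\<close>, it lies modulo \<open>K\<close>
  in every term of the derived series of \<open>S\<close>, and that series reaches 0.\<close>

lemma solv_perfect_mod:
  assumes S: "solv S" "alg S" and A: "sub A" "A \<subseteq> S" and K: "idl S K" and perf: "A \<subseteq> br A A \<boxplus> K"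
  shows "A \<subseteq> K"
proof -
  note sK = idl_sub[OF K]
  have le: "A \<subseteq> der S n \<boxplus> K" for n
  proof (induction n)
    case 0
    show ?case using A(2) plus_left[OF alg_sub[OF S(2)] sK] by simp
  next
    case (Suc n)
    let ?D = "der S n" and ?D' = "der S (Suc n)"
    have D: "sub ?D" "sub ?D'" by (rule idl_sub[OF der_idl[OF S(2)]])+
    have W: "sub (?D' \<boxplus> K)" using sub_plus[OF D(2) sK] .
    have DS: "?D \<subseteq> S" using der_subset[OF S(2)] .
    have KW: "K \<subseteq> ?D' \<boxplus> K" using plus_right[OF D(2) sK] .
    have "br ?D K \<subseteq> K" using idl_br[OF K] br_mono[OF DS subset_refl, of K] by blast
    moreover have "br K ?D \<subseteq> K" "br K K \<subseteq> K"
      using idl_br'[OF K alg_sub[OF S(2)]] br_mono[OF subset_refl DS, of K]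
        br_mono[OF subset_refl idl_subset[OF K], of K] by auto
    moreover have "br ?D ?D \<subseteq> ?D' \<boxplus> K" using plus_left[OF D(2) sK] by simp
    ultimately have "br (?D \<boxplus> K) (?D \<boxplus> K) \<subseteq> ?D' \<boxplus> K"
      using W D sK KW by (intro br_plus_left br_plus_right sub_plus) auto
    then have "br A A \<subseteq> ?D' \<boxplus> K" using br_mono[OF Suc Suc] by blast
    then show ?case using perf plus_least[OF W _ KW] by blast
  qed
  obtain n where "der S n \<subseteq> {\<zero>}" using S(1) solv_def by blast
  then have "der S n \<subseteq> K" using sub_zero[OF sK] by blast
  then show ?thesis using le[of n] plus_least[OF sK _ subset_refl] by blast
qed

text \<open>In the Leibniz expansion every term has at least \<open>k\<close> factors
  \<open>ad x\<close> on \<open>y\<close> or at least \<open>l\<close> on \<open>z\<close>.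
  Induction on \<open>k + l\<close> avoids the binomial coefficients.\<close>

lemma ad_bracket_zero:
  assumes x: "x \<in> carrier L"
  shows "y \<in> carrier L \<Longrightarrow> z \<in> carrier L \<Longrightarrow> ad x k y = \<zero> \<Longrightarrow> ad x l z = \<zero>
    \<Longrightarrow> ad x (k + l) (y \<otimes> z) = \<zero>"
proof (induction "k + l" arbitrary: k l y z)
  case 0
  then show ?case by simp
next
  case (Suc n)
  show ?case
  proof (cases "k = 0 \<or> l = 0")
    case True
    then have "y = \<zero> \<or> z = \<zero>" using Suc by auto
    then have "y \<otimes> z = \<zero>" using Suc by auto
    then show ?thesis using ad_zero[OF x] by simp
  next
    case False
    then obtain k' l' where kl: "k = Suc k'" "l = Suc l'" by (meson not0_implies_Suc)
    have xy: "x \<otimes> y \<in> carrier L" "x \<otimes> z \<in> carrier L" using x Suc bracket_closed by auto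
    have "ad x (k' + l) ((x \<otimes> y) \<otimes> z) = \<zero>"
      using Suc kl xy by (intro Suc.hyps) (auto simp: ad_Suc2)
    moreover have "ad x (k + l') (y \<otimes> (x \<otimes> z)) = \<zero>"
      using Suc kl xy by (intro Suc.hyps) (auto simp: ad_Suc2)
    moreover have "ad x (k + l) (y \<otimes> z) = ad x n ((x \<otimes> y) \<otimes> z \<oplus> y \<otimes> (x \<otimes> z))"
      using Suc(2) jacobi_left[OF x Suc(3,4)] by (metis ad_Suc2)
    moreover have "k' + l = n" "k + l' = n" using Suc(2) kl by auto
    ultimately show ?thesis using ad_add[OF x] xy Suc bracket_closed by simp
  qed
qed

end

subsection \<open>Finite dimension and Engel's theorem\<close>

locale fd_lie_algebra = lie_algebra F L for F and L (structure) +
  assumes fin_dim: "fin_dim"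
begin

text \<open>Measured on the restricted record because \<open>type_I\<close> states its dimension
  bound that way.\<close>

definition sdim where "sdim W = vectorspace.dim F (L\<lparr>carrier := W\<rparr>)"

lemma sub_basis:
  assumes W: "sub W"
  shows "\<exists>B. finite B \<and> B \<subseteq> W \<and> lin_indpt B \<and> span B = W \<and> card B = sdim W"
proof -
  interpret W: vectorspace F "vs W" using subspace_is_vs[OF W] .
  have li: "W.lin_indpt A \<longleftrightarrow> lin_indpt A" if "A \<subseteq> W" for A
    using span_li_not_depend(2)[OF that is_module[OF W]] by simp
  have "\<exists>A. finite A \<and> maximal A (\<lambda>A. A \<subseteq> W \<and> lin_indpt A)"
  proof (rule maximal_exists)
    show "{} \<subseteq> W \<and> lin_indpt {}" by (simp add: lin_dep_def)
    show "finite A \<and> card A \<le> dim" if "A \<subseteq> W \<and> lin_indpt A" for A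
      using that li_le_dim[OF fin_dim] sub_subset[OF W] by (meson subset_trans)
  qed
  then obtain B where B: "finite B" "maximal B (\<lambda>A. A \<subseteq> W \<and> lin_indpt A)" by blast
  then have BW: "B \<subseteq> W" "lin_indpt B" by (auto simp: maximal_def)
  have "maximal B (\<lambda>A. A \<subseteq> carrier (vs W) \<and> W.lin_indpt A)"
    using B(2) li unfolding maximal_def by auto
  then have bas: "W.basis B" by (rule W.max_li_is_basis)
  then have "W.span B = W" unfolding W.basis_def by simp
  then have "span B = W" using span_li_not_depend(1)[OF BW(1) is_module[OF W]] by simp
  moreover have "card B = sdim W" unfolding sdim_def using W.dim_basis[OF B(1) bas] by simp
  ultimately show ?thesis using B BW by blast
qed

lemma sub_dim_le: "sub W \<Longrightarrow> sdim W \<le> dim"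
proof -
  assume W: "sub W"
  obtain B where B: "B \<subseteq> W" "lin_indpt B" "card B = sdim W" using sub_basis[OF W] by blast
  then have "B \<subseteq> carrier L" using sub_subset[OF W] by blast
  then show "sdim W \<le> dim" using li_le_dim(2)[OF fin_dim] B by metis
qed

lemma sub_fin_dim: "sub W \<Longrightarrow> vectorspace.fin_dim F (vs W)"
proof -
  assume W: "sub W"
  interpret W: vectorspace F "vs W" using subspace_is_vs[OF W] .
  obtain B where B: "finite B" "B \<subseteq> W" "span B = W" using sub_basis[OF W] by blast
  then have "W.span B = W" using span_li_not_depend(1)[OF B(2) is_module[OF W]] by simp
  then show ?thesis unfolding W.fin_dim_def using B by auto
qed

text \<open>A basis of \<open>U\<close> with as many elements as the dimension of \<open>W\<close>
  would also be a basis of \<open>W\<close>.\<close>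

lemma sub_dim_less:
  assumes U: "sub U" and W: "sub W" and UW: "U \<subset> W"
  shows "sdim U < sdim W"
proof -
  interpret W: vectorspace F "vs W" using subspace_is_vs[OF W] .
  have fdW: "W.fin_dim" using sub_fin_dim[OF W] .
  obtain B where B: "finite B" "B \<subseteq> U" "lin_indpt B" "span B = U" "card B = sdim U"
    using sub_basis[OF U] by blast
  have BW: "B \<subseteq> W" using B UW by auto
  note nd = span_li_not_depend[OF BW is_module[OF W]]
  have li: "W.lin_indpt B" using nd(2) B by simp
  have Bc: "B \<subseteq> carrier (vs W)" using BW by simp
  have "card B \<le> W.dim" using W.li_le_dim(2)[OF fdW Bc li] .
  moreover have "card B \<noteq> W.dim"
  proof
    assume "card B = W.dim"
    then have "W.basis B" using W.dim_li_is_basis[OF fdW B(1) Bc li] by simp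
    then have "W.span B = W" unfolding W.basis_def by simp
    then show False using nd(1) B UW by simp
  qed
  ultimately show ?thesis using B unfolding sdim_def by simp
qed

section \<open>Extremal subspaces and chain conditions\<close>

lemma ex_maximal_sub:
  assumes "P W0" and P: "\<And>W. P W \<Longrightarrow> sub W"
  shows "\<exists>W. P W \<and> W0 \<subseteq> W \<and> (\<forall>W'. P W' \<and> W \<subseteq> W' \<longrightarrow> W' = W)"
proof -
  have "\<forall>W. P W \<and> W0 \<subseteq> W \<longrightarrow> sdim W \<le> dim" using P sub_dim_le by blast
  \<comment> \<open>A member of largest dimension is maximal for inclusion, since proper inclusion
    raises the dimension. The bound is \<open>Suc dim\<close> because it has to be strict.\<close>
  with assms(1) obtain W where W: "P W \<and> W0 \<subseteq> W" "\<forall>W'. P W' \<and> W0 \<subseteq> W' \<longrightarrow> sdim W' \<le> sdim W"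
    using ex_has_greatest_nat[of "\<lambda>W. P W \<and> W0 \<subseteq> W" W0 sdim "Suc dim"] by (auto simp: less_Suc_eq_le)
  have "W' = W" if "P W'" "W \<subseteq> W'" for W'
  proof (rule ccontr)
    assume "W' \<noteq> W"
    then have "sdim W < sdim W'" using sub_dim_less[of W W'] P W that by blast
    moreover have "W0 \<subseteq> W'" using W(1) that(2) by blast
    ultimately show False using W(2) that(1) by (meson not_le)
  qed
  then show ?thesis using W by blast
qed

lemma ex_minimal_sub:
  assumes "P W0" and P: "\<And>W. P W \<Longrightarrow> sub W"
  shows "\<exists>W. P W \<and> W \<subseteq> W0 \<and> (\<forall>W'. P W' \<and> W' \<subseteq> W \<longrightarrow> W' = W)"
proof -
  from assms(1) obtain W where W: "P W \<and> W \<subseteq> W0" "\<forall>W'. P W' \<and> W' \<subseteq> W0 \<longrightarrow> sdim W \<le> sdim W'"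
    using ex_has_least_nat[of "\<lambda>W. P W \<and> W \<subseteq> W0" W0 sdim] by auto
  have "W' = W" if "P W'" "W' \<subseteq> W" for W'
  proof (rule ccontr)
    assume "W' \<noteq> W"
    then have "sdim W' < sdim W" using sub_dim_less[of W' W] P W that by blast
    moreover have "W' \<subseteq> W0" using W(1) that(2) by blast
    ultimately show False using W(2) that(1) by (meson not_le)
  qed
  then show ?thesis using W by blast
qed

text \<open>Applied to the images of the powers of \<open>ad x\<close>, and the companion
  \<open>incr_stable\<close> to their kernels; together they supply the Fitting decomposition
  piecewise.\<close>

lemma decr_stable:
  assumes V: "\<And>n::nat. sub (V n)" and dec: "\<And>m n. m \<le> n \<Longrightarrow> V n \<subseteq> V m"
  shows "\<exists>N. \<forall>n\<ge>N. V n = V N"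
proof -
  obtain W where W: "\<exists>n. W = V n" "\<forall>W'. (\<exists>n. W' = V n) \<and> W' \<subseteq> W \<longrightarrow> W' = W"
    using ex_minimal_sub[of "\<lambda>W. \<exists>n. W = V n" "V 0"] V by metis
  then obtain N where "W = V N" by blast
  then have "\<forall>n\<ge>N. V n = V N" using W(2) dec by blast
  then show ?thesis by blast
qed

lemma incr_stable:
  assumes V: "\<And>n::nat. sub (V n)" and inc: "\<And>m n. m \<le> n \<Longrightarrow> V m \<subseteq> V n"
  shows "\<exists>N. \<forall>n\<ge>N. V n = V N"
proof -
  obtain W where W: "\<exists>n. W = V n" "\<forall>W'. (\<exists>n. W' = V n) \<and> W \<subseteq> W' \<longrightarrow> W' = W"
    using ex_maximal_sub[of "\<lambda>W. \<exists>n. W = V n" "V 0"] V by metis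
  then obtain N where "W = V N" by blast
  then have "\<forall>n\<ge>N. V n = V N" using W(2) inc by blast
  then show ?thesis by blast
qed

text \<open>Induction on the derived length. By the induction hypothesis [K,K] acts nilpotently on
  \<open>V\<close>; let \<open>H\<close> be largest among the subspaces between [K,K] and
  \<open>K\<close> that do. Every \<open>x\<close> in \<open>K\<close> normalises \<open>H\<close>,
  as [x,H] lies in [K,K], so \<open>nilp_acts_plus\<close> adds the line of \<open>x\<close> to
  \<open>H\<close>. Solvability thus spares the search for a normalising element.\<close>

lemma engel:
  assumes V: "sub V"
  shows "alg K \<Longrightarrow> br K V \<subseteq> V \<Longrightarrow> (\<And>x. x \<in> K \<Longrightarrow> \<exists>n. ad x n ` V \<subseteq> {\<zero>})
    \<Longrightarrow> der K r \<subseteq> {\<zero>} \<Longrightarrow> \<exists>n. bpow K n V \<subseteq> {\<zero>}"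
proof (induction r arbitrary: K)
  case 0
  have "bpow K 1 V \<subseteq> br {\<zero>} V" using 0(4) by (simp add: bpow_Suc br_mono)
  also have "\<dots> \<subseteq> {\<zero>}" using sub_carrier[OF V] by (intro br_least sub_trivial) auto
  finally show ?case by blast
next
  case (Suc r)
  note sK = alg_sub[OF Suc(2)]
  have Kc: "K \<subseteq> carrier L" using sub_subset[OF sK] .
  let ?K' = "br K K"
  have idlK': "idl K ?K'" using br_idl[OF idl_self idl_self] Suc(2) sK by blast
  have K'K: "?K' \<subseteq> K" using idl_subset[OF idlK'] .
  have "\<exists>n. bpow ?K' n V \<subseteq> {\<zero>}"
  proof (rule Suc.IH)
    show "alg ?K'" using idl_alg[OF idlK'] .
    show "br ?K' V \<subseteq> V" using br_mono[OF K'K subset_refl, of V] Suc(3) by blast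
    show "\<exists>n. ad x n ` V \<subseteq> {\<zero>}" if "x \<in> ?K'" for x using Suc(4) K'K that by blast
    show "der ?K' r \<subseteq> {\<zero>}" using Suc(5) by (simp only: der_Suc2)
  qed
  define P where "P H \<longleftrightarrow> sub H \<and> ?K' \<subseteq> H \<and> H \<subseteq> K \<and> (\<exists>n. bpow H n V \<subseteq> {\<zero>})" for H
  have "P ?K'" unfolding P_def using \<open>\<exists>n. bpow ?K' n V \<subseteq> {\<zero>}\<close> idl_sub[OF idlK'] K'K by simp
  moreover have "sub H" if "P H" for H using that P_def by simp
  ultimately obtain H where "P H" and max: "\<forall>H'. P H' \<and> H \<subseteq> H' \<longrightarrow> H' = H"
    using ex_maximal_sub[of P ?K'] by metis
  then have H: "sub H" "?K' \<subseteq> H" "H \<subseteq> K" "\<exists>n. bpow H n V \<subseteq> {\<zero>}"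
    unfolding P_def by auto
  have "H = K"
  proof (rule ccontr)
    assume "H \<noteq> K"
    then obtain x where x: "x \<in> K" "x \<notin> H" using H(3) by blast
    have xc: "x \<in> carrier L" using x Kc by blast
    note sl = sub_line[OF xc]
    have lK: "line x \<subseteq> K" using line_least[OF sK x(1)] .
    obtain h where h: "bpow H h V \<subseteq> {\<zero>}" using H by blast
    obtain y where "ad x y ` V \<subseteq> {\<zero>}" using Suc(4)[OF x(1)] by blast
    then have y: "bpow (line x) y V \<subseteq> {\<zero>}" using bpow_line[OF xc V] by simp
    have "br (line x) H \<subseteq> H" using br_mono[OF lK H(3)] H(2) by blast
    moreover have "br (line x) V \<subseteq> V" "br H V \<subseteq> V"
      using br_mono[OF lK subset_refl, of V] br_mono[OF H(3) subset_refl, of V] Suc(3) by auto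
    ultimately have "\<exists>n. bpow (H \<boxplus> line x) n V \<subseteq> {\<zero>}"
      using nilp_acts_plus[OF H(1) sl V _ _ _ h y] by blast
    then have "P (H \<boxplus> line x)"
      unfolding P_def using sub_plus[OF H(1) sl] plus_left[OF H(1) sl] plus_least[OF sK H(3) lK] H(2)
      by auto
    then have "H \<boxplus> line x = H" using max plus_left[OF H(1) sl] by blast
    then show False using x plus_right[OF H(1) sl] line_self[OF xc] by blast
  qed
  then show ?case using H by blast
qed

end

context lie_algebra
begin

subsection \<open>The Frattini subalgebra of a solvable Lie algebra\<close>

definition nba where "nba S \<longleftrightarrow> nilp (br S S)"

text \<open>Membership in $\mathcal{N}(\leq 2)$, phrased without quotients and nilradicals.\<close>
definition N2 where "N2 S \<longleftrightarrow> (\<exists>N. idl S N \<and> nilp N \<and> (\<exists>n. bpow S n S \<subseteq> N))"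

lemma nba_mono: "nba S \<Longrightarrow> T \<subseteq> S \<Longrightarrow> nba T"
  unfolding nba_def by (erule nilp_mono) (simp add: br_mono)

lemma nba_N2:
  assumes "alg S" "nba S" shows "N2 S"
proof -
  have "idl S (br S S)" using br_idl[OF idl_self idl_self alg_sub] assms(1) by blast
  moreover have "bpow S 1 S \<subseteq> br S S" by (simp add: bpow_Suc)
  ultimately show ?thesis unfolding N2_def using assms(2)[unfolded nba_def] by blast
qed

abbreviation G where "G \<equiv> carrier L"
abbreviation \<Phi> where "\<Phi> \<equiv> frattini F L"

lemma maximalD:
  assumes "maximal_subalgebra F M L"
  shows maximal_alg: "alg M" and maximal_ne: "M \<noteq> G"
    and maximal_max: "\<And>S. alg S \<Longrightarrow> M \<subseteq> S \<Longrightarrow> S = M \<or> S = G"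
  using assms unfolding maximal_subalgebra_def by auto

lemma sub_frattini: "sub \<Phi>"
proof (rule subI)
  note s = alg_sub[OF maximal_alg]
  show "\<Phi> \<subseteq> G" by (auto simp: frattini_def)
  show "\<zero> \<in> \<Phi>" using sub_zero[OF s] by (simp add: frattini_def)
  show "x \<oplus> y \<in> \<Phi>" if "x \<in> \<Phi>" "y \<in> \<Phi>" for x y
    using that sub_add[OF s] by (simp add: frattini_def)
  show "c \<odot> x \<in> \<Phi>" if "c \<in> carrier F" "x \<in> \<Phi>" for c x
    using that sub_smult[OF s] by (simp add: frattini_def)
qed

lemma frattini_le: "maximal_subalgebra F M L \<Longrightarrow> \<Phi> \<subseteq> M"
  by (auto simp: frattini_def)

lemma alg_subset: "alg S \<Longrightarrow> S \<subseteq> G"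
  using sub_subset[OF alg_sub] .

text \<open>The intersection is normalised by \<open>S\<close>, and also by \<open>A\<close> because
  brackets inside \<open>A\<close> fall into \<open>S\<close>; the two together make up
  \<open>G\<close>.\<close>

lemma idl_Int_complement:
  assumes A: "idl G A" and S: "alg S" and AS: "A \<boxplus> S = G"
    and AA: "\<And>a b. a \<in> A \<Longrightarrow> b \<in> A \<Longrightarrow> a \<otimes> b \<in> S"
  shows "idl G (A \<inter> S)"
proof (rule idlI)
  note sAS = sub_Int[OF idl_sub[OF A] alg_sub[OF S]]
  show "sub (A \<inter> S)" by (rule sAS)
  show "A \<inter> S \<subseteq> G" using idl_subset[OF A] by blast
  fix g y assume "g \<in> G" and y: "y \<in> A \<inter> S"
  then have "g \<in> A \<boxplus> S" using AS by simp
  then obtain a s where as: "a \<in> A" "s \<in> S" "g = a \<oplus> s" unfolding set_add_iff by blast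
  have cl: "a \<in> G" "s \<in> G" "y \<in> G" using as y idl_subset[OF A] alg_subset[OF S] by auto
  have "a \<otimes> y \<in> A \<inter> S" using AA[OF as(1)] idl_bracket[OF A cl(1)] y by blast
  moreover have "s \<otimes> y \<in> A \<inter> S" using alg_bracket[OF S as(2)] idl_bracket[OF A cl(2)] y by blast
  ultimately show "g \<otimes> y \<in> A \<inter> S" using as(3) bracket_add_left[OF cl] sub_add[OF sAS] by simp
qed

text \<open>If \<open>a\<close> lies in an ideal \<open>A\<close> with \<open>[A,A] \<subseteq> K\<close>, then \<open>1 - ad a\<close> is an automorphism modulo \<open>K\<close>;
  \<open>twist a T\<close> is the preimage of \<open>T\<close> under it.\<close>
definition twist where "twist a T = {y \<in> G. y \<ominus> a \<otimes> y \<in> T}"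

lemma twist_subset: "twist a T \<subseteq> G"
  and twist_mono: "T \<subseteq> T' \<Longrightarrow> twist a T \<subseteq> twist a T'"
  by (auto simp: twist_def)

lemma twist_whole: "a \<in> G \<Longrightarrow> twist a G = G"
  by (auto simp: twist_def bracket_closed)

context
  fixes A K a
  assumes A: "idl G A" and K: "idl G K" and AK: "br A A \<subseteq> K" and a: "a \<in> A"
begin

lemma a_carrier: "a \<in> G"
  using a idl_subset[OF A] by blast

lemma aA: "y \<in> G \<Longrightarrow> a \<otimes> y \<in> A"
  using idlD2[OF A sub_whole _ a] .

lemma AA_K: "u \<in> A \<Longrightarrow> v \<in> A \<Longrightarrow> u \<otimes> v \<in> K"
  using br_in[OF idl_subset[OF A] idl_subset[OF A]] AK by blast

lemma K_twist:
  assumes T: "alg T" and KT: "K \<subseteq> T"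
  shows "K \<subseteq> twist a T"
proof
  fix k assume k: "k \<in> K"
  then have "k \<in> G" using idl_subset[OF K] by blast
  moreover have "k \<ominus> a \<otimes> k \<in> T"
    using k KT idl_bracket[OF K a_carrier k] sub_minus[OF alg_sub[OF T]] by blast
  ultimately show "k \<in> twist a T" by (simp add: twist_def)
qed

text \<open>By the derivation rule, \<open>1 - ad a\<close> respects the bracket of y and z up to
  the term [[a,y],[a,z]], which lies in [A,A] and hence in \<open>K\<close> and in
  \<open>T\<close>.\<close>

lemma alg_twist:
  assumes T: "alg T" and KT: "K \<subseteq> T"
  shows "alg (twist a T)"
proof (rule algI)
  note sT = alg_sub[OF T] and ac = a_carrier
  show "sub (twist a T)"
  proof (rule subI)
    show "twist a T \<subseteq> G" by (rule twist_subset)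
    show "\<zero> \<in> twist a T"
      using ac sub_zero[OF sT] sub_minus[OF sT sub_zero[OF sT] sub_zero[OF sT]] by (simp add: twist_def)
  next
    fix x y assume "x \<in> twist a T" "y \<in> twist a T"
    then have *: "x \<in> G" "y \<in> G" "x \<ominus> a \<otimes> x \<in> T" "y \<ominus> a \<otimes> y \<in> T" by (auto simp: twist_def)
    have "(x \<oplus> y) \<ominus> a \<otimes> (x \<oplus> y) = (x \<ominus> a \<otimes> x) \<oplus> (y \<ominus> a \<otimes> y)"
      using ac * by (simp add: bracket_add_right bracket_closed M.minus_eq M.minus_add M.a_ac)
    then show "x \<oplus> y \<in> twist a T" using * sub_add[OF sT] by (simp add: twist_def)
  next
    fix c x assume c: "c \<in> carrier F" and "x \<in> twist a T"
    then have *: "x \<in> G" "x \<ominus> a \<otimes> x \<in> T" by (auto simp: twist_def)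
    have "c \<odot> x \<ominus> a \<otimes> (c \<odot> x) = c \<odot> (x \<ominus> a \<otimes> x)"
      using ac * c by (simp add: bracket_smult_right bracket_closed M.minus_eq smult_r_distr smult_r_minus)
    then show "c \<odot> x \<in> twist a T" using * c sub_smult[OF sT] by (simp add: twist_def)
  qed
  fix y z assume "y \<in> twist a T" "z \<in> twist a T"
  then have *: "y \<in> G" "z \<in> G" "y \<ominus> a \<otimes> y \<in> T" "z \<ominus> a \<otimes> z \<in> T" by (auto simp: twist_def)
  have cl: "a \<otimes> y \<in> G" "a \<otimes> z \<in> G" using ac * bracket_closed by auto
  have "(a \<otimes> y) \<otimes> (a \<otimes> z) \<in> T" using AA_K[OF aA[OF *(1)] aA[OF *(2)]] KT by blast
  moreover have "(y \<ominus> a \<otimes> y) \<otimes> (z \<ominus> a \<otimes> z) \<in> T" using alg_bracket[OF T *(3,4)] .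
  moreover have "(y \<ominus> a \<otimes> y) \<otimes> (z \<ominus> a \<otimes> z)
      = (y \<otimes> z \<ominus> a \<otimes> (y \<otimes> z)) \<oplus> (a \<otimes> y) \<otimes> (a \<otimes> z)"
  proof -
    have "(y \<ominus> a \<otimes> y) \<otimes> (z \<ominus> a \<otimes> z)
        = (y \<otimes> z \<ominus> (a \<otimes> y) \<otimes> z) \<ominus> (y \<otimes> (a \<otimes> z) \<ominus> (a \<otimes> y) \<otimes> (a \<otimes> z))"
      using * cl by (simp add: bracket_minus)
    then show ?thesis
      using * cl jacobi_left[OF ac *(1,2)] bracket_closed
      by (simp add: M.minus_eq M.minus_add M.minus_minus M.a_ac)
  qed
  ultimately have "y \<otimes> z \<ominus> a \<otimes> (y \<otimes> z) \<in> T"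
    using sub_diff_iff(1)[OF sT] ac * bracket_closed by simp
  then show "y \<otimes> z \<in> twist a T" using * bracket_closed by (simp add: twist_def)
qed

text \<open>The composite of \<open>1 + ad a\<close> and \<open>1 - ad a\<close> is the identity
  minus the square of \<open>ad a\<close>, and that square maps into [A,A], which is 0 modulo
  \<open>K\<close>.\<close>

lemma twist_twist:
  assumes T: "alg T" and KT: "K \<subseteq> T"
  shows "twist (\<ominus> a) (twist a T) = T"
proof -
  note sT = alg_sub[OF T] and ac = a_carrier
  have "y \<in> twist (\<ominus> a) (twist a T) \<longleftrightarrow> y \<in> T" if y: "y \<in> G" for y
  proof -
    have cl: "a \<otimes> y \<in> G" "a \<otimes> (a \<otimes> y) \<in> G" using ac y bracket_closed by auto
    have "y \<ominus> (\<ominus> a) \<otimes> y = y \<oplus> a \<otimes> y"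
      using ac y cl by (simp add: bracket_neg M.minus_eq)
    moreover have "(y \<oplus> a \<otimes> y) \<ominus> a \<otimes> (y \<oplus> a \<otimes> y) = y \<ominus> a \<otimes> (a \<otimes> y)"
      using ac y cl by (simp add: bracket_add_right M.minus_eq M.minus_add M.a_assoc M.r_neg1 M.r_neg2)
    moreover have "a \<otimes> (a \<otimes> y) \<in> T" using AA_K[OF a aA[OF y]] KT by blast
    ultimately show ?thesis using y cl sub_diff_iff(3)[OF sT y] by (simp add: twist_def)
  qed
  then show ?thesis using twist_subset alg_subset[OF T] by blast
qed

end

text \<open>Both \<open>twist a\<close> and its inverse \<open>twist (\<ominus> a)\<close> preserve
  inclusions and the subalgebras above \<open>K\<close>, so maximality is carried over. This plays
  the part of conjugation by an exponential of \<open>ad a\<close>, in any characteristic.\<close>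

lemma twist_maximal:
  assumes A: "idl G A" and K: "idl G K" and AK: "br A A \<subseteq> K" and a: "a \<in> A"
    and M: "maximal_subalgebra F M L" and KM: "K \<subseteq> M"
  shows "maximal_subalgebra F (twist a M) L"
proof -
  have ac: "a \<in> G" "\<ominus> a \<in> G" and na: "\<ominus> a \<in> A"
    using a idl_subset[OF A] sub_neg[OF idl_sub[OF A] a] by auto
  note Ma = maximal_alg[OF M]
  note tt = twist_twist[OF A K AK a] twist_twist[OF A K AK na, simplified M.minus_minus[OF ac(1)]]
  have KT: "K \<subseteq> twist a M" using K_twist[OF A K AK a Ma KM] .
  have "twist a M \<noteq> G"
  proof
    assume "twist a M = G"
    then have "M = G" using tt(1)[OF Ma KM] twist_whole[OF ac(2)] by simp
    then show False using maximal_ne[OF M] by simp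
  qed
  moreover have "S = twist a M \<or> S = G" if S: "alg S" "twist a M \<subseteq> S" for S
  proof -
    have KS: "K \<subseteq> S" using KT S by blast
    have "alg (twist (\<ominus> a) S)" using alg_twist[OF A K AK na S(1) KS] .
    moreover have "M \<subseteq> twist (\<ominus> a) S" using tt(1)[OF Ma KM] twist_mono[OF S(2), of "\<ominus> a"] by simp
    ultimately have "twist (\<ominus> a) S = M \<or> twist (\<ominus> a) S = G" using maximal_max[OF M] by blast
    then show ?thesis using tt(2)[OF S(1) KS] twist_whole[OF ac(1)] by metis
  qed
  ultimately show ?thesis
    unfolding maximal_subalgebra_def using alg_twist[OF A K AK a Ma KM] by blast
qed

end

context fd_lie_algebra
begin

lemma ex_maximal:
  assumes "alg S" "S \<noteq> G"
  shows "\<exists>M. maximal_subalgebra F M L \<and> S \<subseteq> M"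
proof -
  obtain M where M: "alg M \<and> M \<noteq> G" "S \<subseteq> M" "\<forall>M'. (alg M' \<and> M' \<noteq> G) \<and> M \<subseteq> M' \<longrightarrow> M' = M"
    using ex_maximal_sub[of "\<lambda>M. alg M \<and> M \<noteq> G" S] assms alg_sub by metis
  then have "maximal_subalgebra F M L" unfolding maximal_subalgebra_def by blast
  then show ?thesis using M by blast
qed

text \<open>The factor of \<open>A\<close> by \<open>K\<close> is a chief factor of
  \<open>G\<close>, expressed without forming the quotient.\<close>

lemma ideal_above:
  assumes "idl G K" "K \<noteq> G"
  shows "\<exists>A. idl G A \<and> K \<subseteq> A \<and> A \<noteq> K \<and> (\<forall>A'. idl G A' \<and> K \<subseteq> A' \<and> A' \<noteq> K \<and> A' \<subseteq> A \<longrightarrow> A' = A)"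
proof -
  have "idl G G \<and> K \<subseteq> G \<and> G \<noteq> K" using idl_self[OF alg_whole] idl_subset assms by blast
  then obtain A where "idl G A \<and> K \<subseteq> A \<and> A \<noteq> K"
    "\<forall>A'. (idl G A' \<and> K \<subseteq> A' \<and> A' \<noteq> K) \<and> A' \<subseteq> A \<longrightarrow> A' = A"
    using ex_minimal_sub[of "\<lambda>A. idl G A \<and> K \<subseteq> A \<and> A \<noteq> K" G] idl_sub by metis
  then show ?thesis by blast
qed

text \<open>The ideal [A,A] + K lies between \<open>K\<close> and \<open>A\<close>. Were it all of
  \<open>A\<close>, then \<open>A\<close> would be perfect modulo \<open>K\<close>, against
  solvability; so minimality makes it \<open>K\<close>.\<close>

lemma chief_factor_abelian:
  assumes S: "solv G" and K: "idl G K" and A: "idl G A" "K \<subseteq> A" "A \<noteq> K"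
    and min: "\<And>A'. idl G A' \<Longrightarrow> K \<subseteq> A' \<Longrightarrow> A' \<noteq> K \<Longrightarrow> A' \<subseteq> A \<Longrightarrow> A' = A"
  shows "br A A \<subseteq> K"
proof -
  have AA: "idl G (br A A)" using br_idl[OF A(1) A(1) sub_whole] .
  note s = idl_sub[OF AA] idl_sub[OF K] idl_sub[OF A(1)]
  let ?A' = "br A A \<boxplus> K"
  have sA': "idl G ?A'" using idl_plus[OF AA K sub_whole] .
  have "?A' = K"
  proof (rule ccontr)
    assume "?A' \<noteq> K"
    moreover have "?A' \<subseteq> A" using plus_least[OF s(3) alg_br[OF idl_alg[OF A(1)]] A(2)] .
    ultimately have "?A' = A" using min[OF sA'] plus_right[OF s(1,2)] by blast
    then have "A \<subseteq> K"
      using solv_perfect_mod[OF S alg_whole s(3) idl_subset[OF A(1)] K] by simp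
    then show False using A by blast
  qed
  then show ?thesis using plus_left[OF s(1,2)] by blast
qed

text \<open>Let \<open>K\<close> be the largest ideal of \<open>G\<close> inside \<open>M\<close>
  and A/K a chief factor. The elements of \<open>M\<close> that centralise A/K form an ideal, since
  \<open>M\<close> normalises their set and \<open>A\<close> maps it into \<open>K\<close>; lying in
  \<open>M\<close>, this ideal lies in \<open>K\<close>. The elements of the Frattini subalgebra are
  of this kind because they belong to \<open>M\<close> and to all its twists.\<close>

lemma frattini_in_core:
  assumes S: "solv G" and M: "maximal_subalgebra F M L"
  shows "\<exists>K. idl G K \<and> K \<subseteq> M \<and> \<Phi> \<subseteq> K"
proof -
  note Ma = maximal_alg[OF M]
  note sM = alg_sub[OF Ma]
  have "idl G {\<zero>} \<and> {\<zero>} \<subseteq> M" using idl_trivial[OF sub_whole] sub_zero[OF sM] by simp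
  then obtain K where K: "idl G K" "K \<subseteq> M" and Kmax: "\<forall>K'. (idl G K' \<and> K' \<subseteq> M) \<and> K \<subseteq> K' \<longrightarrow> K' = K"
    using ex_maximal_sub[of "\<lambda>K. idl G K \<and> K \<subseteq> M" "{\<zero>}"] idl_sub by metis
  have core: "I \<subseteq> K" if I: "idl G I" "I \<subseteq> M" for I
  proof -
    note s = idl_sub[OF K(1)] idl_sub[OF I(1)]
    have "K \<boxplus> I = K"
      using Kmax idl_plus[OF K(1) I(1) sub_whole] plus_least[OF sM K(2) I(2)] plus_left[OF s] by blast
    then show ?thesis using plus_right[OF s] by blast
  qed
  have "K \<noteq> G" using K(2) maximal_ne[OF M] alg_subset[OF Ma] by blast
  then obtain A where A: "idl G A" "K \<subseteq> A" "A \<noteq> K"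
    and Amin: "\<And>A'. idl G A' \<Longrightarrow> K \<subseteq> A' \<Longrightarrow> A' \<noteq> K \<Longrightarrow> A' \<subseteq> A \<Longrightarrow> A' = A"
    using ideal_above[OF K(1)] by metis
  have AK: "br A A \<subseteq> K" using chief_factor_abelian[OF S K(1) A Amin] by blast
  have brAA: "u \<otimes> v \<in> K" if "u \<in> A" "v \<in> A" for u v
    using br_in[OF idl_subset[OF A(1)] idl_subset[OF A(1)] that] AK by blast
  note sA = idl_sub[OF A(1)] and sK = idl_sub[OF K(1)]
  have "\<not> A \<subseteq> M" using core A by blast
  then have AM: "A \<boxplus> M = G"
    using maximal_max[OF M idl_plus_alg[OF A(1) Ma alg_subset[OF Ma] alg_whole]]
      plus_left[OF sA sM] plus_right[OF sA sM] by blast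
  have dec: "\<exists>a m. a \<in> A \<and> m \<in> M \<and> x = a \<oplus> m" if "x \<in> G" for x
    using that AM set_add_iff[of x A M] by blast
  have Gc: "A \<subseteq> G" "M \<subseteq> G" using idl_subset[OF A(1)] alg_subset[OF Ma] by auto
  have "idl G (A \<inter> M)"
    using idl_Int_complement[OF A(1) Ma AM] brAA K(2) by blast
  then have AMK: "A \<inter> M \<subseteq> K" using core by blast
  define Z where "Z = {m \<in> M. \<forall>b\<in>A. b \<otimes> m \<in> K}"
  have "\<Phi> \<subseteq> Z"
  proof
    fix m assume m: "m \<in> \<Phi>"
    have mM: "m \<in> M" using m frattini_le[OF M] by blast
    then have mc: "m \<in> G" using Gc by blast
    have "b \<otimes> m \<in> K" if b: "b \<in> A" for b
    proof -
      have bc: "b \<in> G" using b Gc by blast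
      \<comment> \<open>Both \<open>m\<close> and \<open>m \<ominus> b \<otimes> m\<close> lie in
        \<open>M\<close>, hence so does \<open>b \<otimes> m\<close>; it also lies in
        \<open>A\<close>, and \<open>A\<close> meets \<open>M\<close> inside
        \<open>K\<close>.\<close>
      have "m \<in> twist b M" using m frattini_le[OF twist_maximal[OF A(1) K(1) AK b M K(2)]] by blast
      then have "m \<ominus> b \<otimes> m \<in> M" by (simp add: twist_def)
      then have "m \<ominus> (m \<ominus> b \<otimes> m) \<in> M" using sub_minus[OF sM mM] by blast
      moreover have "m \<ominus> (m \<ominus> b \<otimes> m) = b \<otimes> m"
        using mc bc bracket_closed[OF bc mc]
        by (simp add: M.minus_eq M.minus_add M.minus_minus M.r_neg2 M.r_neg1)
      moreover have "b \<otimes> m \<in> A" using idlD2[OF A(1) sub_whole mc b] .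
      ultimately show ?thesis using AMK by auto
    qed
    then show "m \<in> Z" using mM by (simp add: Z_def)
  qed
  moreover have "idl G Z"
  proof (rule idlI)
    show sZ: "sub Z" unfolding Z_def using sub_transporter[OF sM sK Gc(1)] .
    show "Z \<subseteq> G" using sub_subset[OF sZ] .
    have KZ: "K \<subseteq> Z" unfolding Z_def using K(2) idl_bracket[OF K(1)] Gc by blast
    fix x z assume "x \<in> G" and z: "z \<in> Z"
    then obtain b m where bm: "b \<in> A" "m \<in> M" "x = b \<oplus> m" using dec by blast
    have zM: "z \<in> M" and zK: "\<And>b. b \<in> A \<Longrightarrow> b \<otimes> z \<in> K" using z by (auto simp: Z_def)
    have c: "b \<in> G" "m \<in> G" "z \<in> G" using bm zM Gc by auto
    have "b \<otimes> z \<in> Z" using zK[OF bm(1)] KZ by blast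
    moreover have "m \<otimes> z \<in> Z"
    proof -
      have "d \<otimes> (m \<otimes> z) \<in> K" if d: "d \<in> A" for d
      proof -
        have dc: "d \<in> G" using d Gc by blast
        have "(d \<otimes> m) \<otimes> z \<in> K" using zK[OF idlD2[OF A(1) sub_whole c(2) d]] .
        moreover have "m \<otimes> (d \<otimes> z) \<in> K" using idl_bracket[OF K(1) c(2) zK[OF d]] .
        ultimately show ?thesis using jacobi_left[OF dc c(2,3)] sub_add[OF sK] by simp
      qed
      then show ?thesis using alg_bracket[OF Ma bm(2) zM] by (simp add: Z_def)
    qed
    ultimately show "x \<otimes> z \<in> Z" using bm(3) bracket_add_left[OF c] sub_add[OF sZ] by simp
  qed
  then have "Z \<subseteq> K" using core by (auto simp: Z_def)
  ultimately show ?thesis using K by blast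
qed

text \<open>Each maximal subalgebra contains an ideal that lies above the Frattini subalgebra, so a
  bracket with a Frattini element stays in every maximal subalgebra.\<close>

lemma frattini_idl:
  assumes "solv G"
  shows "idl G \<Phi>"
proof (rule idlI[OF sub_frattini sub_subset[OF sub_frattini]])
  fix x y assume x: "x \<in> G" and y: "y \<in> \<Phi>"
  have "x \<otimes> y \<in> M" if M: "maximal_subalgebra F M L" for M
    using frattini_in_core[OF assms M] idl_bracket[OF _ x] y by blast
  then show "x \<otimes> y \<in> \<Phi>"
    using bracket_closed[OF x] sub_carrier[OF sub_frattini y] by (simp add: frattini_def)
qed

text \<open>This is the Fitting null-component of \<open>ad x\<close>, the Engel subalgebra of
  \<open>x\<close>; closure under the bracket is \<open>ad_bracket_zero\<close>.\<close>

lemma alg_engel: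
  assumes x: "x \<in> G"
  shows "alg {y \<in> G. \<exists>n. ad x n y = \<zero>}"
proof -
  have mon: "ad x m y = \<zero>" if "ad x n y = \<zero>" "n \<le> m" for m n y
    using that ad_ad[of x "m - n" n y] ad_zero[OF x] by simp
  show ?thesis
  proof (rule algI[OF subI])
    show "\<zero> \<in> {y \<in> G. \<exists>n. ad x n y = \<zero>}" using ad_zero[OF x] by simp
  next
    fix y z assume "y \<in> {y \<in> G. \<exists>n. ad x n y = \<zero>}" "z \<in> {y \<in> G. \<exists>n. ad x n y = \<zero>}"
    then obtain k l where *: "y \<in> G" "z \<in> G" "ad x k y = \<zero>" "ad x l z = \<zero>" by blast
    then have "ad x (max k l) (y \<oplus> z) = \<zero>"
      using ad_add[OF x] mon[of k y "max k l"] mon[of l z "max k l"] by simp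
    then show "y \<oplus> z \<in> {y \<in> G. \<exists>n. ad x n y = \<zero>}" using * by blast
  next
    fix c y assume c: "c \<in> carrier F" and "y \<in> {y \<in> G. \<exists>n. ad x n y = \<zero>}"
    then obtain n where *: "y \<in> G" "ad x n y = \<zero>" by blast
    then have "ad x n (c \<odot> y) = \<zero>" using ad_smult[OF x _ c] c by simp
    then show "c \<odot> y \<in> {y \<in> G. \<exists>n. ad x n y = \<zero>}" using * c by blast
  next
    fix y z assume "y \<in> {y \<in> G. \<exists>n. ad x n y = \<zero>}" "z \<in> {y \<in> G. \<exists>n. ad x n y = \<zero>}"
    then obtain k l where *: "y \<in> G" "z \<in> G" "ad x k y = \<zero>" "ad x l z = \<zero>" by blast
    then have "ad x (k + l) (y \<otimes> z) = \<zero>" using ad_bracket_zero[OF x] by blast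
    then show "y \<otimes> z \<in> {y \<in> G. \<exists>n. ad x n y = \<zero>}" using * bracket_closed by blast
  qed blast
qed

lemma sub_ad_kernel:
  assumes x: "x \<in> G"
  shows "sub {y \<in> G. ad x n y = \<zero>}"
  by (rule subI) (simp_all add: x ad_zero[OF x] ad_add[OF x] ad_smult[OF x] subset_iff)

text \<open>For \<open>x\<close> in \<open>P\<close>, the Fitting one-component of \<open>ad x\<close> lies in the Frattini subalgebra, so the
  Engel subalgebra of \<open>x\<close>, lying in no maximal subalgebra, is the whole algebra.\<close>
lemma frattini_nilp:
  assumes S: "solv G" and P: "idl G P" and k: "bpow P k P \<subseteq> \<Phi>"
  shows "nilp P"
proof -
  note sP = idl_sub[OF P]
  have nil: "\<exists>n. ad x n ` G \<subseteq> {\<zero>}" if x: "x \<in> P" for x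
  proof -
    have xc: "x \<in> G" using x idl_subset[OF P] by blast
    have lP: "line x \<subseteq> P" using line_least[OF sP x] .
    have im: "bpow (line x) n G = ad x n ` G" for n using bpow_line[OF xc sub_whole] .
    have sim: "sub (ad x n ` G)" for n
      unfolding im[symmetric] using bpow_sub[OF sub_subset[OF sub_line[OF xc]] sub_whole] .
    have dec: "ad x n ` G \<subseteq> ad x m ` G" if "m \<le> n" for m n
    proof
      fix y assume "y \<in> ad x n ` G"
      then obtain z where "z \<in> G" "y = ad x n z" by blast
      then have "y = ad x m (ad x (n - m) z)" "ad x (n - m) z \<in> G"
        using ad_ad[of x m "n - m" z] that ad_closed[OF xc] by auto
      then show "y \<in> ad x m ` G" by blast
    qed
    obtain N0 where N0: "\<forall>n\<ge>N0. ad x n ` G = ad x N0 ` G"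
      using decr_stable[of "\<lambda>n. ad x n ` G", OF sim dec] by blast
    have "bpow P (k + 1) G \<subseteq> bpow P k P"
      unfolding bpow_add by (intro bpow_mono) (simp_all add: bpow_Suc idl_br'[OF P sub_whole])
    then have "bpow (line x) (k + 1) G \<subseteq> \<Phi>" using bpow_mono[OF lP subset_refl] k by blast
    then have Phi: "ad x (k + 1) ` G \<subseteq> \<Phi>" by (simp only: im)
    \<comment> \<open>From \<open>N0\<close> on the images are constant, from \<open>k + 1\<close>
      on they lie in the Frattini subalgebra; at \<open>N\<close> both hold.\<close>
    define N where "N = max N0 (k + 1)"
    have NPhi: "ad x N ` G \<subseteq> \<Phi>" using dec[of "k + 1" N] Phi unfolding N_def by simp
    have "N0 \<le> N" "N0 \<le> N + N" by (simp_all add: N_def)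
    then have NN: "ad x (N + N) ` G = ad x N ` G" using N0 by metis
    define E where "E = {y \<in> G. \<exists>n. ad x n y = \<zero>}"
    have algE: "alg E" unfolding E_def using alg_engel[OF xc] .
    have "E = G"
    proof (rule ccontr)
      assume "E \<noteq> G"
      then obtain M where M: "maximal_subalgebra F M L" "E \<subseteq> M" using ex_maximal[OF algE] by blast
      have "y \<in> M" if y: "y \<in> G" for y
      proof -
        \<comment> \<open>This is the Fitting decomposition of \<open>y\<close>: the difference
          \<open>y \<ominus> ad x N z\<close> is killed by \<open>ad x N\<close> and lies in
          \<open>E\<close>, while \<open>ad x N z\<close> lies in the Frattini subalgebra. Both
          parts are in \<open>M\<close>.\<close>
        have "ad x N y \<in> ad x (N + N) ` G" using NN y by blast
        then obtain z where z: "z \<in> G" "ad x N y = ad x N (ad x N z)" by (auto simp: ad_ad)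
        have zc: "ad x N z \<in> G" using ad_closed[OF xc z(1)] .
        have "ad x N (y \<ominus> ad x N z) = \<zero>"
          using ad_minus[OF xc y zc] z ad_closed[OF xc zc] by simp
        then have "y \<ominus> ad x N z \<in> M" using M(2) y zc unfolding E_def by blast
        moreover have "ad x N z \<in> M" using NPhi z frattini_le[OF M(1)] by blast
        ultimately show ?thesis using sub_diff_iff(3)[OF alg_sub[OF maximal_alg[OF M(1)]] y] by metis
      qed
      then show False using maximal_ne[OF M(1)] alg_subset[OF maximal_alg[OF M(1)]] by blast
    qed
    have inc: "{y \<in> G. ad x m y = \<zero>} \<subseteq> {y \<in> G. ad x n y = \<zero>}" if "m \<le> n" for m n
    proof
      fix y assume "y \<in> {y \<in> G. ad x m y = \<zero>}"
      then show "y \<in> {y \<in> G. ad x n y = \<zero>}"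
        using that ad_ad[of x "n - m" m y] ad_zero[OF xc] by simp
    qed
    \<comment> \<open>Engel's theorem below asks for one exponent that serves all of
      \<open>G\<close>; the stabilising kernels provide it.\<close>
    obtain J where J: "\<forall>n\<ge>J. {y \<in> G. ad x n y = \<zero>} = {y \<in> G. ad x J y = \<zero>}"
      using incr_stable[of "\<lambda>n. {y \<in> G. ad x n y = \<zero>}", OF sub_ad_kernel[OF xc] inc] by blast
    have "ad x J y = \<zero>" if y: "y \<in> G" for y
    proof -
      obtain n where "ad x n y = \<zero>" using y \<open>E = G\<close> E_def by blast
      then have "y \<in> {y \<in> G. ad x (max n J) y = \<zero>}" using inc[of n "max n J"] y by auto
      moreover have "{y \<in> G. ad x (max n J) y = \<zero>} = {y \<in> G. ad x J y = \<zero>}"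
        using J max.cobounded2 by blast
      ultimately show ?thesis by blast
    qed
    then show ?thesis by blast
  qed
  obtain r where r: "der P r \<subseteq> {\<zero>}"
    using solv_mono[OF S idl_subset[OF P]] unfolding solv_def by blast
  have "br P G \<subseteq> G" using idl_br'[OF P sub_whole] idl_subset[OF P] by blast
  from engel[OF sub_whole idl_alg[OF P] this nil r] obtain n where "bpow P n G \<subseteq> {\<zero>}"
    by blast
  then show ?thesis unfolding nilp_def using bpow_mono[OF subset_refl idl_subset[OF P], of P n] by blast
qed

end

context lie_algebra
begin

subsection \<open>Jacobson's lemma\<close>

text \<open>A polynomial in \<open>ad y\<close> applied to \<open>a\<close>. The second numeral
  counts coefficients, so a polynomial of degree d is \<open>peval y c (Suc d)\<close> with leading
  coefficient \<open>c d\<close>, and the values of \<open>c\<close> beyond the count are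
  irrelevant.\<close>

primrec peval where
  "peval y c 0 a = \<zero>"
| "peval y c (Suc n) a = peval y c n a \<oplus> c n \<odot> ad y n a"

definition coeffs where "coeffs c \<longleftrightarrow> (\<forall>n::nat. c n \<in> carrier F)"

lemma coeffsD: "coeffs c \<Longrightarrow> c n \<in> carrier F"
  by (simp add: coeffs_def)

lemma peval_closed:
  assumes "y \<in> G" "coeffs c" "a \<in> G"
  shows "peval y c n a \<in> G"
  by (induction n) (simp_all add: ad_closed[OF assms(1,3)] coeffsD[OF assms(2)])

lemma peval_cong: "(\<And>i. i < n \<Longrightarrow> c i = d i) \<Longrightarrow> peval y c n a = peval y d n a"
  by (induction n) simp_all

lemma peval_add:
  assumes "y \<in> G" "coeffs c" "a \<in> G" "b \<in> G"
  shows "peval y c n (a \<oplus> b) = peval y c n a \<oplus> peval y c n b"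
proof (induction n)
  case (Suc n)
  then show ?case
    using assms coeffsD[OF assms(2)] by (simp add: ad_add ad_closed peval_closed smult_r_distr M.a_ac)
qed simp

lemma peval_smult:
  assumes "y \<in> G" "coeffs c" "a \<in> G" "k \<in> carrier F"
  shows "peval y c n (k \<odot> a) = k \<odot> peval y c n a"
proof (induction n)
  case (Suc n)
  have "c n \<odot> (k \<odot> ad y n a) = k \<odot> (c n \<odot> ad y n a)"
    using assms coeffsD[OF assms(2)] by (simp add: ad_closed R.m_comm flip: smult_assoc1)
  then show ?case
    using Suc assms coeffsD[OF assms(2)] by (simp add: ad_smult ad_closed peval_closed smult_r_distr)
qed (use assms in simp)

lemma peval_zero: "y \<in> G \<Longrightarrow> coeffs c \<Longrightarrow> peval y c n \<zero> = \<zero>"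
  by (induction n) (simp_all add: ad_zero coeffsD)

lemma peval_coeff_add:
  assumes "y \<in> G" "coeffs c" "coeffs d" "a \<in> G"
  shows "peval y (\<lambda>i. c i \<oplus>\<^bsub>F\<^esub> d i) n a = peval y c n a \<oplus> peval y d n a"
proof (induction n)
  case (Suc n)
  then show ?case
    using assms coeffsD[OF assms(2)] coeffsD[OF assms(3)]
    by (simp add: ad_closed peval_closed smult_l_distr M.a_ac)
qed simp

lemma peval_coeff_smult:
  assumes "y \<in> G" "coeffs c" "a \<in> G" "k \<in> carrier F"
  shows "peval y (\<lambda>i. k \<otimes>\<^bsub>F\<^esub> c i) n a = k \<odot> peval y c n a"
proof (induction n)
  case (Suc n)
  then show ?case
    using assms coeffsD[OF assms(2)]
    by (simp add: ad_closed peval_closed smult_assoc1 smult_r_distr)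
qed (use assms in simp)

text \<open>For polynomials this is multiplication by the \<open>k\<close>-th power of the variable:
  all coefficients move up by \<open>k\<close>.\<close>

lemma peval_shift:
  assumes "y \<in> G" "coeffs c" "a \<in> G"
  shows "ad y k (peval y c n a) = peval y (\<lambda>i. if i < k then \<zero>\<^bsub>F\<^esub> else c (i - k)) (k + n) a"
proof (induction n)
  case 0
  have "peval y (\<lambda>i. if i < k then \<zero>\<^bsub>F\<^esub> else c (i - k)) j a = \<zero>" if "j \<le> k" for j
    using that by (induction j) (simp_all add: ad_closed[OF assms(1,3)])
  then show ?case using ad_zero[OF assms(1)] by simp
next
  case (Suc n)
  have "ad y k (peval y c (Suc n) a) = ad y k (peval y c n a) \<oplus> c n \<odot> ad y (k + n) a"
    using assms coeffsD[OF assms(2)] by (simp add: ad_add ad_smult ad_closed peval_closed ad_ad)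
  then show ?case using Suc by simp
qed

text \<open>Padding with zeros brings polynomials to a common length, so that they can be
  added.\<close>

lemma peval_extend: "j \<le> n \<Longrightarrow> y \<in> G \<Longrightarrow> a \<in> G \<Longrightarrow> coeffs c
  \<Longrightarrow> peval y (\<lambda>i. if i < j then c i else \<zero>\<^bsub>F\<^esub>) n a = peval y c j a"
proof (induction n)
  case (Suc n)
  show ?case
  proof (cases "j = Suc n")
    case True
    show ?thesis unfolding True by (rule peval_cong) simp
  next
    case False
    then have "peval y (\<lambda>i. if i < j then c i else \<zero>\<^bsub>F\<^esub>) n a = peval y c j a" using Suc by simp
    then show ?thesis using False Suc by (simp add: ad_closed peval_closed)
  qed
qed simp

text \<open>The product of two polynomials. Its leading coefficient is recorded because a product of
  non-zero polynomials must be recognised as non-zero.\<close>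

lemma peval_compose:
  assumes y: "y \<in> G" and c: "coeffs c" and d: "coeffs d"
  shows "\<exists>h. coeffs h \<and> h (n + e) = c n \<otimes>\<^bsub>F\<^esub> d e \<and>
    (\<forall>a\<in>G. peval y c (Suc n) (peval y d (Suc e) a) = peval y h (Suc (n + e)) a)"
proof (induction n)
  case 0
  have "coeffs (\<lambda>i. c 0 \<otimes>\<^bsub>F\<^esub> d i)" using coeffsD[OF c] coeffsD[OF d] by (simp add: coeffs_def)
  moreover have "peval y c (Suc 0) (peval y d (Suc e) a) = peval y (\<lambda>i. c 0 \<otimes>\<^bsub>F\<^esub> d i) (Suc e) a"
    if a: "a \<in> G" for a
    unfolding peval_coeff_smult[OF y d a coeffsD[OF c]]
    using peval_closed[OF y d a, of "Suc e"] coeffsD[OF c, of 0] by (simp del: peval.simps(2)[of y d])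
  ultimately show ?case by (intro exI[of _ "\<lambda>i. c 0 \<otimes>\<^bsub>F\<^esub> d i"]) simp
next
  case (Suc n)
  then obtain h where h: "coeffs h"
    "\<And>a. a \<in> G \<Longrightarrow> peval y c (Suc n) (peval y d (Suc e) a) = peval y h (Suc (n + e)) a"
    by blast
  \<comment> \<open>\<open>h1\<close> pads the product obtained so far, \<open>h2\<close> shifts
    \<open>d\<close> to the new power, and \<open>h3\<close> adds the new multiple of it.\<close>
  define h1 where "h1 i = (if i < Suc (n + e) then h i else \<zero>\<^bsub>F\<^esub>)" for i
  define h2 where "h2 i = (if i < Suc n then \<zero>\<^bsub>F\<^esub> else d (i - Suc n))" for i
  define h3 where "h3 i = h1 i \<oplus>\<^bsub>F\<^esub> c (Suc n) \<otimes>\<^bsub>F\<^esub> h2 i" for i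
  have co: "coeffs h1" "coeffs h2" "coeffs (\<lambda>i. c (Suc n) \<otimes>\<^bsub>F\<^esub> h2 i)"
    using coeffsD[OF h(1)] coeffsD[OF d] coeffsD[OF c] by (simp_all add: coeffs_def h1_def h2_def)
  then have "coeffs h3" by (simp add: coeffs_def h3_def)
  moreover have "h3 (Suc n + e) = c (Suc n) \<otimes>\<^bsub>F\<^esub> d e"
    using coeffsD[OF c] coeffsD[OF d] by (simp add: h3_def h1_def h2_def)
  moreover have "peval y c (Suc (Suc n)) (peval y d (Suc e) a) = peval y h3 (Suc (Suc n + e)) a"
    if a: "a \<in> G" for a
  proof -
    let ?m = "Suc (Suc n + e)"
    have "peval y h3 ?m a = peval y h1 ?m a \<oplus> c (Suc n) \<odot> peval y h2 ?m a"
      unfolding h3_def using peval_coeff_add[OF y co(1,3) a, of ?m]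
        peval_coeff_smult[OF y co(2) a coeffsD[OF c, of "Suc n"], of ?m] by (simp only:)
    moreover have "peval y h1 ?m a = peval y h (Suc (n + e)) a"
      unfolding h1_def by (rule peval_extend[OF _ y a h(1)]) simp
    moreover have "peval y h2 ?m a = ad y (Suc n) (peval y d (Suc e) a)"
      unfolding h2_def using peval_shift[OF y d a, of "Suc n" "Suc e"] by (simp only: add_Suc_right)
    ultimately show ?thesis using h(2)[OF a] by (simp only: peval.simps(2)[of y c "Suc n"])
  qed
  ultimately show ?case by blast
qed

text \<open>Moving \<open>ad x\<close> past each of the \<open>Suc n\<close> factors
  \<open>ad y\<close> leaves one factor \<open>ad z\<close>. Since \<open>y\<close> and
  \<open>z\<close> commute, these contributions are all equal, which produces the multiple
  \<open>Suc n\<close>.\<close>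

lemma ad_derivation:
  assumes x: "x \<in> G" and y: "y \<in> G" and xy: "x \<otimes> y = z" and yz: "y \<otimes> z = \<zero>" and a: "a \<in> G"
  shows "x \<otimes> ad y (Suc n) a
    = ad y (Suc n) (x \<otimes> a) \<oplus> ([Suc n] \<cdot>\<^bsub>F\<^esub> \<one>\<^bsub>F\<^esub>) \<odot> ad y n (z \<otimes> a)"
proof -
  have z: "z \<in> G" using xy bracket_closed[OF x y] by simp
  have comm: "z \<otimes> ad y n a = ad y n (z \<otimes> a)" for n
  proof (induction n)
    case (Suc n)
    have "z \<otimes> (y \<otimes> ad y n a) = (z \<otimes> y) \<otimes> ad y n a \<oplus> y \<otimes> (z \<otimes> ad y n a)"
      using jacobi_left[OF z y ad_closed[OF y a]] .
    moreover have "z \<otimes> y = \<zero>" using anticomm[OF z y] yz by simp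
    ultimately show ?case
      using Suc y z a by (simp add: ad_Suc ad_closed bracket_closed)
  qed simp
  show ?thesis
  proof (induction n)
    case 0
    show ?case
      using jacobi_left[OF x y a] xy x y z a by (simp add: ad_Suc bracket_closed M.a_comm)
  next
    case (Suc n)
    let ?i = "[Suc n] \<cdot>\<^bsub>F\<^esub> \<one>\<^bsub>F\<^esub>"
    have i: "?i \<in> carrier F" by simp
    have "x \<otimes> ad y (Suc (Suc n)) a
        = z \<otimes> ad y (Suc n) a \<oplus> y \<otimes> (x \<otimes> ad y (Suc n) a)"
      unfolding ad_Suc[of y "Suc n" a]
      using jacobi_left[OF x y ad_closed[OF y a], of "Suc n"] unfolding xy .
    also have "y \<otimes> (x \<otimes> ad y (Suc n) a)
        = ad y (Suc (Suc n)) (x \<otimes> a) \<oplus> ?i \<odot> ad y (Suc n) (z \<otimes> a)"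
      unfolding Suc using x y z a i
      by (simp add: bracket_add_right bracket_smult_right ad_closed bracket_closed flip: ad_Suc)
    also have "z \<otimes> ad y (Suc n) a = \<one>\<^bsub>F\<^esub> \<odot> ad y (Suc n) (z \<otimes> a)"
      using comm y z a by (simp add: ad_closed bracket_closed)
    also have "\<one>\<^bsub>F\<^esub> \<odot> ad y (Suc n) (z \<otimes> a) \<oplus> (ad y (Suc (Suc n)) (x \<otimes> a) \<oplus> ?i \<odot> ad y (Suc n) (z \<otimes> a))
        = ad y (Suc (Suc n)) (x \<otimes> a) \<oplus> (?i \<oplus>\<^bsub>F\<^esub> \<one>\<^bsub>F\<^esub>) \<odot> ad y (Suc n) (z \<otimes> a)"
      using x y z a i by (simp add: smult_l_distr ad_closed bracket_closed M.a_ac)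
    finally show ?case by simp
  qed
qed

text \<open>Linear extension of \<open>ad_derivation\<close>: moving \<open>ad x\<close> past f(ad
  y) costs f'(ad y) applied after \<open>ad z\<close>, the coefficients in the last term being those
  of the formal derivative f'.\<close>

lemma peval_derivation:
  assumes x: "x \<in> G" and y: "y \<in> G" and xy: "x \<otimes> y = z" and yz: "y \<otimes> z = \<zero>" and a: "a \<in> G"
    and c: "coeffs c"
  shows "x \<otimes> peval y c (Suc n) a = peval y c (Suc n) (x \<otimes> a)
    \<oplus> peval y (\<lambda>i. ([Suc i] \<cdot>\<^bsub>F\<^esub> \<one>\<^bsub>F\<^esub>) \<otimes>\<^bsub>F\<^esub> c (Suc i)) n (z \<otimes> a)"
proof (induction n)
  case 0
  show ?case using x y a coeffsD[OF c] by (simp add: bracket_smult_right bracket_closed)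
next
  case (Suc n)
  let ?d = "\<lambda>i. ([Suc i] \<cdot>\<^bsub>F\<^esub> \<one>\<^bsub>F\<^esub>) \<otimes>\<^bsub>F\<^esub> c (Suc i)"
  have z: "z \<in> G" using xy bracket_closed[OF x y] by simp
  have d: "coeffs ?d" using coeffsD[OF c] by (simp add: coeffs_def)
  note cl = ad_closed[OF y] peval_closed[OF y c] peval_closed[OF y d] bracket_closed x y z a coeffsD[OF c]
  let ?i = "[Suc n] \<cdot>\<^bsub>F\<^esub> \<one>\<^bsub>F\<^esub>" and ?k = "c (Suc n)"
  have ik: "?i \<in> carrier F" "?k \<in> carrier F" using coeffsD[OF c] by auto
  have eq: "?k \<odot> (x \<otimes> ad y (Suc n) a)
      = ?k \<odot> ad y (Suc n) (x \<otimes> a) \<oplus> ?d n \<odot> ad y n (z \<otimes> a)"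
    unfolding ad_derivation[OF x y xy yz a]
    using ik cl by (simp only: smult_r_distr smult_closed smult_assoc1 R.m_comm[of ?i ?k])
  have "x \<otimes> peval y c (Suc (Suc n)) a = x \<otimes> peval y c (Suc n) a \<oplus> ?k \<odot> (x \<otimes> ad y (Suc n) a)"
    using ik cl by (simp only: peval.simps(2)[of y c "Suc n"] bracket_add_right bracket_smult_right smult_closed)
  also have "\<dots> = (peval y c (Suc n) (x \<otimes> a) \<oplus> peval y ?d n (z \<otimes> a))
      \<oplus> (?k \<odot> ad y (Suc n) (x \<otimes> a) \<oplus> ?d n \<odot> ad y n (z \<otimes> a))"
    unfolding Suc eq ..
  also have "\<dots> = (peval y c (Suc n) (x \<otimes> a) \<oplus> ?k \<odot> ad y (Suc n) (x \<otimes> a))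
      \<oplus> (peval y ?d n (z \<otimes> a) \<oplus> ?d n \<odot> ad y n (z \<otimes> a))"
    using ik coeffsD[OF d, of n] cl by (simp only: M.a_ac M.a_closed smult_closed)
  finally show ?case by (simp only: peval.simps(2))
qed

end

context fd_lie_algebra
begin

text \<open>The spaces \<open>V n\<close> spanned by the first \<open>n\<close> of the vectors b,
  [y,b], [y,[y,b]], ... increase and become constant at some \<open>N\<close>; then
  \<open>ad y N b\<close> depends linearly on its predecessors.\<close>

lemma peval_vector_annihilated:
  assumes y: "y \<in> G" and b: "b \<in> G"
  shows "\<exists>c n. coeffs c \<and> c n \<noteq> \<zero>\<^bsub>F\<^esub> \<and> peval y c (Suc n) b = \<zero>"
proof -
  define V where "V n = {peval y c n b | c. coeffs c}" for n
  have VI: "peval y c n b \<in> V n" if "coeffs c" for c n using that unfolding V_def by blast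
  have sV: "sub (V n)" for n
  proof (rule subI)
    show "V n \<subseteq> G" using peval_closed[OF y _ b] by (auto simp: V_def)
    have "coeffs (\<lambda>i. \<zero>\<^bsub>F\<^esub>)" by (simp add: coeffs_def)
    moreover have "peval y (\<lambda>i. \<zero>\<^bsub>F\<^esub>) n b = \<zero>" by (induction n) (simp_all add: ad_closed[OF y b])
    ultimately show "\<zero> \<in> V n" using VI by metis
  next
    fix u v assume "u \<in> V n" "v \<in> V n"
    then obtain c d where cd: "coeffs c" "coeffs d" "u = peval y c n b" "v = peval y d n b"
      unfolding V_def by blast
    have "coeffs (\<lambda>i. c i \<oplus>\<^bsub>F\<^esub> d i)" using coeffsD[OF cd(1)] coeffsD[OF cd(2)] by (simp add: coeffs_def)
    from VI[OF this, of n] show "u \<oplus> v \<in> V n" unfolding peval_coeff_add[OF y cd(1,2) b] cd(3,4) .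
  next
    fix k u assume k: "k \<in> carrier F" and "u \<in> V n"
    then obtain c where cd: "coeffs c" "u = peval y c n b" unfolding V_def by blast
    have "coeffs (\<lambda>i. k \<otimes>\<^bsub>F\<^esub> c i)" using coeffsD[OF cd(1)] k by (simp add: coeffs_def)
    from VI[OF this, of n] show "k \<odot> u \<in> V n" unfolding peval_coeff_smult[OF y cd(1) b k] cd(2) .
  qed
  have inc: "V m \<subseteq> V n" if mn: "m \<le> n" for m n
  proof
    fix u assume "u \<in> V m"
    then obtain c where c: "coeffs c" "u = peval y c m b" unfolding V_def by blast
    have "coeffs (\<lambda>i. if i < m then c i else \<zero>\<^bsub>F\<^esub>)" using coeffsD[OF c(1)] by (simp add: coeffs_def)
    from VI[OF this, of n] show "u \<in> V n" unfolding peval_extend[OF mn y b c(1)] c(2) .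
  qed
  obtain N where "\<forall>n\<ge>N. V n = V N" using incr_stable[of V, OF sV inc] by blast
  from spec[OF this, of "Suc N"] have N: "V (Suc N) = V N" by simp
  \<comment> \<open>The coefficients of the single power \<open>N\<close>; they place
    \<open>ad y N b\<close> in \<open>V (Suc N)\<close>, which equals \<open>V N\<close>.\<close>
  define e where "e i = (if i = N then \<one>\<^bsub>F\<^esub> else \<zero>\<^bsub>F\<^esub>)" for i
  have e: "coeffs e" by (simp add: coeffs_def e_def)
  have "peval y e N b = peval y (\<lambda>i. \<zero>\<^bsub>F\<^esub>) N b" by (rule peval_cong) (simp add: e_def)
  moreover have "peval y (\<lambda>i. \<zero>\<^bsub>F\<^esub>) N b = \<zero>" by (induction N) (simp_all add: ad_closed[OF y b])
  ultimately have "peval y e (Suc N) b = ad y N b" by (simp add: e_def ad_closed[OF y b])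
  then have "ad y N b \<in> V N" using VI[OF e, of "Suc N"] N by simp
  then obtain c where c: "coeffs c" "ad y N b = peval y c N b" unfolding V_def by blast
  \<comment> \<open>Bringing \<open>ad y N b\<close> to the other side of the relation gives the
    leading coefficient -1, which is not 0.\<close>
  define h where "h i = (if i = N then \<ominus>\<^bsub>F\<^esub> \<one>\<^bsub>F\<^esub> else c i)" for i
  have h: "coeffs h" using coeffsD[OF c(1)] by (simp add: coeffs_def h_def)
  have "peval y h N b = peval y c N b" by (rule peval_cong) (simp add: h_def)
  then have "peval y h (Suc N) b = \<zero>"
    using c(2) ad_closed[OF y b, of N] by (simp add: h_def smult_minus_1 M.r_neg)
  moreover have "h N \<noteq> \<zero>\<^bsub>F\<^esub>" by (simp add: h_def)
  ultimately show ?thesis using h by blast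
qed

end

context lie_algebra
begin

end

context fd_lie_algebra
begin

text \<open>Among the kernels in \<open>A\<close> of non-zero polynomials in \<open>ad y\<close>
  take a largest one. If some \<open>a\<close> escaped it, multiplying by a polynomial that
  annihilates the image of \<open>a\<close> would enlarge the kernel.\<close>

lemma ad_algebraic:
  assumes y: "y \<in> G" and A: "sub A"
  shows "\<exists>c n. coeffs c \<and> c n \<noteq> \<zero>\<^bsub>F\<^esub> \<and> (\<forall>a\<in>A. peval y c (Suc n) a = \<zero>)"
proof -
  define K where "K c n = {a \<in> A. peval y c (Suc n) a = \<zero>}" for c n
  have Ac: "a \<in> G" if "a \<in> A" for a using that sub_carrier[OF A] by blast
  have sK: "sub (K c n)" if c: "coeffs c" for c n
  proof (rule subI)
    show "K c n \<subseteq> G" using Ac by (auto simp only: K_def)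
    show "\<zero> \<in> K c n" unfolding K_def using sub_zero[OF A] peval_zero[OF y c] by blast
    show "u \<oplus> v \<in> K c n" if "u \<in> K c n" "v \<in> K c n" for u v
      using that peval_add[OF y c Ac Ac, of u v "Suc n"] sub_add[OF A]
      unfolding K_def by (simp del: peval.simps)
    show "k \<odot> u \<in> K c n" if "k \<in> carrier F" "u \<in> K c n" for k u
      using that peval_smult[OF y c Ac, of u k "Suc n"] sub_smult[OF A]
      unfolding K_def by (simp del: peval.simps)
  qed
  define P where "P W \<longleftrightarrow> (\<exists>c n. coeffs c \<and> c n \<noteq> \<zero>\<^bsub>F\<^esub> \<and> W = K c n)" for W
  \<comment> \<open>The constant polynomial 1 shows that there is some kernel to start from.\<close>
  have "coeffs (\<lambda>_. \<one>\<^bsub>F\<^esub>)" by (simp add: coeffs_def)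
  then have "P (K (\<lambda>_. \<one>\<^bsub>F\<^esub>) 0)" unfolding P_def by (metis field.zero_not_one field_axioms)
  moreover have "sub W" if "P W" for W using that sK unfolding P_def by blast
  ultimately obtain W where "P W" and max: "\<forall>W'. P W' \<and> W \<subseteq> W' \<longrightarrow> W' = W"
    using ex_maximal_sub[of P] by metis
  then obtain c n where c: "coeffs c" "c n \<noteq> \<zero>\<^bsub>F\<^esub>" and W: "W = K c n" unfolding P_def by blast
  have "peval y c (Suc n) a = \<zero>" if a: "a \<in> A" for a
  proof (rule ccontr)
    assume ne: "peval y c (Suc n) a \<noteq> \<zero>"
    have bc: "peval y c (Suc n) a \<in> G" using peval_closed[OF y c(1) Ac[OF a]] .
    obtain d m where d: "coeffs d" "d m \<noteq> \<zero>\<^bsub>F\<^esub>" "peval y d (Suc m) (peval y c (Suc n) a) = \<zero>"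
      using peval_vector_annihilated[OF y bc] by blast
    obtain e where e: "coeffs e" "e (m + n) = d m \<otimes>\<^bsub>F\<^esub> c n"
      and ev: "\<And>u. u \<in> G \<Longrightarrow> peval y e (Suc (m + n)) u = peval y d (Suc m) (peval y c (Suc n) u)"
      using peval_compose[OF y d(1) c(1), of m n] by metis
    have en: "e (m + n) \<noteq> \<zero>\<^bsub>F\<^esub>"
      unfolding e(2) using d(2) c(2) coeffsD[OF d(1)] coeffsD[OF c(1)] by (simp add: integral_iff)
    have "K c n \<subseteq> K e (m + n)"
    proof
      fix u assume "u \<in> K c n"
      then have u: "u \<in> A" "peval y c (Suc n) u = \<zero>" unfolding K_def by blast+
      have "peval y e (Suc (m + n)) u = \<zero>"
        unfolding ev[OF Ac[OF u(1)]] u(2) by (rule peval_zero[OF y d(1)])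
      then show "u \<in> K e (m + n)" using u unfolding K_def by blast
    qed
    moreover have "P (K e (m + n))" unfolding P_def using e(1) en by blast
    ultimately have "K e (m + n) = K c n" using max W by blast
    moreover have "a \<in> K e (m + n)" unfolding K_def using a d(3) ev[OF Ac[OF a]] by simp
    ultimately show False using ne unfolding K_def by blast
  qed
  then show ?thesis using c by blast
qed

text \<open>A relation \<open>f(ad y) (ad z)\<^sup>j = 0\<close> on \<open>A\<close>, bracketed with \<open>x\<close>, yields
  \<open>f'(ad y) (ad z)\<^sup>2\<^sup>j\<^sup>+\<^sup>2 = 0\<close>; in characteristic 0 the degree drops until \<open>ad z\<close> is nilpotent.\<close>
lemma jacobson:
  assumes char0: "\<And>n. [Suc n] \<cdot>\<^bsub>F\<^esub> \<one>\<^bsub>F\<^esub> \<noteq> \<zero>\<^bsub>F\<^esub>"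
    and x: "x \<in> G" and y: "y \<in> G" and xy: "x \<otimes> y = z" and xz: "x \<otimes> z = w"
    and yz: "y \<otimes> z = \<zero>" and zw: "z \<otimes> w = \<zero>"
    and A: "sub A" and xA: "\<And>a. a \<in> A \<Longrightarrow> x \<otimes> a \<in> A" and zA: "\<And>a. a \<in> A \<Longrightarrow> z \<otimes> a \<in> A"
    and wA: "\<And>a. a \<in> A \<Longrightarrow> w \<otimes> a \<in> A"
  shows "\<exists>n. ad z n ` A \<subseteq> {\<zero>}"
proof -
  have z: "z \<in> G" using xy bracket_closed[OF x y] by simp
  have Ac: "a \<in> G" if "a \<in> A" for a using that sub_carrier[OF A] by blast
  have adA: "ad z n a \<in> A" if "a \<in> A" for a n
    using that by (induction n) (simp_all add: ad_Suc zA)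
  have main: "\<exists>n. ad z n ` A \<subseteq> {\<zero>}"
    if "coeffs c" "c d \<noteq> \<zero>\<^bsub>F\<^esub>" "\<And>a. a \<in> A \<Longrightarrow> peval y c (Suc d) (ad z j a) = \<zero>" for c d j
    using that
  proof (induction d arbitrary: c j)
    case 0
    have "ad z j a = \<zero>" if a: "a \<in> A" for a
    proof -
      have "c 0 \<odot> ad z j a = \<zero>"
        using 0(3)[OF a] coeffsD[OF 0(1)] ad_closed[OF z Ac[OF a]] by simp
      then show ?thesis
        using smult_cancel[OF sub_trivial ad_closed[OF z Ac[OF a], of j] coeffsD[OF 0(1)] 0(2)] by simp
    qed
    then show ?case by blast
  next
    case (Suc d)
    let ?c' = "\<lambda>i. ([Suc i] \<cdot>\<^bsub>F\<^esub> \<one>\<^bsub>F\<^esub>) \<otimes>\<^bsub>F\<^esub> c (Suc i)"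
    note c = Suc(2)
    have c': "coeffs ?c'" using coeffsD[OF c] by (simp add: coeffs_def)
    \<comment> \<open>The place where the characteristic enters: the leading coefficient of the
      derivative is a positive integer multiple of that of f.\<close>
    have "?c' d \<noteq> \<zero>\<^bsub>F\<^esub>" using char0[of d] Suc(3) coeffsD[OF c] by (simp only: integral_iff R.add.nat_pow_closed R.one_closed) simp
    moreover have "peval y ?c' (Suc d) (ad z (Suc (Suc (j + j))) a) = \<zero>" if a: "a \<in> A" for a
    proof -
      \<comment> \<open>The exponent leaves room: after \<open>ad x\<close> has moved past
        \<open>ad z ?k\<close>, both resulting terms still carry at least \<open>j\<close> factors
        \<open>ad z\<close> and are killed by f. Only the derivative term survives, with one more
        factor \<open>ad z\<close>, so it vanishes.\<close>
      let ?k = "Suc (j + j)" and ?f = "peval y c (Suc (Suc d))"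
      let ?i = "[?k] \<cdot>\<^bsub>F\<^esub> \<one>\<^bsub>F\<^esub>"
      have f0: "?f (ad z m b) = \<zero>" if "j \<le> m" "b \<in> A" for m b
      proof -
        have "?f (ad z j (ad z (m - j) b)) = \<zero>" using Suc(4)[OF adA[OF that(2)]] .
        then show ?thesis using that(1) by (simp only: ad_ad le_add_diff_inverse)
      qed
      have ac: "ad z ?k a \<in> G" using ad_closed[OF z Ac[OF a]] .
      have wa: "w \<otimes> a \<in> A" and xa: "x \<otimes> a \<in> A" using wA xA a by auto
      have cl: "ad z ?k (x \<otimes> a) \<in> G" "ad z (j + j) (w \<otimes> a) \<in> G" "?i \<in> carrier F"
        using ad_closed[OF z Ac[OF xa]] ad_closed[OF z Ac[OF wa]] by (auto simp del: R.add.nat_pow_Suc)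
      have "?f (x \<otimes> ad z ?k a) = ?f (ad z ?k (x \<otimes> a) \<oplus> ?i \<odot> ad z (j + j) (w \<otimes> a))"
        using ad_derivation[OF x z xz zw Ac[OF a], of "j + j"] by (simp only:)
      also have "\<dots> = ?f (ad z ?k (x \<otimes> a)) \<oplus> ?i \<odot> ?f (ad z (j + j) (w \<otimes> a))"
        using peval_add[OF y c cl(1) smult_closed[OF cl(3,2)], of "Suc (Suc d)"]
          peval_smult[OF y c cl(2,3), of "Suc (Suc d)"] by (simp only:)
      also have "\<dots> = \<zero>"
        using f0[OF _ xa, of ?k] f0[OF _ wa, of "j + j"] cl(3) by (simp del: peval.simps R.add.nat_pow_Suc)
      finally have "?f (x \<otimes> ad z ?k a) = \<zero>" .
      moreover have "x \<otimes> ?f (ad z ?k a) = \<zero>" using f0[OF _ a, of ?k] x by (simp del: peval.simps)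
      moreover have "x \<otimes> ?f (ad z ?k a)
          = ?f (x \<otimes> ad z ?k a) \<oplus> peval y ?c' (Suc d) (z \<otimes> ad z ?k a)"
        using peval_derivation[OF x y xy yz ac c] .
      ultimately show ?thesis
        using peval_closed[OF y c' bracket_closed[OF z ac], of "Suc d"]
        by (simp only: ad_Suc[of z ?k] M.l_zero)
    qed
    ultimately show ?case using Suc.IH[OF c', of "Suc (Suc (j + j))"] by blast
  qed
  obtain c n where c: "coeffs c" "c n \<noteq> \<zero>\<^bsub>F\<^esub>" "\<forall>a\<in>A. peval y c (Suc n) a = \<zero>"
    using ad_algebraic[OF y A] by blast
  have "peval y c (Suc n) (ad z 0 a) = \<zero>" if "a \<in> A" for a using c(3) that by (simp del: peval.simps)
  from main[OF c(1,2) this] show ?thesis .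
qed

end

context lie_algebra
begin

subsection \<open>The structure of a minimal non-$\mathcal{N}(\leq 2)$ algebra with trivial Frattini subalgebra\<close>

definition minid where
  "minid S A \<longleftrightarrow> idl S A \<and> A \<noteq> {\<zero>} \<and> (\<forall>I. idl S I \<and> I \<subseteq> A \<longrightarrow> I = {\<zero>} \<or> I = A)"

lemma minidD:
  assumes "minid S A"
  shows minid_idl: "idl S A" and minid_ne: "A \<noteq> {\<zero>}"
    and minid_cases: "\<And>I. idl S I \<Longrightarrow> I \<subseteq> A \<Longrightarrow> I = {\<zero>} \<or> I = A"
  using assms unfolding minid_def by auto

lemma sub_ne_trivial: "sub A \<Longrightarrow> A \<noteq> {\<zero>} \<Longrightarrow> \<exists>a\<in>A. a \<noteq> \<zero>"
  using sub_zero[of A] by blast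

lemma sub_le_trivial: "sub A \<Longrightarrow> A \<subseteq> {\<zero>} \<Longrightarrow> A = {\<zero>}"
  using sub_zero[of A] by blast

text \<open>The last non-zero term among the iterated brackets of \<open>H\<close> with
  \<open>A\<close> is annihilated by \<open>H\<close>.\<close>

lemma act_kernel:
  assumes H: "H \<subseteq> G" and A: "sub A" "A \<noteq> {\<zero>}" and k: "bpow H k A \<subseteq> {\<zero>}" and HA: "br H A \<subseteq> A"
  shows "\<exists>a\<in>A. a \<noteq> \<zero> \<and> (\<forall>h\<in>H. h \<otimes> a = \<zero>)"
proof -
  define n where "n = (LEAST n. bpow H n A \<subseteq> {\<zero>})"
  have n: "bpow H n A \<subseteq> {\<zero>}" unfolding n_def by (rule LeastI[of _ k]) (rule k)
  have "\<not> A \<subseteq> {\<zero>}" using sub_le_trivial A by blast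
  then have "n \<noteq> 0" using n by (metis bpow_0)
  then obtain m where m: "n = Suc m" by (meson not0_implies_Suc)
  have "\<not> bpow H m A \<subseteq> {\<zero>}"
    using not_less_Least[of m "\<lambda>n. bpow H n A \<subseteq> {\<zero>}"] m unfolding n_def by simp
  then obtain a where a: "a \<in> bpow H m A" "a \<noteq> \<zero>" by blast
  have "bpow H m A \<subseteq> A" using bpow_invariant[OF A(1) HA subset_refl] .
  moreover have "h \<otimes> a = \<zero>" if "h \<in> H" for h
    using br_in[OF H bpow_subset[OF H sub_subset[OF A(1)]] that a(1)] n unfolding m bpow_Suc by blast
  ultimately show ?thesis using a by blast
qed

text \<open>Since \<open>C\<close> normalises \<open>N\<close>, the annihilator of \<open>N\<close>
  in \<open>A\<close> is invariant under \<open>C\<close>. It is not 0 by assumption, so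
  irreducibility makes it all of \<open>A\<close>.\<close>

lemma irreducible_annihilated:
  assumes A: "sub A" and N: "N \<subseteq> G" and C: "C \<subseteq> G"
    and CN: "\<And>c n. c \<in> C \<Longrightarrow> n \<in> N \<Longrightarrow> c \<otimes> n \<in> N"
    and CA: "\<And>c a. c \<in> C \<Longrightarrow> a \<in> A \<Longrightarrow> c \<otimes> a \<in> A"
    and irr: "\<And>I. sub I \<Longrightarrow> I \<subseteq> A \<Longrightarrow> (\<And>c a. c \<in> C \<Longrightarrow> a \<in> I \<Longrightarrow> c \<otimes> a \<in> I) \<Longrightarrow> I = {\<zero>} \<or> I = A"
    and ex: "\<exists>a\<in>A. a \<noteq> \<zero> \<and> (\<forall>n\<in>N. n \<otimes> a = \<zero>)"
    and n: "n \<in> N" and a: "a \<in> A"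
  shows "n \<otimes> a = \<zero>"
proof -
  have Ac: "u \<in> G" if "u \<in> A" for u using that sub_carrier[OF A] by blast
  define I where "I = {a \<in> A. \<forall>n\<in>N. n \<otimes> a = \<zero>}"
  have "sub I" using sub_transporter[OF A sub_trivial N] by (simp add: I_def)
  moreover have "I \<subseteq> A" by (auto simp: I_def)
  moreover have "c \<otimes> u \<in> I" if c: "c \<in> C" and u: "u \<in> I" for c u
  proof -
    have uA: "u \<in> A" and uN: "\<And>h. h \<in> N \<Longrightarrow> h \<otimes> u = \<zero>" using u by (auto simp: I_def)
    have "h \<otimes> (c \<otimes> u) = \<zero>" if h: "h \<in> N" for h
    proof -
      have cl: "h \<in> G" "c \<in> G" "u \<in> G" "c \<otimes> h \<in> G" using h c N C Ac[OF uA] bracket_closed by auto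
      have "(h \<otimes> c) \<otimes> u = \<zero>"
        using anticomm[OF cl(1,2)] bracket_neg(2)[OF cl(4,3)] uN[OF CN[OF c h]] by simp
      then show ?thesis using jacobi_left[OF cl(1-3)] uN[OF h] cl by simp
    qed
    then show ?thesis using CA[OF c uA] by (simp add: I_def)
  qed
  ultimately have "I = {\<zero>} \<or> I = A" by (rule irr)
  then have "I = A" using ex by (auto simp: I_def)
  then show ?thesis using n a by (auto simp: I_def)
qed

lemma plus_commute:
  assumes "sub U" "sub W" shows "U \<boxplus> W = W \<boxplus> U"
proof -
  have "U \<boxplus> W \<subseteq> W \<boxplus> U" if "sub U" "sub W" for U W
    using plus_least[OF sub_plus[OF that(2,1)]] plus_left[OF that(2,1)] plus_right[OF that(2,1)] by blast
  then show ?thesis using assms by blast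
qed

text \<open>Modulo the ideal \<open>A\<close>, brackets in A + S are brackets in \<open>S\<close>,
  so the two lower central series agree there.\<close>

lemma bpow_mod:
  assumes A: "idl G A" and S: "sub S"
  shows "bpow (A \<boxplus> S) n (A \<boxplus> S) \<subseteq> bpow S n S \<boxplus> A"
proof (induction n)
  case 0
  show ?case using plus_commute[OF idl_sub[OF A] S] by simp
next
  case (Suc n)
  note sA = idl_sub[OF A] and Sc = sub_subset[OF S]
  have sn: "sub (bpow S n S)" "sub (bpow S (Suc n) S)" using bpow_sub[OF Sc S] by blast+
  have W: "sub (bpow S (Suc n) S \<boxplus> A)" using sub_plus[OF sn(2) sA] .
  have AW: "A \<subseteq> bpow S (Suc n) S \<boxplus> A" and SW: "br S (bpow S n S) \<subseteq> bpow S (Suc n) S \<boxplus> A"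
    using plus_right[OF sn(2) sA] plus_left[OF sn(2) sA] by (auto simp only: bpow_Suc)
  have "br A V \<subseteq> A" if "sub V" for V
    using br_mono[OF subset_refl sub_subset[OF that], of A] idl_br'[OF A sub_whole] by blast
  moreover have "br S A \<subseteq> A" using br_mono[OF Sc subset_refl, of A] idl_br[OF A] by blast
  ultimately have "br (A \<boxplus> S) (bpow S n S \<boxplus> A) \<subseteq> bpow S (Suc n) S \<boxplus> A"
    using W AW SW sA S sn by (intro br_plus_left br_plus_right sub_plus) (blast+)
  then show ?case using br_mono[OF subset_refl Suc] unfolding bpow_Suc by blast
qed

end

context fd_lie_algebra
begin

lemma ex_minid:
  assumes "idl S I" "I \<noteq> {\<zero>}"
  shows "\<exists>A. minid S A \<and> A \<subseteq> I"
proof -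
  obtain A where A: "idl S A \<and> A \<noteq> {\<zero>}" "A \<subseteq> I"
    "\<forall>A'. (idl S A' \<and> A' \<noteq> {\<zero>}) \<and> A' \<subseteq> A \<longrightarrow> A' = A"
    using ex_minimal_sub[of "\<lambda>A. idl S A \<and> A \<noteq> {\<zero>}" I] assms idl_sub by metis
  then have "minid S A" unfolding minid_def by blast
  then show ?thesis using A by blast
qed

end

section \<open>Splittings over a unique abelian minimal ideal\<close>

locale split_lie_algebra = fd_lie_algebra F L for F and L (structure) +
  fixes A C
  assumes A_min: "minid G A" and A_unique: "\<And>A'. minid G A' \<Longrightarrow> A' = A"
    and A_abelian: "br A A \<subseteq> {\<zero>}" and C_alg: "alg C"
    and AC: "A \<boxplus> C = G" and AC_disj: "A \<inter> C = {\<zero>}"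
begin

lemmas A_idl = minid_idl[OF A_min]
lemmas A_sub = idl_sub[OF A_idl]
lemmas C_sub = alg_sub[OF C_alg]
lemmas A_subset = sub_subset[OF A_sub]
lemmas C_subset = sub_subset[OF C_sub]

lemma decompose: "x \<in> G \<Longrightarrow> \<exists>a\<in>A. \<exists>c\<in>C. x = a \<oplus> c"
  using set_add_iff[of x A C] AC by blast

lemma A_bracket: "a \<in> A \<Longrightarrow> b \<in> A \<Longrightarrow> a \<otimes> b = \<zero>"
  using br_in[OF A_subset A_subset] A_abelian by blast

text \<open>As \<open>A\<close> acts trivially on itself, the subspaces of \<open>A\<close>
  invariant under \<open>C\<close> are ideals of \<open>G\<close>; so \<open>C\<close> acts
  irreducibly on \<open>A\<close>.\<close>

lemma C_invariant_cases:
  assumes I: "sub I" "I \<subseteq> A" and CI: "\<And>c a. c \<in> C \<Longrightarrow> a \<in> I \<Longrightarrow> c \<otimes> a \<in> I"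
  shows "I = {\<zero>} \<or> I = A"
proof (rule minid_cases[OF A_min _ I(2)])
  show "idl G I"
  proof (rule idlI[OF I(1) sub_subset[OF I(1)]])
    fix x y assume "x \<in> G" and y: "y \<in> I"
    then obtain a c where ac: "a \<in> A" "c \<in> C" "x = a \<oplus> c" using decompose by blast
    have cl: "a \<in> G" "c \<in> G" "y \<in> G" using ac y I(2) A_subset C_subset by auto
    have "a \<otimes> y = \<zero>" using A_bracket ac y I(2) by blast
    then have "x \<otimes> y = c \<otimes> y" using ac(3) bracket_add_left[OF cl] cl bracket_closed by simp
    then show "x \<otimes> y \<in> I" using CI[OF ac(2) y] by simp
  qed
qed

text \<open>The centraliser of \<open>A\<close> in \<open>C\<close> is an ideal of \<open>G\<close>.
  If it were not 0 it would contain the unique minimal ideal \<open>A\<close>, although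
  \<open>C\<close> meets \<open>A\<close> in 0.\<close>

lemma faithful:
  assumes c: "c \<in> C" "\<And>a. a \<in> A \<Longrightarrow> c \<otimes> a = \<zero>"
  shows "c = \<zero>"
proof -
  define Z where "Z = {c \<in> C. \<forall>a\<in>A. a \<otimes> c = \<zero>}"
  have sZ: "sub Z" using sub_transporter[OF C_sub sub_trivial A_subset] by (simp add: Z_def)
  have swap: "u \<otimes> v = \<zero>" if "v \<otimes> u = \<zero>" "u \<in> G" "v \<in> G" for u v
    using anticomm[OF that(2,3)] that(1) by simp
  have "idl G Z"
  proof (rule idlI[OF sZ sub_subset[OF sZ]])
    fix x z assume "x \<in> G" and z: "z \<in> Z"
    then obtain a d where ad: "a \<in> A" "d \<in> C" "x = a \<oplus> d" using decompose by blast
    have zC: "z \<in> C" and Az: "\<And>b. b \<in> A \<Longrightarrow> b \<otimes> z = \<zero>" using z by (auto simp: Z_def)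
    have cl: "a \<in> G" "d \<in> G" "z \<in> G" using ad zC A_subset C_subset by auto
    have xz: "x \<otimes> z = d \<otimes> z"
      using ad(3) bracket_add_left[OF cl] Az[OF ad(1)] cl bracket_closed by simp
    have "b \<otimes> (d \<otimes> z) = \<zero>" if b: "b \<in> A" for b
    proof -
      have bc: "b \<in> G" using b A_subset by blast
      have "(b \<otimes> d) \<otimes> z = \<zero>" using Az[OF idlD2[OF A_idl sub_whole cl(2) b]] .
      then show ?thesis using jacobi_left[OF bc cl(2,3)] Az[OF b] cl by simp
    qed
    then show "x \<otimes> z \<in> Z" using xz alg_bracket[OF C_alg ad(2) zC] by (simp add: Z_def)
  qed
  moreover have "\<not> A \<subseteq> Z"
  proof
    assume "A \<subseteq> Z"
    then have "A \<subseteq> {\<zero>}" using AC_disj by (auto simp: Z_def)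
    then show False using sub_le_trivial[OF A_sub] minid_ne[OF A_min] by blast
  qed
  ultimately have "Z = {\<zero>}" using ex_minid[of G Z] A_unique by blast
  moreover have "c \<in> Z" unfolding Z_def using c(1) swap[OF c(2)] A_subset C_subset by blast
  ultimately show ?thesis by blast
qed

text \<open>A nilpotent ideal acts nilpotently on \<open>A\<close>, so it annihilates a non-zero
  vector and by irreducibility all of \<open>A\<close>. The \<open>C\<close>-component of each of
  its elements then acts as 0 too and vanishes by faithfulness.\<close>

lemma nilp_ideal_le:
  assumes N: "idl G N" "nilp N"
  shows "N \<subseteq> A"
proof
  fix n assume n: "n \<in> N"
  note Nc = idl_subset[OF N(1)]
  obtain k where "bpow N k G \<subseteq> {\<zero>}" using idl_nilp_acts[OF N(1) sub_whole N(2)] by blast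
  then have k: "bpow N k A \<subseteq> {\<zero>}" using bpow_mono[OF subset_refl A_subset, of N k] by blast
  have "br N A \<subseteq> A" using br_mono[OF Nc subset_refl, of A] idl_br[OF A_idl] by blast
  from act_kernel[OF Nc A_sub minid_ne[OF A_min] k this]
  have ex: "\<exists>a\<in>A. a \<noteq> \<zero> \<and> (\<forall>n\<in>N. n \<otimes> a = \<zero>)" .
  have irr: "I = {\<zero>} \<or> I = A"
    if "sub I" "I \<subseteq> A" "\<And>c a. c \<in> G \<Longrightarrow> a \<in> I \<Longrightarrow> c \<otimes> a \<in> I" for I
    using C_invariant_cases[OF that(1,2)] that(3) C_subset by blast
  have nA: "n \<otimes> a = \<zero>" if "a \<in> A" for a
    by (rule irreducible_annihilated[OF A_sub Nc subset_refl idl_bracket[OF N(1)]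
          idl_bracket[OF A_idl] irr ex n that])
  obtain a c where ac: "a \<in> A" "c \<in> C" "n = a \<oplus> c" using decompose n Nc by blast
  have cl: "a \<in> G" "c \<in> G" using ac A_subset C_subset by auto
  have "c \<otimes> b = \<zero>" if b: "b \<in> A" for b
  proof -
    have bc: "b \<in> G" using b A_subset by blast
    have "\<zero> = a \<otimes> b \<oplus> c \<otimes> b" using nA[OF b] ac(3) bracket_add_left[OF cl bc] by simp
    then show ?thesis using A_bracket[OF ac(1) b] cl bc bracket_closed by simp
  qed
  then have "c = \<zero>" using faithful ac(2) by blast
  then show "n \<in> A" using ac cl by simp
qed

text \<open>A nilpotent action has a non-zero annihilated vector, the annihilator of an ideal of
  \<open>C\<close> is invariant under \<open>C\<close>, so the action is trivial and faithfulness
  applies.\<close>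

lemma C_ideal_trivial:
  assumes M: "idl C M" and k: "bpow M k A \<subseteq> {\<zero>}"
  shows "M = {\<zero>}"
proof -
  have MC: "M \<subseteq> C" using idl_subset[OF M] .
  have Mc: "M \<subseteq> G" using MC C_subset by blast
  have "br M A \<subseteq> A" using br_mono[OF Mc subset_refl, of A] idl_br[OF A_idl] by blast
  from act_kernel[OF Mc A_sub minid_ne[OF A_min] k this]
  have ex: "\<exists>a\<in>A. a \<noteq> \<zero> \<and> (\<forall>n\<in>M. n \<otimes> a = \<zero>)" .
  have CA: "c \<otimes> a \<in> A" if "c \<in> C" "a \<in> A" for c a
    using idl_bracket[OF A_idl _ that(2)] that(1) C_subset by blast
  have "m = \<zero>" if m: "m \<in> M" for m
  proof (rule faithful)
    show "m \<in> C" using m MC by blast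
    show "m \<otimes> a = \<zero>" if "a \<in> A" for a
      by (rule irreducible_annihilated[OF A_sub Mc C_subset idl_bracket[OF M] CA
            C_invariant_cases ex m that])
  qed
  then show ?thesis using sub_zero[OF idl_sub[OF M]] by blast
qed

lemma br_G_le:
  assumes "sub W" "br C C \<subseteq> W"
  shows "br G G \<subseteq> W \<boxplus> A"
proof -
  have sW: "sub (W \<boxplus> A)" using sub_plus[OF assms(1) A_sub] .
  have AW: "A \<subseteq> W \<boxplus> A" and WW: "W \<subseteq> W \<boxplus> A"
    using plus_right[OF assms(1) A_sub] plus_left[OF assms(1) A_sub] by auto
  have AV: "br A V \<subseteq> W \<boxplus> A" if "V \<subseteq> G" for V
    using br_mono[OF subset_refl that, of A] idl_br'[OF A_idl sub_whole] AW by blast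
  have CA: "br C A \<subseteq> W \<boxplus> A"
    using br_mono[OF C_subset subset_refl, of A] idl_br[OF A_idl] AW by blast
  have "br (A \<boxplus> C) (A \<boxplus> C) \<subseteq> W \<boxplus> A"
    using assms(1) A_sub C_sub AV[OF A_subset] AV[OF C_subset] CA subset_trans[OF assms(2) WW]
    by (intro br_plus_left br_plus_right sub_plus)
  then show ?thesis unfolding AC .
qed

lemma A_nilp: "nilp A"
  unfolding nilp_def using A_abelian by (intro exI[of _ 1]) (simp add: bpow_Suc)

lemma abelian_N2: "br G G \<subseteq> A \<Longrightarrow> N2 G"
  unfolding N2_def using A_idl A_nilp by (intro exI[of _ A] conjI exI[of _ 1]) (simp_all add: bpow_Suc)

end

section \<open>Splittings of type I\<close>

locale type_I_splitting = split_lie_algebra F L A C for F and L (structure) and A C +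
  fixes M x
  assumes M_min: "minid C M" and M_abelian: "br M M \<subseteq> {\<zero>}" and x: "x \<in> C" and Mx: "C = M \<boxplus> line x"
    and A_dim: "2 \<le> sdim A" and x_nonzero: "x \<noteq> \<zero>" and Mx_disj: "M \<inter> line x = {\<zero>}"
begin

lemmas M_idl = minid_idl[OF M_min]
lemmas M_sub = idl_sub[OF M_idl]
lemmas M_C = idl_subset[OF M_idl]

lemma x_carrier: "x \<in> G"
  using x C_subset by blast

lemma M_subset: "M \<subseteq> G"
  using M_C C_subset by blast

lemma M_bracket: "u \<in> M \<Longrightarrow> v \<in> M \<Longrightarrow> u \<otimes> v = \<zero>"
  using br_in[OF M_subset M_subset] M_abelian by blast

lemma br_CM_cases: "br C M = {\<zero>} \<or> br C M = M"
  using minid_cases[OF M_min br_idl[OF idl_self[OF C_alg] M_idl C_sub] idl_br[OF M_idl]] .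

text \<open>Apart from multiples of [x,x] = 0, every bracket in C = M + Fx involves an element of
  \<open>M\<close>.\<close>

lemma br_CC_le:
  assumes "sub W" "br C M \<subseteq> W"
  shows "br C C \<subseteq> W"
proof -
  note sl = sub_line[OF x_carrier]
  have "br C (line x) \<subseteq> W" unfolding Mx
  proof (rule br_plus_left[OF assms(1) M_sub sl sl])
    have "line x \<subseteq> C" using line_least[OF C_sub x] .
    then show "br M (line x) \<subseteq> W"
      using br_commute[OF M_subset sub_subset[OF sl]] br_mono[of "line x" C M M] assms(2) by blast
    show "br (line x) (line x) \<subseteq> W" using br_line_line[OF x_carrier assms(1)] .
  qed
  then have "br C (M \<boxplus> line x) \<subseteq> W" by (rule br_plus_right[OF assms(1) M_sub sl C_sub assms(2)])
  then show ?thesis unfolding Mx[symmetric] .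
qed

lemma central_abelian:
  assumes "br C M = {\<zero>}"
  shows "br G G \<subseteq> A"
proof -
  have "br C C \<subseteq> {\<zero>}" using br_CC_le[OF sub_trivial] assms by blast
  from br_G_le[OF sub_trivial this] show ?thesis
    using plus_eq_right[OF sub_trivial A_sub] sub_zero[OF A_sub] by blast
qed

lemma M_le_bpow:
  assumes "br C M = M"
  shows "M \<subseteq> bpow C n C"
proof (induction n)
  case (Suc n)
  then show ?case using br_mono[OF subset_refl Suc, of C] assms unfolding bpow_Suc by blast
qed (simp add: M_C)

text \<open>By minimality [C,M] is 0 or \<open>M\<close>. In the second case \<open>M\<close> would
  persist in every lower central term of \<open>C\<close>, but one of these lies in a nilpotent
  ideal, hence in \<open>A\<close>, and so is 0.\<close>

lemma N2_abelian:
  assumes "N2 G"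
  shows "br G G \<subseteq> A"
proof -
  obtain N n where N: "idl G N" "nilp N" "bpow G n G \<subseteq> N" using assms N2_def by blast
  have "bpow C n C \<subseteq> A" using N(3) nilp_ideal_le[OF N(1,2)] bpow_mono[OF C_subset C_subset, of n] by blast
  moreover have "bpow C n C \<subseteq> C" using bpow_invariant[OF C_sub alg_br[OF C_alg] subset_refl] .
  ultimately have "bpow C n C \<subseteq> {\<zero>}" using AC_disj by blast
  then have "br C M \<noteq> M" using M_le_bpow[of n] sub_le_trivial[OF M_sub] minid_ne[OF M_min] by blast
  then show ?thesis using br_CM_cases central_abelian by blast
qed

text \<open>Modulo \<open>A\<close> the question concerns \<open>D = S \<inter> C\<close>, a proper
  subalgebra of \<open>C\<close>. Either \<open>D\<close> lies in the abelian \<open>M\<close>, or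
  it contains some \<open>d\<close> outside \<open>M\<close> and C = M + Fd. Then minimality of
  \<open>M\<close> leaves two cases: \<open>D\<close> meets \<open>M\<close> in 0 and is a line, or
  \<open>D\<close> contains \<open>M\<close> and would be all of \<open>C\<close>.\<close>

lemma over_A_abelian:
  assumes S: "alg S" "A \<subseteq> S" "S \<noteq> G"
  shows "br S S \<subseteq> A"
proof -
  note sS = alg_sub[OF S(1)] and Sc = alg_subset[OF S(1)]
  define D where "D = S \<inter> C"
  have sD: "sub D" unfolding D_def using sub_Int[OF sS C_sub] .
  have Dc: "D \<subseteq> G" using sub_subset[OF sD] .
  have algD: "alg D" unfolding D_def
    using sub_Int[OF sS C_sub] alg_bracket[OF S(1)] alg_bracket[OF C_alg] by (intro algI) auto
  have SAD: "S \<subseteq> A \<boxplus> D"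
  proof
    fix s assume s: "s \<in> S"
    then obtain a c where ac: "a \<in> A" "c \<in> C" "s = a \<oplus> c" using decompose Sc by blast
    have "c \<in> S" using sub_diff_iff(2)[OF sS, of c a] ac s S(2) C_subset by blast
    then show "s \<in> A \<boxplus> D" using set_addI ac unfolding D_def by blast
  qed
  have DC: "D \<noteq> C"
  proof
    assume "D = C"
    then have "C \<subseteq> S" unfolding D_def by blast
    then have "G \<subseteq> S" using plus_least[OF sS S(2)] AC by blast
    then show False using S(3) Sc by blast
  qed
  have DD: "br D D \<subseteq> {\<zero>}"
  proof (cases "D \<subseteq> M")
    case True
    then show ?thesis using br_mono[OF True True] M_abelian by blast
  next
    case False
    then obtain d where d: "d \<in> D" "d \<notin> M" by blast
    have dc: "d \<in> G" using d Dc by blast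
    have dC: "d \<in> C" using d unfolding D_def by blast
    note sld = sub_line[OF dc]
    have "d \<in> M \<boxplus> line x" using dC Mx by simp
    then obtain m u where mu: "m \<in> M" "u \<in> line x" "d = m \<oplus> u" unfolding set_add_iff by blast
    then obtain f where f: "f \<in> carrier F" "u = f \<odot> x" unfolding line_def by blast
    have mc: "m \<in> G" using mu M_subset by blast
    have uc: "u \<in> G" using f x_carrier by simp
    have fne: "f \<noteq> \<zero>\<^bsub>F\<^esub>"
    proof
      assume "f = \<zero>\<^bsub>F\<^esub>"
      then have "d = m" using mu f x_carrier mc by simp
      then show False using d mu by simp
    qed
    have sMd: "sub (M \<boxplus> line d)" using sub_plus[OF M_sub sld] .
    \<comment> \<open>Since \<open>f\<close> is not 0, \<open>x\<close> can be expressed through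
      \<open>m\<close> and \<open>d\<close>, so \<open>d\<close> may replace \<open>x\<close> as the
      generator of \<open>C\<close> over \<open>M\<close>.\<close>
    have "u = \<ominus> m \<oplus> d" using mu mc uc by (simp add: M.r_neg1)
    moreover have "\<ominus> m \<oplus> d \<in> M \<boxplus> line d" using set_addI[OF sub_neg[OF M_sub mu(1)] line_self[OF dc]] .
    ultimately have "x \<in> M \<boxplus> line d" using smult_cancel[OF sMd x_carrier f(1) fne] f(2) by simp
    then have Cd: "C \<subseteq> M \<boxplus> line d"
      using plus_least[OF sMd plus_left[OF M_sub sld] line_least[OF sMd]] Mx by blast
    \<comment> \<open>\<open>M\<close> is abelian and kills the intersection, and multiples of
      \<open>d\<close> preserve both \<open>D\<close> and \<open>M\<close>; together these make up
      \<open>C\<close>.\<close>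
    have "idl C (D \<inter> M)"
    proof (rule idlI)
      show sDM: "sub (D \<inter> M)" using sub_Int[OF sD M_sub] .
      show "D \<inter> M \<subseteq> C" using M_C by blast
      fix c y assume c: "c \<in> C" and y: "y \<in> D \<inter> M"
      have "c \<in> M \<boxplus> line d" using c Cd by blast
      then obtain m' v where mv: "m' \<in> M" "v \<in> line d" "c = m' \<oplus> v" unfolding set_add_iff by blast
      have vD: "v \<in> D" using mv line_least[OF sD d(1)] by blast
      have cl: "m' \<in> G" "v \<in> G" "y \<in> G" using mv vD y M_subset Dc by auto
      have "c \<otimes> y = v \<otimes> y"
        using mv(3) bracket_add_left[OF cl] M_bracket[OF mv(1)] y cl bracket_closed by simp
      moreover have "v \<otimes> y \<in> D" using alg_bracket[OF algD vD] y by blast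
      moreover have "v \<otimes> y \<in> M" using idl_bracket[OF M_idl] vD y unfolding D_def by blast
      ultimately show "c \<otimes> y \<in> D \<inter> M" by simp
    qed
    then consider "D \<inter> M = {\<zero>}" | "D \<inter> M = M" using minid_cases[OF M_min] by blast
    then show ?thesis
    proof cases
      case 1
      have "D \<subseteq> line d"
      proof
        fix e assume e: "e \<in> D"
        then have "e \<in> M \<boxplus> line d" using Cd unfolding D_def by blast
        then obtain m' v where mv: "m' \<in> M" "v \<in> line d" "e = m' \<oplus> v" unfolding set_add_iff by blast
        have vD: "v \<in> D" using mv line_least[OF sD d(1)] by blast
        have m'c: "m' \<in> G" and vc: "v \<in> G" using mv(1) M_subset vD Dc by auto
        have "m' \<in> D" using sub_diff_iff(1)[OF sD m'c vD] e mv(3) by simp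
        then have "m' = \<zero>" using 1 mv(1) by blast
        then show "e \<in> line d" using mv vc by simp
      qed
      then have "br D D \<subseteq> br (line d) (line d)" by (intro br_mono)
      then show ?thesis using br_line_line[OF dc sub_trivial] by blast
    next
      case 2
      then have "M \<boxplus> line d \<subseteq> D" using plus_least[OF sD _ line_least[OF sD d(1)]] by blast
      then have "C \<subseteq> D" using Cd by blast
      then show ?thesis using DC unfolding D_def by blast
    qed
  qed
  have AV: "br A V \<subseteq> A" if "V \<subseteq> G" for V
    using br_mono[OF subset_refl that, of A] idl_br'[OF A_idl sub_whole] by blast
  have DA: "br D A \<subseteq> A" using br_mono[OF Dc subset_refl, of A] idl_br[OF A_idl] by blast
  have DDA: "br D D \<subseteq> A" using DD sub_zero[OF A_sub] by blast
  have "br (A \<boxplus> D) (A \<boxplus> D) \<subseteq> A"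
    using A_sub sD AV[OF A_subset] AV[OF Dc] DA DDA
    by (intro br_plus_left br_plus_right sub_plus)
  then show ?thesis using br_mono[OF SAD SAD] by blast
qed

text \<open>As \<open>G\<close> is not in \<open>N2\<close>, [C,M] = M, so [C,C] lies in every lower
  central term of \<open>C\<close>. Modulo \<open>A\<close> the brackets of \<open>C\<close>,
  \<open>S\<close> and \<open>G\<close> agree, hence [S,S] lies in each lower central term of
  \<open>S\<close> up to \<open>A\<close>, which meets \<open>S\<close> in 0. \<open>N\<close> is a
  mere set above such a term, so that the image of an ideal of a subalgebra of \<open>L\<close> can
  be inserted.\<close>

lemma complement_derived:
  assumes nN2: "\<not> N2 G" and S: "alg S" "S \<noteq> G" and SA: "A \<boxplus> S = G" and N: "bpow S n S \<subseteq> N"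
  shows "br S S \<subseteq> N"
proof
  note sS = alg_sub[OF S(1)] and Sc = alg_subset[OF S(1)]
  have "br C M = M" using nN2 br_CM_cases central_abelian abelian_N2 by blast
  then have MC: "M \<subseteq> bpow C n C" by (rule M_le_bpow)
  have "br C C \<subseteq> M" using br_CC_le[OF M_sub idl_br[OF M_idl]] .
  then have "br C C \<subseteq> bpow G n G" using MC bpow_mono[OF C_subset C_subset, of n] by blast
  then have GG: "br G G \<subseteq> bpow G n G \<boxplus> A" using br_G_le[OF bpow_sub[OF subset_refl sub_whole]] by blast
  have sSn: "sub (bpow S n S)" using bpow_sub[OF Sc sS] .
  have "bpow G n G \<subseteq> bpow S n S \<boxplus> A" using bpow_mod[OF A_idl sS, of n] unfolding SA .
  then have GGS: "br G G \<subseteq> bpow S n S \<boxplus> A"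
    using GG plus_least[OF sub_plus[OF sSn A_sub] _ plus_right[OF sSn A_sub], of "bpow G n G"] by blast
  have disj: "A \<inter> S = {\<zero>}"
  proof -
    have "idl G (A \<inter> S)"
      using idl_Int_complement[OF A_idl S(1) SA] A_bracket sub_zero[OF sS] by simp
    moreover have "A \<inter> S \<noteq> A"
    proof
      assume "A \<inter> S = A"
      then have "G \<subseteq> S" using plus_least[OF sS _ subset_refl, of A] SA by blast
      then show False using S(2) Sc by blast
    qed
    ultimately show ?thesis using minid_cases[OF A_min] by blast
  qed
  fix s assume s: "s \<in> br S S"
  then have "s \<in> bpow S n S \<boxplus> A" using br_mono[OF Sc Sc] GGS by blast
  then obtain t a where ta: "t \<in> bpow S n S" "a \<in> A" "s = t \<oplus> a" unfolding set_add_iff by blast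
  have tS: "t \<in> S" using ta(1) bpow_invariant[OF sS alg_br[OF S(1)] subset_refl] by blast
  have sS': "s \<in> S" using s alg_br[OF S(1)] by blast
  have cl: "t \<in> G" "a \<in> G" using tS Sc ta(2) A_subset by auto
  have "a \<in> S" using sub_diff_iff(2)[OF sS cl(2) tS] sS' ta(3) by simp
  then have "a = \<zero>" using disj ta(2) by blast
  then show "s \<in> N" using ta cl N by auto
qed

end

context split_lie_algebra
begin

lemma C_bpow_le:
  assumes "bpow C n C \<subseteq> N" "sub N"
  shows "bpow G n G \<subseteq> N \<boxplus> A"
proof -
  have s: "sub (bpow C n C)" using bpow_sub[OF C_subset C_sub] .
  have "bpow G n G \<subseteq> bpow C n C \<boxplus> A" using bpow_mod[OF A_idl C_sub, of n] unfolding AC .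
  then show ?thesis using plus_mono[OF assms(1) subset_refl, of A] by blast
qed

end

section \<open>Uniqueness of the minimal ideal, and the Fitting one-component\<close>

context fd_lie_algebra
begin

text \<open>The first claim is \<open>chief_factor_abelian\<close> with
  \<open>K = {\<zero>}\<close>. It makes \<open>A \<inter> M\<close> an ideal, which is properly
  contained in \<open>A\<close> and so is 0.\<close>

lemma minid_complement:
  assumes S: "solv G" and A: "minid G A" and M: "maximal_subalgebra F M L" and AM: "\<not> A \<subseteq> M"
  shows "br A A \<subseteq> {\<zero>}" "A \<boxplus> M = G" "A \<inter> M = {\<zero>}"
proof -
  note Ai = minid_idl[OF A] and Ma = maximal_alg[OF M]
  note sA = idl_sub[OF Ai] and sM = alg_sub[OF Ma]
  have Ac: "A \<subseteq> G" and Mc: "M \<subseteq> G" using sub_subset sA sM by auto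
  have "{\<zero>} \<subseteq> A" using sub_zero[OF sA] by simp
  moreover have "A' = A" if "idl G A'" "{\<zero>} \<subseteq> A'" "A' \<noteq> {\<zero>}" "A' \<subseteq> A" for A'
    using minid_cases[OF A that(1,4)] that(3) by blast
  ultimately show AA: "br A A \<subseteq> {\<zero>}"
    using chief_factor_abelian[OF S idl_trivial[OF sub_whole] Ai _ minid_ne[OF A]] by blast
  show AMG: "A \<boxplus> M = G"
    using maximal_max[OF M idl_plus_alg[OF Ai Ma Mc alg_whole]] plus_left[OF sA sM]
      plus_right[OF sA sM] AM by blast
  have "a \<otimes> b \<in> M" if "a \<in> A" "b \<in> A" for a b
    using br_in[OF Ac Ac that] AA sub_zero[OF sM] by auto
  from idl_Int_complement[OF Ai Ma AMG this] have "idl G (A \<inter> M)" .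
  then show "A \<inter> M = {\<zero>}" using minid_cases[OF A, of "A \<inter> M"] AM by blast
qed

text \<open>Because the Frattini subalgebra is 0, some maximal subalgebra \<open>C\<close> misses
  part of \<open>A\<close> and is a complement. G/A is then a copy of \<open>C\<close>, and a
  nilpotent ideal \<open>N\<close> witnessing \<open>N2 C\<close> lifts to A + N.\<close>

lemma minid_N2_mod:
  assumes S: "solv G" and A: "minid G A" and \<Phi>: "\<Phi> = {\<zero>}"
    and sub_N2: "\<And>S. alg S \<Longrightarrow> S \<noteq> G \<Longrightarrow> N2 S"
  shows "\<exists>N k n. idl G N \<and> bpow N k N \<subseteq> A \<and> bpow G n G \<subseteq> N"
proof -
  note Ai = minid_idl[OF A]
  note sA = idl_sub[OF Ai]
  have Ac: "A \<subseteq> G" using sub_subset[OF sA] .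
  obtain a where a: "a \<in> A" "a \<noteq> \<zero>" using sub_ne_trivial[OF sA minid_ne[OF A]] by blast
  then have "a \<notin> \<Phi>" using \<Phi> by simp
  then obtain C where C: "maximal_subalgebra F C L" "a \<notin> C" using a Ac unfolding frattini_def by blast
  have "\<not> A \<subseteq> C" using C a by blast
  note c = minid_complement[OF S A C(1) this]
  note Ca = maximal_alg[OF C(1)]
  note sC = alg_sub[OF Ca]
  have Cc: "C \<subseteq> G" using sub_subset[OF sC] .
  obtain N k n where N: "idl C N" "bpow N k N \<subseteq> {\<zero>}" "bpow C n C \<subseteq> N"
    using sub_N2[OF Ca maximal_ne[OF C(1)]] unfolding N2_def nilp_def by blast
  note sN = idl_sub[OF N(1)] and NC = idl_subset[OF N(1)]
  have sAN: "sub (A \<boxplus> N)" using sub_plus[OF sA sN] .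
  have "idl G (A \<boxplus> N)"
  proof (rule idlI[OF sAN sub_subset[OF sAN]])
    fix g y assume "g \<in> G" and "y \<in> A \<boxplus> N"
    then have "g \<in> A \<boxplus> C" "y \<in> A \<boxplus> N" using c(2) by auto
    then obtain a c b m where *: "a \<in> A" "c \<in> C" "g = a \<oplus> c" "b \<in> A" "m \<in> N" "y = b \<oplus> m"
      unfolding set_add_iff by blast
    have cl: "a \<in> G" "c \<in> G" "b \<in> G" "m \<in> G" using * Ac Cc NC by auto
    have "g \<otimes> y = (a \<otimes> y \<oplus> c \<otimes> b) \<oplus> c \<otimes> m"
      using * cl by (simp add: bracket_add_left bracket_add_right bracket_closed M.a_ac)
    moreover have "a \<otimes> y \<oplus> c \<otimes> b \<in> A"
      using sub_add[OF sA idlD2[OF Ai sub_whole _ *(1)] idl_bracket[OF Ai cl(2) *(4)]] cl * by simp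
    moreover have "c \<otimes> m \<in> N" using idl_bracket[OF N(1) *(2,5)] .
    ultimately show "g \<otimes> y \<in> A \<boxplus> N" using set_addI by simp
  qed
  moreover have "bpow (A \<boxplus> N) k (A \<boxplus> N) \<subseteq> A"
    using bpow_mod[OF Ai sN, of k] plus_least[OF sA _ subset_refl, of "bpow N k N"] N(2) sub_zero[OF sA]
    by blast
  moreover have "bpow G n G \<subseteq> A \<boxplus> N"
  proof -
    have "bpow G n G \<subseteq> bpow C n C \<boxplus> A" using bpow_mod[OF Ai sC, of n] unfolding c(2) .
    then show ?thesis using plus_mono[OF N(3) subset_refl, of A] plus_commute[OF sN sA] by blast
  qed
  ultimately show ?thesis by blast
qed

text \<open>Distinct minimal ideals meet in 0. The ideals obtained modulo each of them intersect in
  an ideal whose lower central series ends in both, so it is nilpotent and witnesses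
  \<open>N2 G\<close>.\<close>

lemma minid_unique:
  assumes S: "solv G" and A: "minid G A" "minid G A'" and \<Phi>: "\<Phi> = {\<zero>}"
    and sub_N2: "\<And>S. alg S \<Longrightarrow> S \<noteq> G \<Longrightarrow> N2 S" and nN2: "\<not> N2 G"
  shows "A' = A"
proof (rule ccontr)
  assume ne: "A' \<noteq> A"
  note i = minid_idl[OF A(1)] minid_idl[OF A(2)]
  have "A \<inter> A' = {\<zero>}"
  proof (rule ccontr)
    assume "A \<inter> A' \<noteq> {\<zero>}"
    then have "A \<inter> A' = A" "A \<inter> A' = A'"
      using minid_cases[OF A(1) idl_Int[OF i]] minid_cases[OF A(2) idl_Int[OF i]] by blast+
    then show False using ne by blast
  qed
  obtain N k n where N: "idl G N" "bpow N k N \<subseteq> A" "bpow G n G \<subseteq> N"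
    using minid_N2_mod[OF S A(1) \<Phi> sub_N2] by blast
  obtain N' k' n' where N': "idl G N'" "bpow N' k' N' \<subseteq> A'" "bpow G n' G \<subseteq> N'"
    using minid_N2_mod[OF S A(2) \<Phi> sub_N2] by blast
  let ?I = "N \<inter> N'"
  have I: "idl G ?I" using idl_Int[OF N(1) N'(1)] .
  note sI = idl_sub[OF I] and brI = alg_br[OF idl_alg[OF I]]
  have "bpow ?I (max k k') ?I \<subseteq> bpow ?I k ?I" "bpow ?I (max k k') ?I \<subseteq> bpow ?I k' ?I"
    using bpow_decr[OF sI brI] by simp_all
  moreover have "bpow ?I k ?I \<subseteq> bpow N k N" "bpow ?I k' ?I \<subseteq> bpow N' k' N'"
    by (intro bpow_mono; blast)+
  ultimately have "bpow ?I (max k k') ?I \<subseteq> A \<inter> A'" using N(2) N'(2) by blast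
  then have nil: "nilp ?I" unfolding nilp_def using \<open>A \<inter> A' = {\<zero>}\<close> by blast
  have "bpow G (max n n') G \<subseteq> bpow G n G" "bpow G (max n n') G \<subseteq> bpow G n' G"
    using bpow_decr[OF sub_whole alg_br[OF alg_whole]] by simp_all
  then have "bpow G (max n n') G \<subseteq> ?I" using N(3) N'(3) by blast
  then show False using nN2 I nil unfolding N2_def by blast
qed

text \<open>The images of the powers of \<open>ad x\<close> on \<open>V\<close> become constant; the
  limit is the Fitting one-component, which \<open>ad x\<close> maps onto itself.\<close>

lemma surj_stable:
  assumes x: "x \<in> G" and V: "sub V" and xV: "\<And>v. v \<in> V \<Longrightarrow> x \<otimes> v \<in> V"
  shows "\<exists>N. ad x 1 ` (ad x N ` V) = ad x N ` V"
proof -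
  have s: "sub (ad x n ` V)" for n
    unfolding bpow_line[OF x V, symmetric] using bpow_sub[OF sub_subset[OF sub_line[OF x]] V] .
  have inv: "ad x n v \<in> V" if "v \<in> V" for n v
    using that by (induction n) (simp_all add: ad_Suc xV)
  have dec: "ad x n ` V \<subseteq> ad x m ` V" if "m \<le> n" for m n
  proof
    fix y assume "y \<in> ad x n ` V"
    then obtain v where "v \<in> V" "y = ad x n v" by blast
    then have "y = ad x m (ad x (n - m) v)" "ad x (n - m) v \<in> V"
      using that inv by (auto simp: ad_ad)
    then show "y \<in> ad x m ` V" by blast
  qed
  obtain N where "\<forall>n\<ge>N. ad x n ` V = ad x N ` V"
    using decr_stable[of "\<lambda>n. ad x n ` V", OF s dec] by blast
  from spec[OF this, of "Suc N"] have "ad x (Suc N) ` V = ad x N ` V" by simp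
  moreover have "ad x 1 ` (ad x N ` V) = ad x (Suc N) ` V" by (simp add: image_image ad_Suc)
  ultimately show ?thesis by metis
qed

text \<open>Let the kernels of the powers become constant at \<open>J\<close>. Surjectivity writes
  \<open>d\<close> as \<open>ad x J e\<close>; then \<open>e\<close> is killed by
  \<open>ad x (Suc J)\<close>, hence by \<open>ad x J\<close>.\<close>

lemma surj_inj:
  assumes x: "x \<in> G" and V: "sub V" and surj: "ad x 1 ` V = V" and d: "d \<in> V" "x \<otimes> d = \<zero>"
  shows "d = \<zero>"
proof -
  have Vc: "v \<in> G" if "v \<in> V" for v using that sub_carrier[OF V] by blast
  have s: "sub ({v \<in> G. ad x n v = \<zero>} \<inter> V)" for n using sub_Int[OF sub_ad_kernel[OF x] V] .
  have inc: "{v \<in> G. ad x m v = \<zero>} \<inter> V \<subseteq> {v \<in> G. ad x n v = \<zero>} \<inter> V" if "m \<le> n" for m n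
  proof
    fix v assume v: "v \<in> {v \<in> G. ad x m v = \<zero>} \<inter> V"
    then show "v \<in> {v \<in> G. ad x n v = \<zero>} \<inter> V"
      using that ad_ad[of x "n - m" m v] ad_zero[OF x] by simp
  qed
  obtain J where "\<forall>n\<ge>J. {v \<in> G. ad x n v = \<zero>} \<inter> V = {v \<in> G. ad x J v = \<zero>} \<inter> V"
    using incr_stable[of "\<lambda>n. {v \<in> G. ad x n v = \<zero>} \<inter> V", OF s inc] by blast
  from spec[OF this, of "Suc J"]
  have J: "{v \<in> G. ad x (Suc J) v = \<zero>} \<inter> V = {v \<in> G. ad x J v = \<zero>} \<inter> V" by simp
  have surjn: "V \<subseteq> ad x n ` V" for n
  proof (induction n)
    case (Suc n)
    show ?case
    proof
      fix v assume "v \<in> V"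
      then have "v \<in> ad x 1 ` V" using surj by simp
      then obtain u where u: "u \<in> V" "v = x \<otimes> u" by (auto simp: ad_Suc)
      then obtain w where "w \<in> V" "u = ad x n w" using Suc by blast
      then show "v \<in> ad x (Suc n) ` V" using u by (auto simp: ad_Suc)
    qed
  qed simp
  obtain e where e: "e \<in> V" "d = ad x J e" using surjn[of J] d(1) by blast
  have "ad x (Suc J) e = \<zero>" using e d(2) by (simp add: ad_Suc)
  then have "e \<in> {v \<in> G. ad x J v = \<zero>} \<inter> V" using J e(1) Vc by blast
  then show ?thesis using e by blast
qed

theorem minimal_non_N2_structure:
  assumes der3: "der G 3 \<subseteq> {\<zero>}" and \<Phi>: "\<Phi> = {\<zero>}" and nN2: "\<not> N2 G"
    and sub_N2: "\<And>S. alg S \<Longrightarrow> S \<noteq> G \<Longrightarrow> N2 S"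
  shows "(\<exists>n. [Suc n] \<cdot>\<^bsub>F\<^esub> \<one>\<^bsub>F\<^esub> = \<zero>\<^bsub>F\<^esub>) \<and> (\<exists>A C M x. type_I_splitting F L A C M x)"
proof -
  have S: "solv G" unfolding solv_def using der3 by blast
  have "G \<noteq> {\<zero>}"
  proof
    assume "G = {\<zero>}"
    then have "N2 G" unfolding N2_def nilp_def using idl_self[OF alg_whole]
      by (metis bpow_0 subset_refl)
    then show False using nN2 by simp
  qed
  then obtain A where A: "minid G A" using ex_minid[OF idl_self[OF alg_whole]] by blast
  have uniq: "A' = A" if "minid G A'" for A' using minid_unique[OF S A that \<Phi> sub_N2 nN2] .
  note Ai = minid_idl[OF A]
  note sA = idl_sub[OF Ai]
  obtain a0 where a0: "a0 \<in> A" "a0 \<noteq> \<zero>" using sub_ne_trivial[OF sA minid_ne[OF A]] by blast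
  have a0c: "a0 \<in> G" using a0 sub_carrier[OF sA] by blast
  from a0 have "a0 \<notin> \<Phi>" using \<Phi> by simp
  then obtain C where C: "maximal_subalgebra F C L" "a0 \<notin> C" using a0c unfolding frattini_def by blast
  have nAC: "\<not> A \<subseteq> C" using C a0 by blast
  note compl = minid_complement[OF S A C(1) nAC]
  interpret split_lie_algebra F L A C
  proof unfold_locales
    show "minid G A" by (rule A)
    show "A' = A" if "minid G A'" for A' using uniq[OF that] .
    show "br A A \<subseteq> {\<zero>}" "A \<boxplus> C = G" "A \<inter> C = {\<zero>}" by (rule compl)+
    show "alg C" by (rule maximal_alg[OF C(1)])
  qed
  let ?C' = "br C C"
  have C'i: "idl C ?C'" using br_idl[OF idl_self[OF C_alg] idl_self[OF C_alg] C_sub] .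
  have C'C: "?C' \<subseteq> C" using idl_subset[OF C'i] .
  have sC': "sub ?C'" using idl_sub[OF C'i] .
  have C'c: "?C' \<subseteq> G" using C'C C_subset by blast
  \<comment> \<open>The second derived algebra of \<open>G\<close> is 0 or contains
    \<open>A\<close>. In the latter case it centralises \<open>A\<close>, because its own derived
    algebra vanishes by \<open>der3\<close>, and faithfulness applies to the element
    \<open>u \<otimes> v\<close> of \<open>C\<close>.\<close>
  have C'_abelian: "u \<otimes> v = \<zero>" if uv: "u \<in> ?C'" "v \<in> ?C'" for u v
  proof -
    have D: "idl G (der G 2)" using der_idl[OF alg_whole] .
    have d2: "der H 2 = br (br H H) (br H H)" for H by (simp add: numeral_2_eq_2)
    have "u \<otimes> v \<in> br ?C' ?C'" using br_in[OF C'c C'c uv] .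
    moreover have "br ?C' ?C' \<subseteq> der G 2" using der_mono[OF C_subset, of 2] d2 by simp
    ultimately have uvD: "u \<otimes> v \<in> der G 2" by blast
    show ?thesis
    proof (cases "der G 2 = {\<zero>}")
      case True
      then show ?thesis using uvD by blast
    next
      case False
      then have AD: "A \<subseteq> der G 2" using ex_minid[OF D] uniq by blast
      have "(u \<otimes> v) \<otimes> a = \<zero>" if "a \<in> A" for a
      proof -
        have Dc: "der G 2 \<subseteq> G" using idl_subset[OF D] .
        have "(u \<otimes> v) \<otimes> a \<in> br (der G 2) (der G 2)" using br_in[OF Dc Dc uvD] AD that by blast
        then show ?thesis using der3 by (auto simp: numeral_3_eq_3 numeral_2_eq_2)
      qed
      moreover have "u \<otimes> v \<in> C" using alg_bracket[OF C_alg] uv C'C by blast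
      ultimately show ?thesis using faithful by blast
    qed
  qed
  \<comment> \<open>Otherwise Engel's theorem makes \<open>C\<close> nilpotent, and then
    \<open>A\<close> itself witnesses \<open>N2 G\<close>.\<close>
  have "\<exists>x\<in>C. \<forall>n. \<not> ad x n ` C \<subseteq> {\<zero>}"
  proof (rule ccontr)
    assume "\<not> ?thesis"
    then have nil: "\<And>x. x \<in> C \<Longrightarrow> \<exists>n. ad x n ` C \<subseteq> {\<zero>}" by blast
    obtain r where r: "der C r \<subseteq> {\<zero>}" using solv_mono[OF S C_subset] unfolding solv_def by blast
    obtain n where "bpow C n C \<subseteq> {\<zero>}" using engel[OF C_sub C_alg alg_br[OF C_alg] nil r] by blast
    then have "bpow G n G \<subseteq> {\<zero>} \<boxplus> A" using C_bpow_le[OF _ sub_trivial] by blast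
    moreover have "{\<zero>} \<boxplus> A = A" using plus_eq_right[OF sub_trivial A_sub] sub_zero[OF A_sub] by blast
    ultimately show False using nN2 A_idl A_nilp unfolding N2_def by blast
  qed
  then obtain x where x: "x \<in> C" and xn: "\<And>n. \<not> ad x n ` C \<subseteq> {\<zero>}" by blast
  have xc: "x \<in> G" using x C_subset by blast
  obtain N where N: "ad x 1 ` (ad x N ` ?C') = ad x N ` ?C'"
    using surj_stable[OF xc sC' idl_bracket[OF C'i x]] by blast
  define D where "D = ad x N ` ?C'"
  have sD: "sub D" unfolding D_def bpow_line[OF xc sC', symmetric]
    using bpow_sub[OF sub_subset[OF sub_line[OF xc]] sC'] .
  have adC': "ad x n v \<in> ?C'" if "v \<in> ?C'" for n v
    using that by (induction n) (simp_all add: ad_Suc idl_bracket[OF C'i x])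
  have DC': "D \<subseteq> ?C'" unfolding D_def using adC' by blast
  \<comment> \<open>The correction term of the derivation rule vanishes, as [c,x] and
    \<open>v\<close> lie in the abelian [C,C]. Hence \<open>ad x\<close> commutes with
    \<open>C\<close> on [C,C], and its images of ideals are ideals.\<close>
  have comm: "c \<otimes> (x \<otimes> v) = x \<otimes> (c \<otimes> v)" if c: "c \<in> C" and v: "v \<in> ?C'" for c v
  proof -
    have cl: "c \<in> G" "v \<in> G" using c v C_subset C'c by auto
    have "c \<otimes> x \<in> ?C'" using br_in[OF C_subset C_subset c x] .
    then have "(c \<otimes> x) \<otimes> v = \<zero>" using C'_abelian v by blast
    then show ?thesis using jacobi_left[OF cl(1) xc cl(2)] cl xc bracket_closed by simp
  qed
  have commn: "c \<otimes> ad x n v = ad x n (c \<otimes> v)" if c: "c \<in> C" and v: "v \<in> ?C'" for c v n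
    by (induction n) (simp_all add: ad_Suc comm[OF c adC'[OF v]])
  have "idl C D"
  proof (rule idlI[OF sD])
    show "D \<subseteq> C" using DC' C'C by blast
    fix c y assume c: "c \<in> C" and "y \<in> D"
    then obtain v where v: "v \<in> ?C'" "y = ad x N v" unfolding D_def by blast
    then have "c \<otimes> y = ad x N (c \<otimes> v)" using commn[OF c v(1)] by simp
    then show "c \<otimes> y \<in> D" unfolding D_def using idl_bracket[OF C'i c v(1)] by blast
  qed
  moreover have "D \<noteq> {\<zero>}"
  proof
    assume D0: "D = {\<zero>}"
    \<comment> \<open>The first bracket with \<open>x\<close> moves \<open>C\<close> into [C,C],
      where \<open>D\<close> is the image of the remaining \<open>N\<close> brackets;
      \<open>D = {\<zero>}\<close> would contradict the choice of \<open>x\<close>.\<close>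
    have "ad x (Suc N) c \<in> D" if c: "c \<in> C" for c
      unfolding D_def ad_Suc2 using br_in[OF C_subset C_subset x c] by blast
    then have "ad x (Suc N) ` C \<subseteq> {\<zero>}" using D0 by blast
    then show False using xn by blast
  qed
  ultimately obtain M where M: "minid C M" "M \<subseteq> D" using ex_minid by blast
  note Mi = minid_idl[OF M(1)]
  note sM = idl_sub[OF Mi] and MC = idl_subset[OF Mi]
  have MC': "M \<subseteq> ?C'" using M DC' by blast
  have Mc: "M \<subseteq> G" using MC C_subset by blast
  have Mab: "u \<otimes> v = \<zero>" if "u \<in> M" "v \<in> M" for u v using C'_abelian that MC' by blast
  have brM: "br M M \<subseteq> {\<zero>}" by (rule br_least[OF sub_trivial]) (simp add: Mab)
  \<comment> \<open>[x,M] is an ideal of \<open>C\<close> inside \<open>M\<close>, and it is not 0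
    because \<open>ad x\<close> is injective on \<open>D\<close>.\<close>
  have xM: "(\<lambda>v. x \<otimes> v) ` M = M"
  proof -
    have sub: "(\<lambda>v. x \<otimes> v) ` M \<subseteq> M" using idl_bracket[OF Mi x] by blast
    have "idl C ((\<lambda>v. x \<otimes> v) ` M)"
    proof (rule idlI)
      show "sub ((\<lambda>v. x \<otimes> v) ` M)" unfolding br_line[OF xc sM, symmetric]
        using br_sub[OF sub_subset[OF sub_line[OF xc]] Mc] .
      show "(\<lambda>v. x \<otimes> v) ` M \<subseteq> C" using sub MC by blast
      fix c y assume c: "c \<in> C" and "y \<in> (\<lambda>v. x \<otimes> v) ` M"
      then obtain m where m: "m \<in> M" "y = x \<otimes> m" by blast
      then have "c \<otimes> y = x \<otimes> (c \<otimes> m)" using comm[OF c] MC' by blast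
      then show "c \<otimes> y \<in> (\<lambda>v. x \<otimes> v) ` M" using idl_bracket[OF Mi c m(1)] by blast
    qed
    moreover have "(\<lambda>v. x \<otimes> v) ` M \<noteq> {\<zero>}"
    proof
      assume z: "(\<lambda>v. x \<otimes> v) ` M = {\<zero>}"
      have "m = \<zero>" if m: "m \<in> M" for m
      proof (rule surj_inj[OF xc sD])
        show "ad x 1 ` D = D" using N unfolding D_def .
        show "m \<in> D" using m M by blast
        show "x \<otimes> m = \<zero>" using z m by blast
      qed
      then show False using minid_ne[OF M(1)] sub_zero[OF sM] by blast
    qed
    ultimately show ?thesis using minid_cases[OF M(1) _ sub] by blast
  qed
  have xM_ex: "\<exists>v\<in>M. m = x \<otimes> v" if "m \<in> M" for m
  proof -
    have "m \<in> (\<lambda>v. x \<otimes> v) ` M" using that by (simp only: xM)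
    then show ?thesis by (rule imageE) blast
  qed
  note sl = sub_line[OF xc]
  have lC: "line x \<subseteq> C" using line_least[OF C_sub x] .
  define K where "K = M \<boxplus> line x"
  have sK: "sub K" unfolding K_def using sub_plus[OF sM sl] .
  have MK: "M \<subseteq> K" and xK: "x \<in> K"
    unfolding K_def using plus_left[OF sM sl] plus_right[OF sM sl] line_self[OF xc] by auto
  have KC: "K \<subseteq> C" unfolding K_def using plus_least[OF C_sub MC lC] .
  have Kc: "K \<subseteq> G" using KC C_subset by blast
  have Ka: "alg K"
  proof (rule algI[OF sK])
    fix u v assume "u \<in> K" "v \<in> K"
    have "br (line x) M \<subseteq> M" by (rule br_line_left[OF xc sM sM]) (rule idl_bracket[OF Mi x])
    then have "br (line x) M \<subseteq> K" using MK by blast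
    moreover have "br M (line x) = br (line x) M" using br_commute[OF Mc sub_subset[OF sl]] .
    moreover have "br M M \<subseteq> K" using brM sub_zero[OF sK] by blast
    ultimately have "br (M \<boxplus> line x) (M \<boxplus> line x) \<subseteq> K"
      using sK sM sl br_line_line[OF xc sK] by (intro br_plus_left br_plus_right sub_plus) simp_all
    then show "u \<otimes> v \<in> K" using br_in[OF Kc Kc \<open>u \<in> K\<close> \<open>v \<in> K\<close>] unfolding K_def by blast
  qed
  have nonnil: "\<not> bpow M k A \<subseteq> {\<zero>}" for k
    using C_ideal_trivial[OF Mi] minid_ne[OF M(1)] by blast
  have "A \<boxplus> K = G"
  proof (rule ccontr)
    assume ne: "A \<boxplus> K \<noteq> G"
    let ?E = "A \<boxplus> K"
    have Ea: "alg ?E" using idl_plus_alg[OF A_idl Ka Kc alg_whole] .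
    have AE: "A \<subseteq> ?E" and KE: "K \<subseteq> ?E" using plus_left[OF A_sub sK] plus_right[OF A_sub sK] by auto
    obtain P k n where P: "idl ?E P" "bpow P k P \<subseteq> {\<zero>}" "bpow ?E n ?E \<subseteq> P"
      using sub_N2[OF Ea ne] unfolding N2_def nilp_def by blast
    have "M \<subseteq> bpow ?E n ?E" for n
    proof (induction n)
      case 0
      show ?case using MK KE by simp
    next
      case (Suc n)
      have Ec: "?E \<subseteq> G" using alg_subset[OF Ea] .
      have xE: "x \<in> ?E" using xK KE by blast
      show ?case
      proof
        fix m assume "m \<in> M"
        then obtain v where v: "v \<in> M" "m = x \<otimes> v" using xM_ex by blast
        have "v \<in> bpow ?E n ?E" using Suc v(1) by blast
        then show "m \<in> bpow ?E (Suc n) ?E"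
          unfolding bpow_Suc v(2) by (rule br_in[OF Ec bpow_subset[OF Ec Ec] xE])
      qed
    qed
    then have MP: "M \<subseteq> P" using P(3) by blast
    have "br M A \<subseteq> P"
      using br_mono[OF MP AE] idl_br'[OF P(1) alg_sub[OF Ea]] by blast
    then have "bpow M k (br M A) \<subseteq> {\<zero>}" using bpow_mono[OF MP, of "br M A" P k] P(2) by blast
    then have "bpow M (k + 1) A \<subseteq> {\<zero>}" unfolding bpow_add by (simp add: bpow_Suc)
    then show False using nonnil by blast
  qed
  have CK: "C = K"
  proof
    show "K \<subseteq> C" by (rule KC)
    show "C \<subseteq> K"
    proof
      fix c assume c: "c \<in> C"
      then have "c \<in> A \<boxplus> K" using \<open>A \<boxplus> K = G\<close> C_subset by blast
      then obtain a k where ak: "a \<in> A" "k \<in> K" "c = a \<oplus> k" unfolding set_add_iff by blast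
      have cl: "a \<in> G" "k \<in> G" using ak A_subset Kc by auto
      have "a \<in> C" using sub_diff_iff(1)[OF C_sub cl(1), of k] ak KC c by blast
      then have "a = \<zero>" using AC_disj ak(1) by blast
      then show "c \<in> K" using ak cl by simp
    qed
  qed
  have disj: "M \<inter> line x = {\<zero>}"
  proof -
    have "u = \<zero>" if u: "u \<in> M" "u \<in> line x" for u
    proof (rule ccontr)
      assume ne: "u \<noteq> \<zero>"
      obtain f where f: "f \<in> carrier F" "u = f \<odot> x" using u(2) unfolding line_def by blast
      have "f \<noteq> \<zero>\<^bsub>F\<^esub>" using ne f xc by auto
      \<comment> \<open>With \<open>x\<close> inside the abelian \<open>M\<close>, M = [x,M] would
        be 0.\<close>
      then have "x \<in> M" using smult_cancel[OF sM xc f(1)] f(2) u(1) by simp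
      then have "M \<subseteq> {\<zero>}" using xM_ex Mab by (metis singletonI subsetI)
      then show False using sub_le_trivial[OF sM] minid_ne[OF M(1)] by blast
    qed
    then show ?thesis using sub_zero[OF sM] sub_zero[OF sl] by blast
  qed
  have x0: "x \<noteq> \<zero>"
  proof
    assume "x = \<zero>"
    then have "x \<otimes> m = \<zero>" if "m \<in> M" for m using that Mc by (metis bracket_zero(2) subsetD)
    then have "M \<subseteq> {\<zero>}" using xM_ex by (metis singletonI subsetI)
    then show False using sub_le_trivial[OF sM] minid_ne[OF M(1)] by blast
  qed
  have dim2: "2 \<le> sdim A"
  proof -
    note sla = sub_line[OF a0c]
    have la: "line a0 \<subseteq> A" using line_least[OF A_sub a0(1)] .
    \<comment> \<open>On a line every element of \<open>C\<close> acts by a scalar, and scalars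
      commute; so m = [x,m'] would act as 0, against faithfulness.\<close>
    have "line a0 \<noteq> A"
    proof
      assume lA: "line a0 = A"
      have CA: "\<exists>f\<in>carrier F. c \<otimes> a0 = f \<odot> a0" if "c \<in> C" for c
      proof -
        have "c \<otimes> a0 \<in> line a0" using idl_bracket[OF A_idl _ a0(1)] that C_subset lA by blast
        then show ?thesis unfolding line_def by blast
      qed
      have "m = \<zero>" if m: "m \<in> M" for m
      proof (rule faithful)
        show "m \<in> C" using m MC by blast
        fix a assume "a \<in> A"
        then obtain g where g: "g \<in> carrier F" "a = g \<odot> a0" using lA unfolding line_def by blast
        obtain m' where m': "m' \<in> M" "m = x \<otimes> m'" using xM_ex[OF m] by blast
        obtain f where f: "f \<in> carrier F" "x \<otimes> a0 = f \<odot> a0" using CA[OF x] by blast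
        obtain h where h: "h \<in> carrier F" "m' \<otimes> a0 = h \<odot> a0" using CA m'(1) MC by blast
        have m'c: "m' \<in> G" using m' Mc by blast
        have "m \<otimes> a0 = x \<otimes> (m' \<otimes> a0) \<ominus> m' \<otimes> (x \<otimes> a0)"
          using m'(2) jacobi_right[OF xc m'c a0c] by simp
        also have "\<dots> = h \<odot> (f \<odot> a0) \<ominus> f \<odot> (h \<odot> a0)"
          using f h xc m'c a0c by (simp add: bracket_smult_right)
        also have "h \<odot> (f \<odot> a0) = f \<odot> (h \<odot> a0)"
          using f(1) h(1) a0c by (simp add: R.m_comm flip: smult_assoc1)
        finally have "m \<otimes> a0 = \<zero>" using f(1) h(1) a0c by (simp add: M.minus_eq M.r_neg)
        then show "m \<otimes> a = \<zero>" using g m Mc a0c bracket_smult_right[of g m a0] by auto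
      qed
      then show False using sub_le_trivial[OF sM] minid_ne[OF M(1)] by blast
    qed
    then have "sdim (line a0) < sdim A" using sub_dim_less[OF sla A_sub] la by blast
    moreover have "{\<zero>} \<subset> line a0" using sub_zero[OF sla] line_self[OF a0c] a0(2) by blast
    then have "sdim {\<zero>} < sdim (line a0)" using sub_dim_less[OF sub_trivial sla] by blast
    ultimately show ?thesis by linarith
  qed
  have "\<exists>n. [Suc n] \<cdot>\<^bsub>F\<^esub> \<one>\<^bsub>F\<^esub> = \<zero>\<^bsub>F\<^esub>"
  proof (rule ccontr)
    assume "\<not> ?thesis"
    then have char0: "\<And>n. [Suc n] \<cdot>\<^bsub>F\<^esub> \<one>\<^bsub>F\<^esub> \<noteq> \<zero>\<^bsub>F\<^esub>" by blast
    have MA: "m \<otimes> a \<in> A" if "m \<in> M" "a \<in> A" for m a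
      using idl_bracket[OF A_idl _ that(2)] that(1) Mc by blast
    have nil: "\<exists>n. ad m n ` A \<subseteq> {\<zero>}" if m: "m \<in> M" for m
    proof -
      obtain m' where m': "m' \<in> M" "x \<otimes> m' = m" using xM_ex[OF m] by blast
      have xm: "x \<otimes> m \<in> M" using idl_bracket[OF Mi x m] .
      have m'c: "m' \<in> G" using m' Mc by blast
      \<comment> \<open>Here \<open>m'\<close>, \<open>m\<close> and [x,m] serve as y, z and w of
        Jacobson's lemma; they commute because all three lie in \<open>M\<close>.\<close>
      show ?thesis
        by (rule jacobson[OF char0 xc m'c m'(2) refl Mab[OF m'(1) m] Mab[OF m xm] A_sub
              idl_bracket[OF A_idl xc] MA[OF m] MA[OF xm]])
    qed
    have "der M 1 \<subseteq> {\<zero>}" using brM by simp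
    moreover have "br M A \<subseteq> A" by (rule br_least[OF A_sub]) (rule MA)
    ultimately obtain k where "bpow M k A \<subseteq> {\<zero>}"
      using engel[OF A_sub idl_alg[OF Mi] _ nil] by blast
    then show False using nonnil by blast
  qed
  moreover have "type_I_splitting F L A C M x"
  proof unfold_locales
    show "minid C M" by (rule M(1))
    show "C = M \<boxplus> line x" using CK unfolding K_def .
  qed (rule brM x dim2 x0 disj)+
  ultimately show ?thesis by blast
qed

end

context lie_algebra
begin

subsection \<open>Restriction to subalgebras and quotients\<close>

lemma restrict_lie:
  assumes S: "alg S"
  shows "lie_algebra F (vs S)"
proof (rule lie_algebra.intro)
  note sS = alg_sub[OF S]
  have SG: "x \<in> S \<Longrightarrow> x \<in> G" for x using sub_carrier[OF sS] .
  show "vectorspace F (vs S)" using subspace_is_vs[OF sS] .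
  show "lie_algebra_axioms F (vs S)"
    by unfold_locales
      (simp_all add: alg_bracket[OF S] bracket_add_left bracket_add_right bracket_smult_left
        bracket_smult_right bracket_self jacobi SG)
qed

lemma restrict_sub:
  assumes S: "alg S"
  shows "subspace F W (vs S) \<longleftrightarrow> sub W \<and> W \<subseteq> S"
proof -
  interpret S: lie_algebra F "vs S" using restrict_lie[OF S] .
  have SG: "S \<subseteq> G" using alg_subset[OF S] .
  show ?thesis
  proof
    assume W: "S.sub W"
    have "sub W"
    proof (rule subI)
      show "W \<subseteq> G" using S.sub_subset[OF W] SG by auto
      show "\<zero> \<in> W" using S.sub_zero[OF W] by simp
      show "\<And>x y. x \<in> W \<Longrightarrow> y \<in> W \<Longrightarrow> x \<oplus> y \<in> W" using S.sub_add[OF W] by simp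
      show "\<And>c x. c \<in> carrier F \<Longrightarrow> x \<in> W \<Longrightarrow> c \<odot> x \<in> W" using S.sub_smult[OF W] by simp
    qed
    then show "sub W \<and> W \<subseteq> S" using S.sub_subset[OF W] by simp
  next
    assume W: "sub W \<and> W \<subseteq> S"
    then have sW: "sub W" by blast
    show "S.sub W"
      by (rule S.subI) (simp_all add: W sub_zero[OF sW] sub_add[OF sW] sub_smult[OF sW])
  qed
qed

text \<open>The span of a subset of \<open>S\<close> is the same in \<open>S\<close> and in
  \<open>L\<close>, so notions built from \<open>br\<close> do not notice the restriction of the
  carrier.\<close>

lemma restrict_br:
  assumes S: "alg S" and X: "X \<subseteq> S" and Y: "Y \<subseteq> S"
  shows "lie_product F (vs S) X Y = br X Y"
proof -
  have "{x \<otimes> y | x y. x \<in> X \<and> y \<in> Y} \<subseteq> S" using X Y alg_bracket[OF S] by blast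
  from span_li_not_depend(1)[OF this is_module[OF alg_sub[OF S]]]
  show ?thesis unfolding lie_product_def by simp
qed

lemma restrict_idl:
  assumes S: "alg S" and T: "T \<subseteq> S"
  shows "lie_algebra.idl F (vs S) T I \<longleftrightarrow> idl T I"
proof -
  interpret S: lie_algebra F "vs S" using restrict_lie[OF S] .
  show ?thesis unfolding S.idl_def idl_def restrict_sub[OF S] using T by auto
qed

lemma restrict_bpow:
  assumes S: "alg S" and X: "X \<subseteq> S" and V: "V \<subseteq> S"
  shows "lie_algebra.bpow F (vs S) X n V = bpow X n V"
proof -
  interpret S: lie_algebra F "vs S" using restrict_lie[OF S] .
  have "br X S \<subseteq> S" using br_mono[OF X subset_refl, of S] alg_br[OF S] by blast
  then have le: "bpow X n V \<subseteq> S" for n using bpow_invariant[OF alg_sub[OF S] _ V] by blast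
  show ?thesis
    by (induction n) (simp_all add: S.bpow_Suc bpow_Suc restrict_br[OF S X le])
qed

lemma restrict_nilp:
  assumes S: "alg S" and T: "T \<subseteq> S"
  shows "lie_algebra.nilp F (vs S) T \<longleftrightarrow> nilp T"
proof -
  interpret S: lie_algebra F "vs S" using restrict_lie[OF S] .
  show ?thesis unfolding S.nilp_def nilp_def restrict_bpow[OF S T T] by simp
qed

lemma restrict_N2:
  assumes S: "alg S"
  shows "lie_algebra.N2 F (vs S) S \<longleftrightarrow> N2 S"
proof -
  interpret S: lie_algebra F "vs S" using restrict_lie[OF S] .
  show ?thesis
    unfolding S.N2_def N2_def restrict_idl[OF S subset_refl] restrict_bpow[OF S subset_refl subset_refl]
    using restrict_nilp[OF S idl_subset] by metis
qed

lemma lower_central_series_bpow: "lower_central_series F L n = bpow G n G"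
  by (induction n) (simp_all add: bpow_Suc)

lemma lie_nilpotent_iff: "lie_nilpotent F L \<longleftrightarrow> nilp G"
proof -
  have "bpow G n G = {\<zero>} \<longleftrightarrow> bpow G n G \<subseteq> {\<zero>}" for n
    using sub_zero[OF bpow_sub[OF subset_refl sub_whole]] by blast
  then show ?thesis unfolding lie_nilpotent_def lower_central_series_bpow nilp_def by simp
qed

lemma restrict_nilpotent:
  assumes S: "alg S"
  shows "lie_nilpotent F (vs S) \<longleftrightarrow> nilp S"
proof -
  interpret S: lie_algebra F "vs S" using restrict_lie[OF S] .
  show ?thesis unfolding S.lie_nilpotent_iff using restrict_nilp[OF S subset_refl] by simp
qed

lemma nilpotent_ideal_iff: "nilpotent_ideal F I L \<longleftrightarrow> idl G I \<and> nilp I"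
  unfolding nilpotent_ideal_def lie_ideal_iff using restrict_nilpotent[OF idl_alg[of G I]] by metis

lemma nilpotent_by_abelian_iff:
  assumes S: "alg S"
  shows "nilpotent_by_abelian F (vs S) \<longleftrightarrow> nba S"
proof -
  have "idl S (br S S)" using br_idl[OF idl_self[OF S] idl_self[OF S] alg_sub[OF S]] .
  from restrict_nilpotent[OF idl_alg[OF this]] show ?thesis
    unfolding nilpotent_by_abelian_def nba_def using restrict_br[OF S subset_refl subset_refl] by simp
qed

end

section \<open>Surjective homomorphisms\<close>

locale lie_hom = L: lie_algebra F L + Q: lie_algebra F Q for F and L (structure) and Q +
  fixes f
  assumes f_surj: "f ` carrier L = carrier Q"
    and f_add: "x \<in> carrier L \<Longrightarrow> y \<in> carrier L \<Longrightarrow> f (x \<oplus> y) = f x \<oplus>\<^bsub>Q\<^esub> f y"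
    and f_smult: "c \<in> carrier F \<Longrightarrow> x \<in> carrier L \<Longrightarrow> f (c \<odot> x) = c \<odot>\<^bsub>Q\<^esub> f x"
    and f_bracket: "x \<in> carrier L \<Longrightarrow> y \<in> carrier L \<Longrightarrow> f (x \<otimes> y) = f x \<otimes>\<^bsub>Q\<^esub> f y"
begin

lemma f_closed: "x \<in> carrier L \<Longrightarrow> f x \<in> carrier Q"
  using f_surj by blast

lemma f_zero: "f \<zero> = \<zero>\<^bsub>Q\<^esub>"
proof -
  have "f (\<zero>\<^bsub>F\<^esub> \<odot> \<zero>) = \<zero>\<^bsub>F\<^esub> \<odot>\<^bsub>Q\<^esub> f \<zero>" by (rule f_smult) auto
  then show ?thesis using f_closed[of \<zero>] by simp
qed

definition pre where "pre V = {x \<in> carrier L. f x \<in> V}"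

lemma pre_mono: "V \<subseteq> W \<Longrightarrow> pre V \<subseteq> pre W"
  by (auto simp: pre_def)

lemma pre_subset: "pre V \<subseteq> carrier L"
  by (auto simp: pre_def)

lemma pre_whole: "pre (carrier Q) = carrier L"
  using f_closed by (auto simp: pre_def)

lemma image_pre:
  assumes "V \<subseteq> carrier Q" shows "f ` pre V = V"
proof
  show "f ` pre V \<subseteq> V" by (auto simp: pre_def)
  show "V \<subseteq> f ` pre V"
  proof
    fix v assume v: "v \<in> V"
    then have "v \<in> f ` carrier L" using assms f_surj by auto
    then obtain x where "x \<in> carrier L" "v = f x" by blast
    then show "v \<in> f ` pre V" using v by (auto simp: pre_def)
  qed
qed

lemma image_sub:
  assumes W: "L.sub W" shows "Q.sub (f ` W)"
proof (rule Q.subI)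
  note c = L.sub_carrier[OF W]
  show "f ` W \<subseteq> carrier Q" using c f_closed by blast
  show "\<zero>\<^bsub>Q\<^esub> \<in> f ` W" using L.sub_zero[OF W] f_zero by (metis imageI)
  fix u v assume "u \<in> f ` W" "v \<in> f ` W"
  then obtain x y where xy: "x \<in> W" "y \<in> W" "u = f x" "v = f y" by blast
  then have "u \<oplus>\<^bsub>Q\<^esub> v = f (x \<oplus> y)" using f_add c by simp
  then show "u \<oplus>\<^bsub>Q\<^esub> v \<in> f ` W" using L.sub_add[OF W xy(1,2)] by blast
next
  note c = L.sub_carrier[OF W]
  fix k u assume k: "k \<in> carrier F" and "u \<in> f ` W"
  then obtain x where x: "x \<in> W" "u = f x" by blast
  then have "k \<odot>\<^bsub>Q\<^esub> u = f (k \<odot> x)" using f_smult k c by simp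
  then show "k \<odot>\<^bsub>Q\<^esub> u \<in> f ` W" using L.sub_smult[OF W k x(1)] by blast
qed

lemma pre_sub:
  assumes V: "Q.sub V" shows "L.sub (pre V)"
  by (rule L.subI)
    (simp_all add: pre_subset, simp_all add: pre_def f_zero f_add f_smult Q.sub_zero[OF V] Q.sub_add[OF V]
      Q.sub_smult[OF V])

lemma image_br:
  assumes X: "X \<subseteq> carrier L" and Y: "Y \<subseteq> carrier L"
  shows "f ` L.br X Y = Q.br (f ` X) (f ` Y)"
proof
  have fX: "f ` X \<subseteq> carrier Q" and fY: "f ` Y \<subseteq> carrier Q" using X Y f_closed by auto
  have s: "Q.sub (Q.br (f ` X) (f ` Y))" using Q.br_sub[OF fX fY] .
  have "L.br X Y \<subseteq> pre (Q.br (f ` X) (f ` Y))"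
  proof (rule L.br_least[OF pre_sub[OF s]])
    fix x y assume xy: "x \<in> X" "y \<in> Y"
    then have c: "x \<in> carrier L" "y \<in> carrier L" using X Y by auto
    have "f x \<otimes>\<^bsub>Q\<^esub> f y \<in> Q.br (f ` X) (f ` Y)" using Q.br_in[OF fX fY imageI[OF xy(1)] imageI[OF xy(2)]] .
    then show "x \<otimes> y \<in> pre (Q.br (f ` X) (f ` Y))"
      using c f_bracket L.bracket_closed by (simp add: pre_def)
  qed
  then show "f ` L.br X Y \<subseteq> Q.br (f ` X) (f ` Y)" by (auto simp: pre_def)
  show "Q.br (f ` X) (f ` Y) \<subseteq> f ` L.br X Y"
  proof (rule Q.br_least[OF image_sub[OF L.br_sub[OF X Y]]])
    fix u v assume "u \<in> f ` X" "v \<in> f ` Y"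
    then obtain x y where xy: "x \<in> X" "y \<in> Y" "u = f x" "v = f y" by blast
    then have "u \<otimes>\<^bsub>Q\<^esub> v = f (x \<otimes> y)" using f_bracket[OF subsetD[OF X] subsetD[OF Y]] by simp
    then show "u \<otimes>\<^bsub>Q\<^esub> v \<in> f ` L.br X Y" using L.br_in[OF X Y xy(1,2)] by blast
  qed
qed

lemma image_bpow:
  assumes X: "X \<subseteq> carrier L" and V: "V \<subseteq> carrier L"
  shows "f ` L.bpow X n V = Q.bpow (f ` X) n (f ` V)"
proof (induction n)
  case (Suc n)
  show ?case unfolding L.bpow_Suc Q.bpow_Suc image_br[OF X L.bpow_subset[OF X V]] Suc ..
qed simp

lemma image_der: "f ` L.der (carrier L) n = Q.der (carrier Q) n"
proof (induction n)
  case (Suc n)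
  have "L.der (carrier L) n \<subseteq> carrier L" using L.der_subset[OF L.alg_whole] .
  then show ?case by (simp only: L.der.simps Q.der.simps image_br Suc)
qed (simp add: f_surj)

lemma image_alg:
  assumes S: "L.alg S" shows "Q.alg (f ` S)"
proof (rule Q.algI[OF image_sub[OF L.alg_sub[OF S]]])
  have c: "S \<subseteq> carrier L" using L.alg_subset[OF S] .
  fix u v assume "u \<in> f ` S" "v \<in> f ` S"
  then obtain x y where xy: "x \<in> S" "y \<in> S" "u = f x" "v = f y" by blast
  then have "u \<otimes>\<^bsub>Q\<^esub> v = f (x \<otimes> y)" using f_bracket[OF subsetD[OF c] subsetD[OF c]] by simp
  then show "u \<otimes>\<^bsub>Q\<^esub> v \<in> f ` S" using L.alg_bracket[OF S xy(1,2)] by blast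
qed

lemma pre_alg:
  assumes T: "Q.alg T" shows "L.alg (pre T)"
  by (rule L.algI[OF pre_sub[OF Q.alg_sub[OF T]]])
    (simp add: pre_def f_bracket Q.alg_bracket[OF T] L.bracket_closed)

lemma image_idl:
  assumes I: "L.idl S I" and S: "S \<subseteq> carrier L" shows "Q.idl (f ` S) (f ` I)"
proof (rule Q.idlI[OF image_sub[OF L.idl_sub[OF I]]])
  show "f ` I \<subseteq> f ` S" using L.idl_subset[OF I] by blast
  fix u v assume "u \<in> f ` S" "v \<in> f ` I"
  then obtain x y where xy: "x \<in> S" "y \<in> I" "u = f x" "v = f y" by blast
  have "x \<in> carrier L" "y \<in> carrier L" using xy S L.idl_subset[OF I] by auto
  then have "u \<otimes>\<^bsub>Q\<^esub> v = f (x \<otimes> y)" using f_bracket xy by simp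
  then show "u \<otimes>\<^bsub>Q\<^esub> v \<in> f ` I" using L.idl_bracket[OF I xy(1,2)] by blast
qed

lemma pre_idl:
  assumes J: "Q.idl T J" shows "L.idl (pre T) (pre J)"
  by (rule L.idlI[OF pre_sub[OF Q.idl_sub[OF J]] pre_mono[OF Q.idl_subset[OF J]]])
    (simp add: pre_def f_bracket Q.idl_bracket[OF J] L.bracket_closed)

lemma pre_image:
  assumes W: "L.sub W" and K: "pre {\<zero>\<^bsub>Q\<^esub>} \<subseteq> W"
  shows "pre (f ` W) = W"
proof
  show "W \<subseteq> pre (f ` W)" using L.sub_subset[OF W] by (auto simp: pre_def)
  show "pre (f ` W) \<subseteq> W"
  proof
    fix x assume "x \<in> pre (f ` W)"
    then obtain w where x: "x \<in> carrier L" and w: "w \<in> W" "f x = f w" by (auto simp: pre_def)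
    have wc: "w \<in> carrier L" using L.sub_carrier[OF W w(1)] .
    \<comment> \<open>The negative is written as a scalar multiple so that \<open>f_add\<close> and
      \<open>f_smult\<close> can evaluate the difference.\<close>
    have mw: "\<ominus> w = (\<ominus>\<^bsub>F\<^esub> \<one>\<^bsub>F\<^esub>) \<odot> w" using wc by (simp add: L.smult_minus_1)
    have "f (x \<ominus> w) = f x \<oplus>\<^bsub>Q\<^esub> (\<ominus>\<^bsub>F\<^esub> \<one>\<^bsub>F\<^esub>) \<odot>\<^bsub>Q\<^esub> f w"
      unfolding L.M.minus_eq mw using x wc by (subst f_add) (simp_all add: f_smult)
    also have "\<dots> = \<zero>\<^bsub>Q\<^esub>" using w(2) f_closed[OF wc] by (simp add: Q.smult_minus_1 Q.M.r_neg)
    finally have "x \<ominus> w \<in> W" using K x wc by (auto simp: pre_def)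
    then show "x \<in> W" using L.sub_diff_iff(3)[OF W x w(1)] by blast
  qed
qed

lemma image_N2:
  assumes S: "L.alg S" and N2: "L.N2 S"
  shows "Q.N2 (f ` S)"
proof -
  have c: "S \<subseteq> carrier L" using L.alg_subset[OF S] .
  obtain N k n where N: "L.idl S N" "L.bpow N k N \<subseteq> {\<zero>}" "L.bpow S n S \<subseteq> N"
    using N2 unfolding L.N2_def L.nilp_def by blast
  have Nc: "N \<subseteq> carrier L" using L.idl_subset[OF N(1)] c by blast
  have "Q.bpow (f ` N) k (f ` N) \<subseteq> {\<zero>\<^bsub>Q\<^esub>}"
    unfolding image_bpow[OF Nc Nc, symmetric] using N(2) f_zero by auto
  moreover have "Q.bpow (f ` S) n (f ` S) \<subseteq> f ` N"
    unfolding image_bpow[OF c c, symmetric] using N(3) by blast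
  ultimately show ?thesis
    unfolding Q.N2_def Q.nilp_def using image_idl[OF N(1) c] by blast
qed

lemma fin_dim_image:
  assumes "L.fin_dim"
  shows "Q.fin_dim"
proof -
  have "linear_map F L Q f"
  proof (rule linear_map.intro)
    show "vectorspace F L" "vectorspace F Q" by unfold_locales
    show "mod_hom F L Q f"
      by (rule mod_hom.intro; unfold_locales)
        (auto simp: module_hom_def f_add f_smult f_closed)
  qed
  from linear_map.surj_fin_dim[OF this assms f_surj] show ?thesis .
qed

end

section \<open>Quotient algebras\<close>

context lie_algebra
begin

text \<open>The axioms are identities, so they pass along any surjection compatible with the
  operations. Nothing is presupposed about \<open>Q\<close>, which makes this applicable to the bare
  record of cosets.\<close>

lemma image_lie_algebra:
  assumes surj: "f ` carrier L = carrier Q"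
    and add: "\<And>x y. x \<in> carrier L \<Longrightarrow> y \<in> carrier L \<Longrightarrow> f x \<oplus>\<^bsub>Q\<^esub> f y = f (x \<oplus> y)"
    and smult: "\<And>c x. c \<in> carrier F \<Longrightarrow> x \<in> carrier L \<Longrightarrow> c \<odot>\<^bsub>Q\<^esub> f x = f (c \<odot> x)"
    and bracket: "\<And>x y. x \<in> carrier L \<Longrightarrow> y \<in> carrier L \<Longrightarrow> f x \<otimes>\<^bsub>Q\<^esub> f y = f (x \<otimes> y)"
    and zero: "\<zero>\<^bsub>Q\<^esub> = f \<zero>"
  shows "lie_algebra F Q"
proof -
  have rep: "\<exists>x\<in>G. u = f x" if "u \<in> carrier Q" for u using that surj by (metis imageE)
  have cl: "x \<in> G \<Longrightarrow> f x \<in> carrier Q" for x using surj by (metis imageI)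
  have ab: "abelian_group Q"
  proof (rule abelian_groupI)
    show "\<zero>\<^bsub>Q\<^esub> \<in> carrier Q" using cl zero by simp
  next
    fix u assume "u \<in> carrier Q"
    then obtain x where x: "x \<in> G" "u = f x" using rep by blast
    show "\<zero>\<^bsub>Q\<^esub> \<oplus>\<^bsub>Q\<^esub> u = u" using x by (simp add: zero add)
    have "f (\<ominus> x) \<oplus>\<^bsub>Q\<^esub> u = \<zero>\<^bsub>Q\<^esub>" using x by (simp add: zero add M.l_neg)
    moreover have "f (\<ominus> x) \<in> carrier Q" using x cl by simp
    ultimately show "\<exists>y\<in>carrier Q. y \<oplus>\<^bsub>Q\<^esub> u = \<zero>\<^bsub>Q\<^esub>" by blast
  next
    fix u v assume "u \<in> carrier Q" "v \<in> carrier Q"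
    then obtain x y where xy: "x \<in> G" "u = f x" "y \<in> G" "v = f y" using rep by metis
    show "u \<oplus>\<^bsub>Q\<^esub> v \<in> carrier Q" using xy cl by (simp add: add)
    show "u \<oplus>\<^bsub>Q\<^esub> v = v \<oplus>\<^bsub>Q\<^esub> u" using xy by (simp add: add M.a_comm)
  next
    fix u v w assume "u \<in> carrier Q" "v \<in> carrier Q" "w \<in> carrier Q"
    then obtain x y z where xyz: "x \<in> G" "u = f x" "y \<in> G" "v = f y" "z \<in> G" "w = f z"
      using rep by metis
    show "(u \<oplus>\<^bsub>Q\<^esub> v) \<oplus>\<^bsub>Q\<^esub> w = u \<oplus>\<^bsub>Q\<^esub> (v \<oplus>\<^bsub>Q\<^esub> w)" using xyz by (simp add: add M.a_assoc)
  qed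
  have mod: "Module.module F Q"
  proof (rule moduleI[OF R.is_cring ab])
    fix c u assume c: "c \<in> carrier F" and "u \<in> carrier Q"
    then obtain x where x: "x \<in> G" "u = f x" using rep by blast
    show "c \<odot>\<^bsub>Q\<^esub> u \<in> carrier Q" using x c cl by (simp add: smult)
  next
    fix c d u assume c: "c \<in> carrier F" "d \<in> carrier F" and "u \<in> carrier Q"
    then obtain x where x: "x \<in> G" "u = f x" using rep by blast
    show "(c \<oplus>\<^bsub>F\<^esub> d) \<odot>\<^bsub>Q\<^esub> u = c \<odot>\<^bsub>Q\<^esub> u \<oplus>\<^bsub>Q\<^esub> d \<odot>\<^bsub>Q\<^esub> u"
      using x c by (simp add: smult add smult_l_distr)
    show "(c \<otimes>\<^bsub>F\<^esub> d) \<odot>\<^bsub>Q\<^esub> u = c \<odot>\<^bsub>Q\<^esub> (d \<odot>\<^bsub>Q\<^esub> u)"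
      using x c by (simp add: smult smult_assoc1)
  next
    fix c u v assume c: "c \<in> carrier F" and "u \<in> carrier Q" "v \<in> carrier Q"
    then obtain x y where xy: "x \<in> G" "u = f x" "y \<in> G" "v = f y" using rep by metis
    show "c \<odot>\<^bsub>Q\<^esub> (u \<oplus>\<^bsub>Q\<^esub> v) = c \<odot>\<^bsub>Q\<^esub> u \<oplus>\<^bsub>Q\<^esub> c \<odot>\<^bsub>Q\<^esub> v"
      using xy c by (simp add: smult add smult_r_distr)
  next
    fix u assume "u \<in> carrier Q"
    then obtain x where x: "x \<in> G" "u = f x" using rep by blast
    show "\<one>\<^bsub>F\<^esub> \<odot>\<^bsub>Q\<^esub> u = u" using x by (simp add: smult)
  qed
  show ?thesis
  proof (rule lie_algebra.intro[OF vectorspace.intro[OF mod field_axioms]], rule lie_algebra_axioms.intro)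
    fix u v assume "u \<in> carrier Q" "v \<in> carrier Q"
    then obtain x y where xy: "x \<in> G" "u = f x" "y \<in> G" "v = f y" using rep by metis
    show "u \<otimes>\<^bsub>Q\<^esub> v \<in> carrier Q" using xy cl by (simp add: bracket bracket_closed)
  next
    fix u v w assume "u \<in> carrier Q" "v \<in> carrier Q" "w \<in> carrier Q"
    then obtain x y z where xyz: "x \<in> G" "u = f x" "y \<in> G" "v = f y" "z \<in> G" "w = f z"
      using rep by metis
    show "(u \<oplus>\<^bsub>Q\<^esub> v) \<otimes>\<^bsub>Q\<^esub> w = u \<otimes>\<^bsub>Q\<^esub> w \<oplus>\<^bsub>Q\<^esub> v \<otimes>\<^bsub>Q\<^esub> w"
      using xyz by (simp add: add bracket bracket_closed bracket_add_left)
    show "u \<otimes>\<^bsub>Q\<^esub> (v \<oplus>\<^bsub>Q\<^esub> w) = u \<otimes>\<^bsub>Q\<^esub> v \<oplus>\<^bsub>Q\<^esub> u \<otimes>\<^bsub>Q\<^esub> w"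
      using xyz by (simp add: add bracket bracket_closed bracket_add_right)
    show "u \<otimes>\<^bsub>Q\<^esub> (v \<otimes>\<^bsub>Q\<^esub> w) \<oplus>\<^bsub>Q\<^esub> v \<otimes>\<^bsub>Q\<^esub> (w \<otimes>\<^bsub>Q\<^esub> u) \<oplus>\<^bsub>Q\<^esub> w \<otimes>\<^bsub>Q\<^esub> (u \<otimes>\<^bsub>Q\<^esub> v) = \<zero>\<^bsub>Q\<^esub>"
      using xyz by (simp add: add bracket bracket_closed jacobi zero)
  next
    fix c u v assume c: "c \<in> carrier F" and "u \<in> carrier Q" "v \<in> carrier Q"
    then obtain x y where xy: "x \<in> G" "u = f x" "y \<in> G" "v = f y" using rep by metis
    show "(c \<odot>\<^bsub>Q\<^esub> u) \<otimes>\<^bsub>Q\<^esub> v = c \<odot>\<^bsub>Q\<^esub> (u \<otimes>\<^bsub>Q\<^esub> v)"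
      using xy c by (simp add: smult bracket bracket_closed bracket_smult_left)
    show "u \<otimes>\<^bsub>Q\<^esub> (c \<odot>\<^bsub>Q\<^esub> v) = c \<odot>\<^bsub>Q\<^esub> (u \<otimes>\<^bsub>Q\<^esub> v)"
      using xy c by (simp add: smult bracket bracket_closed bracket_smult_right)
  next
    fix u assume "u \<in> carrier Q"
    then obtain x where x: "x \<in> G" "u = f x" using rep by blast
    show "u \<otimes>\<^bsub>Q\<^esub> u = \<zero>\<^bsub>Q\<^esub>" using x by (simp add: bracket bracket_self zero)
  qed
qed

lemma coset_iff: "y \<in> I +> x \<longleftrightarrow> (\<exists>i\<in>I. y = i \<oplus> x)"
  unfolding a_r_coset_def' by auto

context
  fixes I
  assumes I: "idl G I"
begin

lemmas I_sub = idl_sub[OF I]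
lemmas I_subset = idl_subset[OF I]

lemma coset_self: "x \<in> G \<Longrightarrow> x \<in> I +> x"
  unfolding coset_iff using sub_zero[OF I_sub] by (metis M.l_zero)

lemma coset_eq:
  assumes "x \<in> G" "y \<in> G" "x \<ominus> y \<in> I"
  shows "I +> x = I +> y"
proof -
  have le: "I +> x \<subseteq> I +> y" if "x \<in> G" "y \<in> G" "x \<ominus> y \<in> I" for x y
  proof
    fix z assume "z \<in> I +> x"
    then obtain i where i: "i \<in> I" "z = i \<oplus> x" unfolding coset_iff by blast
    have ic: "i \<in> G" using i I_subset by blast
    have "z = (i \<oplus> (x \<ominus> y)) \<oplus> y"
      using i ic that minus_add_cancel[of x y] by (simp add: M.a_assoc)
    then show "z \<in> I +> y" unfolding coset_iff using sub_add[OF I_sub i(1) that(3)] by blast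
  qed
  have "y \<ominus> x = \<ominus> (x \<ominus> y)" using assms by (simp add: M.minus_eq M.minus_add M.minus_minus M.a_comm)
  then have "y \<ominus> x \<in> I" using sub_neg[OF I_sub assms(3)] by simp
  then show ?thesis using le[OF assms] le[OF assms(2,1)] by blast
qed

lemma coset_diff:
  assumes "x \<in> G" "y \<in> I +> x"
  shows "y \<in> G" "y \<ominus> x \<in> I"
proof -
  obtain i where i: "i \<in> I" "y = i \<oplus> x" using assms(2) unfolding coset_iff by blast
  have ic: "i \<in> G" using i I_subset by blast
  show "y \<in> G" using i ic assms by simp
  show "y \<ominus> x \<in> I" using i add_minus_cancel[OF ic assms(1)] by simp
qed

lemma coset_zero_iff: "x \<in> G \<Longrightarrow> I +> x = I \<longleftrightarrow> x \<in> I"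
proof -
  assume x: "x \<in> G"
  have I0: "I +> \<zero> = I" using a_coset_add_zero[OF I_subset] .
  show ?thesis
  proof
    show "I +> x = I \<Longrightarrow> x \<in> I" using coset_self[OF x] by simp
    assume "x \<in> I"
    then have "x \<ominus> \<zero> \<in> I" using sub_minus[OF I_sub _ sub_zero[OF I_sub]] by simp
    then show "I +> x = I" using coset_eq[OF x M.zero_closed] I0 by simp
  qed
qed

text \<open>Scalar multiplication and bracket of cosets are unions over representatives; all cosets
  in such a union coincide, since changing a representative changes the result by an element of
  \<open>I\<close>.\<close>

lemma quotient_lie_hom: "lie_hom F L (lie_quotient L I) (\<lambda>x. I +> x)"
proof -
  let ?Q = "lie_quotient L I"
  have car: "carrier ?Q = (\<lambda>x. I +> x) ` G"
    unfolding lie_quotient_def A_RCOSETS_def RCOSETS_def a_r_coset_def by auto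
  have add: "(I +> x) \<oplus>\<^bsub>?Q\<^esub> (I +> y) = I +> (x \<oplus> y)" if x: "x \<in> G" and y: "y \<in> G" for x y
  proof -
    have "set_add L (I +> x) (I +> y) = I +> (x \<oplus> y)"
    proof
      show "set_add L (I +> x) (I +> y) \<subseteq> I +> (x \<oplus> y)"
      proof
        fix z assume "z \<in> set_add L (I +> x) (I +> y)"
        then obtain u v where uv: "u \<in> I +> x" "v \<in> I +> y" "z = u \<oplus> v"
          unfolding set_add_iff by blast
        obtain i where i: "i \<in> I" "u = i \<oplus> x" using uv(1) unfolding coset_iff by blast
        obtain j where j: "j \<in> I" "v = j \<oplus> y" using uv(2) unfolding coset_iff by blast
        have ij: "i \<in> I" "j \<in> I" "z = (i \<oplus> x) \<oplus> (j \<oplus> y)" using i j uv(3) by auto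
        have "i \<in> G" "j \<in> G" using ij I_subset by auto
        then have "z = (i \<oplus> j) \<oplus> (x \<oplus> y)" using ij(3) x y by (simp add: M.a_ac)
        then show "z \<in> I +> (x \<oplus> y)" unfolding coset_iff using sub_add[OF I_sub ij(1,2)] by blast
      qed
      show "I +> (x \<oplus> y) \<subseteq> set_add L (I +> x) (I +> y)"
      proof
        fix z assume "z \<in> I +> (x \<oplus> y)"
        then obtain i where i: "i \<in> I" "z = i \<oplus> (x \<oplus> y)" unfolding coset_iff by blast
        have "i \<in> G" using i I_subset by auto
        then have "z = (i \<oplus> x) \<oplus> y" using i x y by (simp add: M.a_assoc)
        moreover have "i \<oplus> x \<in> I +> x" using i(1) coset_iff by blast
        ultimately show "z \<in> set_add L (I +> x) (I +> y)" using set_addI coset_self[OF y] by simp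
      qed
    qed
    then show ?thesis by (simp add: lie_quotient_def)
  qed
  have smult: "c \<odot>\<^bsub>?Q\<^esub> (I +> x) = I +> (c \<odot> x)" if c: "c \<in> carrier F" and x: "x \<in> G" for c x
  proof -
    have "I +> (c \<odot> a) = I +> (c \<odot> x)" if a: "a \<in> I +> x" for a
    proof (rule coset_eq)
      note d = coset_diff[OF x a]
      show "c \<odot> a \<in> G" "c \<odot> x \<in> G" using c x d by auto
      have "c \<odot> a \<ominus> c \<odot> x = c \<odot> (a \<ominus> x)"
        using c x d by (simp add: M.minus_eq smult_r_distr smult_r_minus)
      then show "c \<odot> a \<ominus> c \<odot> x \<in> I" using sub_smult[OF I_sub c d(2)] by simp
    qed
    then have "(\<Union>a\<in>I +> x. I +> (c \<odot> a)) = I +> (c \<odot> x)" using coset_self[OF x] by blast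
    then show ?thesis by (simp add: lie_quotient_def)
  qed
  have bracket: "(I +> x) \<otimes>\<^bsub>?Q\<^esub> (I +> y) = I +> (x \<otimes> y)" if x: "x \<in> G" and y: "y \<in> G" for x y
  proof -
    have *: "I +> (a \<otimes> b) = I +> (x \<otimes> y)" if a: "a \<in> I +> x" and b: "b \<in> I +> y" for a b
    proof (rule coset_eq)
      note da = coset_diff[OF x a] and db = coset_diff[OF y b]
      show "a \<otimes> b \<in> G" "x \<otimes> y \<in> G" using x y da db bracket_closed by auto
      \<comment> \<open>Changing one factor at a time leaves a bracket with an element of
        \<open>I\<close> in each summand.\<close>
      have "a \<otimes> b \<ominus> x \<otimes> y = (a \<ominus> x) \<otimes> b \<oplus> x \<otimes> (b \<ominus> y)"
      proof -
        have "(a \<ominus> x) \<otimes> b \<oplus> x \<otimes> (b \<ominus> y) = (a \<otimes> b \<ominus> x \<otimes> b) \<oplus> (x \<otimes> b \<ominus> x \<otimes> y)"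
          using x y da(1) db(1) by (simp add: bracket_minus)
        then show ?thesis
          using x y da(1) db(1) bracket_closed
          by (simp add: M.minus_eq M.a_assoc M.r_neg1 M.r_neg2)
      qed
      moreover have "(a \<ominus> x) \<otimes> b \<in> I" using idlD2[OF I sub_whole db(1) da(2)] .
      moreover have "x \<otimes> (b \<ominus> y) \<in> I" using idl_bracket[OF I x db(2)] .
      ultimately show "a \<otimes> b \<ominus> x \<otimes> y \<in> I" using sub_add[OF I_sub] by simp
    qed
    have "rcoset_mult L I (I +> x) (I +> y) = I +> (x \<otimes> y)"
      unfolding rcoset_mult_def
    proof (rule equalityI)
      show "(\<Union>a\<in>I +> x. \<Union>b\<in>I +> y. I +> (a \<otimes> b)) \<subseteq> I +> (x \<otimes> y)" using * by blast
      show "I +> (x \<otimes> y) \<subseteq> (\<Union>a\<in>I +> x. \<Union>b\<in>I +> y. I +> (a \<otimes> b))"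
        using coset_self[OF x] coset_self[OF y] by blast
    qed
    then show ?thesis by (simp add: lie_quotient_def)
  qed
  have zero: "\<zero>\<^bsub>?Q\<^esub> = I +> \<zero>" using a_coset_add_zero[OF I_subset] by (simp add: lie_quotient_def)
  have "lie_algebra F ?Q"
    by (rule image_lie_algebra[of "\<lambda>x. I +> x", OF car[symmetric] add smult bracket zero])
  then interpret Q: lie_algebra F ?Q .
  show ?thesis
    by unfold_locales (simp_all only: car add smult bracket)
qed

lemma quotient_zero: "\<zero>\<^bsub>lie_quotient L I\<^esub> = I"
  by (simp add: lie_quotient_def)

end

end

section \<open>Nilradical and upper nilpotent series\<close>

context fd_lie_algebra
begin

lemma quotient_fd: "idl G I \<Longrightarrow> fd_lie_algebra F (lie_quotient L I)"
proof -
  assume I: "idl G I"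
  interpret H: lie_hom F L "lie_quotient L I" "\<lambda>x. I +> x" using quotient_lie_hom[OF I] .
  show ?thesis by unfold_locales (rule H.fin_dim_image[OF fin_dim])
qed

lemma restrict_fd: "alg S \<Longrightarrow> fd_lie_algebra F (vs S)"
  using restrict_lie sub_fin_dim[OF alg_sub]
  by (auto intro!: fd_lie_algebra.intro fd_lie_algebra_axioms.intro)

text \<open>A maximal nilpotent ideal absorbs every other one, because by \<open>nilp_plus\<close>
  their sum is again nilpotent; this settles the definite description.\<close>

lemma nilradical:
  shows nilradical_idl: "idl G (nilradical F L)" and nilradical_nilp: "nilp (nilradical F L)"
    and nilradical_greatest: "idl G I \<Longrightarrow> nilp I \<Longrightarrow> I \<subseteq> nilradical F L"
proof -
  have "nilp {\<zero>}" unfolding nilp_def by (intro exI[of _ 0]) simp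
  then have "idl G {\<zero>} \<and> nilp {\<zero>}" using idl_trivial[OF sub_whole] by simp
  then obtain N where N: "idl G N" "nilp N" and max: "\<forall>N'. (idl G N' \<and> nilp N') \<and> N \<subseteq> N' \<longrightarrow> N' = N"
    using ex_maximal_sub[of "\<lambda>N. idl G N \<and> nilp N" "{\<zero>}"] idl_sub by metis
  have great: "I \<subseteq> N" if I: "idl G I" "nilp I" for I
  proof -
    note s = idl_sub[OF N(1)] idl_sub[OF I(1)]
    have "N \<boxplus> I = N"
      using max idl_plus[OF N(1) I(1) sub_whole] nilp_plus[OF sub_whole N I] plus_left[OF s] by blast
    then show ?thesis using plus_right[OF s] by blast
  qed
  have "nilradical F L = N" unfolding nilradical_def nilpotent_ideal_iff
    by (rule the_equality) (use N great in blast)+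
  then show "idl G (nilradical F L)" "nilp (nilradical F L)"
    "idl G I \<Longrightarrow> nilp I \<Longrightarrow> I \<subseteq> nilradical F L"
    using N great by auto
qed

text \<open>Image and preimage under the projection match the nilpotent ideals of the quotient with
  the ideals of \<open>G\<close> that are nilpotent modulo \<open>I\<close>. Each step of the upper
  nilpotent series thereby becomes coset-free.\<close>

lemma nilradical_preimage:
  assumes I: "idl G I"
  defines "R \<equiv> {x \<in> G. I +> x \<in> nilradical F (lie_quotient L I)}"
  shows "idl G R" "I \<subseteq> R" "\<exists>k. bpow R k R \<subseteq> I" "\<And>J k. idl G J \<Longrightarrow> bpow J k J \<subseteq> I \<Longrightarrow> J \<subseteq> R"
proof -
  let ?Q = "lie_quotient L I"
  interpret Q: fd_lie_algebra F ?Q using quotient_fd[OF I] .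
  interpret H: lie_hom F L ?Q "\<lambda>x. I +> x" using quotient_lie_hom[OF I] .
  have R: "R = H.pre (nilradical F ?Q)" unfolding R_def H.pre_def ..
  have zQ: "\<zero>\<^bsub>?Q\<^esub> = I" using quotient_zero[OF I] .
  have ker: "H.pre {\<zero>\<^bsub>?Q\<^esub>} = I"
    unfolding H.pre_def zQ using coset_zero_iff[OF I] idl_subset[OF I] by blast
  have Nc: "nilradical F ?Q \<subseteq> carrier ?Q" using Q.idl_subset[OF Q.nilradical_idl] .
  show idlR: "idl G R" unfolding R using H.pre_idl[OF Q.nilradical_idl] unfolding H.pre_whole .
  have "{\<zero>\<^bsub>?Q\<^esub>} \<subseteq> nilradical F ?Q" using Q.sub_zero[OF Q.idl_sub[OF Q.nilradical_idl]] by simp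
  from H.pre_mono[OF this] show "I \<subseteq> R" unfolding R ker .
  have Rc: "R \<subseteq> G" using idl_subset[OF idlR] .
  have fR: "(\<lambda>x. I +> x) ` R = nilradical F ?Q" unfolding R using H.image_pre[OF Nc] .
  obtain k where k: "Q.bpow (nilradical F ?Q) k (nilradical F ?Q) \<subseteq> {\<zero>\<^bsub>?Q\<^esub>}"
    using Q.nilradical_nilp unfolding Q.nilp_def by blast
  then have "(\<lambda>x. I +> x) ` bpow R k R \<subseteq> {\<zero>\<^bsub>?Q\<^esub>}" unfolding H.image_bpow[OF Rc Rc] fR .
  then have "bpow R k R \<subseteq> H.pre {\<zero>\<^bsub>?Q\<^esub>}"
    using bpow_subset[OF Rc Rc] unfolding H.pre_def by blast
  then show "\<exists>k. bpow R k R \<subseteq> I" unfolding ker by blast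
  show "J \<subseteq> R" if J: "idl G J" "bpow J k J \<subseteq> I" for J k
  proof -
    have Jc: "J \<subseteq> G" using idl_subset[OF J(1)] .
    have "bpow J k J \<subseteq> H.pre {\<zero>\<^bsub>?Q\<^esub>}" using J(2) by (simp only: ker)
    then have "(\<lambda>x. I +> x) ` bpow J k J \<subseteq> {\<zero>\<^bsub>?Q\<^esub>}" unfolding H.pre_def by blast
    then have "Q.nilp ((\<lambda>x. I +> x) ` J)" unfolding Q.nilp_def H.image_bpow[OF Jc Jc] by blast
    moreover have "Q.idl (carrier ?Q) ((\<lambda>x. I +> x) ` J)"
      using H.image_idl[OF J(1) subset_refl] unfolding H.f_surj .
    ultimately have "(\<lambda>x. I +> x) ` J \<subseteq> nilradical F ?Q" using Q.nilradical_greatest by blast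
    then show ?thesis unfolding R_def using Jc by blast
  qed
qed

text \<open>The first term of the series is the largest nilpotent ideal, so it contains every ideal
  that witnesses \<open>N2\<close>; the second term is \<open>G\<close> when \<open>G\<close> is
  nilpotent modulo the first.\<close>

lemma nilpotent_length_le_2_iff: "nilpotent_length_le F 2 L \<longleftrightarrow> N2 G"
proof -
  let ?U = "upper_nilpotent_series F L"
  have U: "idl G (?U i)" for i
  proof (induction i)
    case 0
    show ?case using idl_trivial[OF sub_whole] by simp
  next
    case (Suc i)
    then show ?case using nilradical_preimage(1)[OF Suc] by simp
  qed
  have inc: "?U i \<subseteq> ?U (Suc i)" for i using nilradical_preimage(2)[OF U[of i]] by simp
  have pow: "\<exists>k. bpow (?U (Suc i)) k (?U (Suc i)) \<subseteq> ?U i" for i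
    using nilradical_preimage(3)[OF U[of i]] by simp
  have great: "J \<subseteq> ?U (Suc i)" if "idl G J" "bpow J k J \<subseteq> ?U i" for J k i
    using nilradical_preimage(4)[OF U[of i] that] by simp
  have U2: "?U 2 = ?U (Suc 1)" "?U 1 = ?U (Suc 0)" by (simp_all only: numeral_2_eq_2 One_nat_def)
  have UG: "?U i \<subseteq> G" for i using idl_subset[OF U] .
  show ?thesis
  proof
    assume "nilpotent_length_le F 2 L"
    then have ex: "\<exists>k. ?U k = G" and le: "nilpotent_length F L \<le> 2"
      unfolding nilpotent_length_le_def by auto
    have m: "?U (nilpotent_length F L) = G"
      unfolding nilpotent_length_def using LeastI_ex[OF ex] .
    \<comment> \<open>The series increases, so reaching \<open>G\<close> at an index of at most 2
      means having it at index 2.\<close>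
    have "?U (nilpotent_length F L) \<subseteq> ?U 2" using lift_Suc_mono_le[of ?U, OF inc le] .
    then have GU: "?U 2 = G" using m UG by blast
    obtain k where "bpow (?U 2) k (?U 2) \<subseteq> ?U 1" using pow[of 1] U2 by metis
    then have 1: "bpow G k G \<subseteq> ?U 1" unfolding GU .
    obtain j where "bpow (?U 1) j (?U 1) \<subseteq> {\<zero>}" using pow[of 0] U2 by (metis upper_nilpotent_series.simps(1))
    then have "nilp (?U 1)" unfolding nilp_def by blast
    then show "N2 G" unfolding N2_def using U 1 by blast
  next
    assume "N2 G"
    then obtain N k n where N: "idl G N" "bpow N k N \<subseteq> {\<zero>}" "bpow G n G \<subseteq> N"
      unfolding N2_def nilp_def by blast
    have "N \<subseteq> ?U (Suc 0)" using great[OF N(1)] N(2) by (metis upper_nilpotent_series.simps(1))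
    then have "bpow G n G \<subseteq> ?U (Suc 0)" using N(3) by blast
    then have "G \<subseteq> ?U (Suc (Suc 0))" using great[OF idl_self[OF alg_whole]] by metis
    then have "?U 2 = G" using UG[of 2] by (simp only: numeral_2_eq_2)
    then show "nilpotent_length_le F 2 L"
      unfolding nilpotent_length_le_def nilpotent_length_def using Least_le[of "\<lambda>m. ?U m = G" 2] by blast
  qed
qed

end

context lie_algebra
begin

lemma minimal_ideal_iff:
  assumes S: "alg S"
  shows "minimal_ideal F A (vs S) \<longleftrightarrow> minid S A"
proof -
  interpret S: lie_algebra F "vs S" using restrict_lie[OF S] .
  show ?thesis
    unfolding minimal_ideal_def minid_def S.lie_ideal_iff using restrict_idl[OF S subset_refl] by simp
qed

end

lemma (in fd_lie_algebra) minimal_non_iff: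
  "minimal_non F (nilpotent_length_le F 2) L \<longleftrightarrow> (\<forall>S. alg S \<and> S \<noteq> G \<longrightarrow> N2 S) \<and> \<not> N2 G"
  "minimal_non F (nilpotent_by_abelian F) L \<longleftrightarrow> (\<forall>S. alg S \<and> S \<noteq> G \<longrightarrow> nba S) \<and> \<not> nba G"
proof -
  have "nilpotent_length_le F 2 (vs S) \<longleftrightarrow> N2 S" if S: "alg S" for S
  proof -
    interpret S: fd_lie_algebra F "vs S" using restrict_fd[OF S] .
    show ?thesis using S.nilpotent_length_le_2_iff restrict_N2[OF S] by simp
  qed
  then show "minimal_non F (nilpotent_length_le F 2) L \<longleftrightarrow> (\<forall>S. alg S \<and> S \<noteq> G \<longrightarrow> N2 S) \<and> \<not> N2 G"
    unfolding minimal_non_def nilpotent_length_le_2_iff by blast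
  have "nilpotent_by_abelian F L \<longleftrightarrow> nba G" using nilpotent_by_abelian_iff[OF alg_whole] by simp
  then show "minimal_non F (nilpotent_by_abelian F) L \<longleftrightarrow> (\<forall>S. alg S \<and> S \<noteq> G \<longrightarrow> nba S) \<and> \<not> nba G"
    unfolding minimal_non_def using nilpotent_by_abelian_iff by blast
qed

section \<open>Passage to the quotient by the Frattini ideal\<close>

context fd_lie_algebra
begin

text \<open>Every maximal subalgebra of \<open>L\<close> contains the kernel, so it is the full
  preimage of its image, and that image is maximal in the quotient. An element common to all the
  images therefore comes from the Frattini subalgebra.\<close>

lemma frattini_quotient_trivial:
  assumes S: "solv G"
  shows "frattini F (lie_quotient L \<Phi>) = {\<zero>\<^bsub>lie_quotient L \<Phi>\<^esub>}"
proof -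
  let ?Q = "lie_quotient L \<Phi>" and ?f = "\<lambda>x. \<Phi> +> x"
  note I = frattini_idl[OF S]
  interpret Q: fd_lie_algebra F ?Q using quotient_fd[OF I] .
  interpret H: lie_hom F L ?Q ?f using quotient_lie_hom[OF I] .
  have ker: "H.pre {\<zero>\<^bsub>?Q\<^esub>} = \<Phi>"
    unfolding H.pre_def quotient_zero[OF I] using coset_zero_iff[OF I] idl_subset[OF I] by blast
  have max: "maximal_subalgebra F (?f ` M) ?Q" and preM: "H.pre (?f ` M) = M"
    if M: "maximal_subalgebra F M L" for M
  proof -
    note Ma = maximal_alg[OF M]
    show preM: "H.pre (?f ` M) = M"
      by (rule H.pre_image[OF alg_sub[OF Ma]]) (simp only: ker frattini_le[OF M])
    have "?f ` M \<noteq> carrier ?Q"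
    proof
      assume "?f ` M = carrier ?Q"
      then have "M = G" using preM H.pre_whole by simp
      then show False using maximal_ne[OF M] by simp
    qed
    moreover have "T = ?f ` M \<or> T = carrier ?Q" if T: "Q.alg T" "?f ` M \<subseteq> T" for T
    proof -
      have fT: "?f ` H.pre T = T" using H.image_pre[OF Q.alg_subset[OF T(1)]] .
      have "M \<subseteq> H.pre T" using H.pre_mono[OF T(2)] preM by simp
      then have "H.pre T = M \<or> H.pre T = G" using maximal_max[OF M H.pre_alg[OF T(1)]] by blast
      then show ?thesis using fT H.f_surj by metis
    qed
    ultimately show "maximal_subalgebra F (?f ` M) ?Q"
      unfolding maximal_subalgebra_def using H.image_alg[OF Ma] by blast
  qed
  have "frattini F ?Q \<subseteq> {\<zero>\<^bsub>?Q\<^esub>}"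
  proof
    fix u assume u: "u \<in> frattini F ?Q"
    then have "u \<in> ?f ` G" using Q.sub_carrier[OF Q.sub_frattini] H.f_surj by metis
    then obtain x where x: "x \<in> G" "u = ?f x" by blast
    have "x \<in> M" if M: "maximal_subalgebra F M L" for M
    proof -
      have "u \<in> ?f ` M" using u Q.frattini_le[OF max[OF M]] by blast
      then have "x \<in> H.pre (?f ` M)" using x unfolding H.pre_def by blast
      then show ?thesis using preM[OF M] by simp
    qed
    then have "x \<in> \<Phi>" unfolding frattini_def using x(1) by blast
    then have "x \<in> H.pre {\<zero>\<^bsub>?Q\<^esub>}" by (simp only: ker)
    then show "u \<in> {\<zero>\<^bsub>?Q\<^esub>}" using x(2) unfolding H.pre_def by blast
  qed
  then show ?thesis using Q.sub_le_trivial[OF Q.sub_frattini] by blast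
qed

lemma type_I_iff:
  assumes S: "solv G"
  shows "type_I F L \<longleftrightarrow> (\<exists>n. [Suc n] \<cdot>\<^bsub>F\<^esub> \<one>\<^bsub>F\<^esub> = \<zero>\<^bsub>F\<^esub>) \<and>
    (\<exists>A C M x. type_I_splitting F (lie_quotient L \<Phi>) A C M x)"
proof -
  let ?Q = "lie_quotient L \<Phi>"
  note I = frattini_idl[OF S]
  interpret Q: fd_lie_algebra F ?Q using quotient_fd[OF I] .
  \<comment> \<open>\<open>characteristic\<close> is the least positive annihilating multiple of 1,
    with default 0 if there is none; \<open>Suc n\<close> builds in the positivity.\<close>
  have char: "characteristic F > 0 \<longleftrightarrow> (\<exists>n. [Suc n] \<cdot>\<^bsub>F\<^esub> \<one>\<^bsub>F\<^esub> = \<zero>\<^bsub>F\<^esub>)"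
  proof
    assume "characteristic F > 0"
    then have "\<exists>n::nat. n > 0 \<and> [n] \<cdot>\<^bsub>F\<^esub> \<one>\<^bsub>F\<^esub> = \<zero>\<^bsub>F\<^esub>"
      unfolding characteristic_def by (auto split: if_splits)
    then show "\<exists>n. [Suc n] \<cdot>\<^bsub>F\<^esub> \<one>\<^bsub>F\<^esub> = \<zero>\<^bsub>F\<^esub>" by (metis gr0_conv_Suc)
  next
    assume "\<exists>n. [Suc n] \<cdot>\<^bsub>F\<^esub> \<one>\<^bsub>F\<^esub> = \<zero>\<^bsub>F\<^esub>"
    then have ex: "\<exists>n::nat. n > 0 \<and> [n] \<cdot>\<^bsub>F\<^esub> \<one>\<^bsub>F\<^esub> = \<zero>\<^bsub>F\<^esub>" by blast
    then show "characteristic F > 0"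
      unfolding characteristic_def using LeastI_ex[OF ex] by simp
  qed
  have min: "minimal_ideal F A ?Q \<longleftrightarrow> Q.minid (carrier ?Q) A" for A
    using Q.minimal_ideal_iff[OF Q.alg_whole] by simp
  have ab: "Q.br A A = {\<zero>\<^bsub>?Q\<^esub>} \<longleftrightarrow> Q.br A A \<subseteq> {\<zero>\<^bsub>?Q\<^esub>}" if "Q.sub A" for A
    using Q.sub_zero[OF Q.br_sub[OF Q.sub_subset[OF that] Q.sub_subset[OF that]]] by blast
  have "(minimal_ideal F A ?Q \<and> (\<forall>A'. minimal_ideal F A' ?Q \<longrightarrow> A' = A) \<and>
        vectorspace.dim F (?Q\<lparr>carrier := A\<rparr>) \<ge> 2 \<and> lie_product F ?Q A A = {\<zero>\<^bsub>?Q\<^esub>} \<and>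
        lie_subalgebra F B ?Q \<and> is_direct_sum ?Q (carrier ?Q) A B \<and>
        minimal_ideal F M (?Q\<lparr>carrier := B\<rparr>) \<and> lie_product F ?Q M M = {\<zero>\<^bsub>?Q\<^esub>} \<and>
        x \<in> B \<and> x \<noteq> \<zero>\<^bsub>?Q\<^esub> \<and> is_direct_sum ?Q B M {c \<odot>\<^bsub>?Q\<^esub> x | c. c \<in> carrier F})
      \<longleftrightarrow> type_I_splitting F ?Q A B M x"
    (is "?L \<longleftrightarrow> ?R") for A B M x
  proof
    assume L: ?L
    from L have m: "minimal_ideal F A ?Q" "\<forall>A'. minimal_ideal F A' ?Q \<longrightarrow> A' = A"
        "minimal_ideal F M (?Q\<lparr>carrier := B\<rparr>)"
      and d: "2 \<le> Q.sdim A"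
      and a: "lie_product F ?Q A A = {\<zero>\<^bsub>?Q\<^esub>}" "lie_product F ?Q M M = {\<zero>\<^bsub>?Q\<^esub>}"
      and B: "Q.alg B" and x: "x \<in> B" "x \<noteq> \<zero>\<^bsub>?Q\<^esub>"
      and ds: "is_direct_sum ?Q (carrier ?Q) A B" "is_direct_sum ?Q B M (Q.line x)"
      unfolding Q.line_def Q.sdim_def by simp_all
    have mA: "Q.minid (carrier ?Q) A" and mM: "Q.minid B M"
      using m min Q.minimal_ideal_iff[OF B] by blast+
    show ?R
    proof unfold_locales
      show "Q.minid (carrier ?Q) A" "Q.minid B M" "Q.alg B" by (rule mA mM B)+
      show "A' = A" if "Q.minid (carrier ?Q) A'" for A' using m(2) that min by blast
      show "Q.br A A \<subseteq> {\<zero>\<^bsub>?Q\<^esub>}" "Q.br M M \<subseteq> {\<zero>\<^bsub>?Q\<^esub>}" by (simp_all only: a subset_refl)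
      show "x \<in> B" "x \<noteq> \<zero>\<^bsub>?Q\<^esub>" "2 \<le> Q.sdim A" by (rule x d)+
      show "Q.subspace_plus A B = carrier ?Q" "A \<inter> B = {\<zero>\<^bsub>?Q\<^esub>}"
        using ds(1) unfolding is_direct_sum_def by simp_all
      show "B = Q.subspace_plus M (Q.line x)" using ds(2) unfolding is_direct_sum_def by (rule conjunct1)
      show "M \<inter> Q.line x = {\<zero>\<^bsub>?Q\<^esub>}" using ds(2) unfolding is_direct_sum_def by (rule conjunct2)
    qed
  next
    assume R: ?R
    then interpret type_I_splitting F ?Q A B M x .
    have "minimal_ideal F A ?Q" "\<forall>A'. minimal_ideal F A' ?Q \<longrightarrow> A' = A"
      using A_min A_unique min by blast+
    moreover have "minimal_ideal F M (?Q\<lparr>carrier := B\<rparr>)"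
      using M_min Q.minimal_ideal_iff[OF C_alg] by blast
    moreover have "lie_product F ?Q A A = {\<zero>\<^bsub>?Q\<^esub>}" "lie_product F ?Q M M = {\<zero>\<^bsub>?Q\<^esub>}"
      using ab[OF A_sub] ab[OF M_sub] A_abelian M_abelian by blast+
    moreover have "is_direct_sum ?Q (carrier ?Q) A B"
      unfolding is_direct_sum_def using AC AC_disj by simp
    moreover have "is_direct_sum ?Q B M {c \<odot>\<^bsub>?Q\<^esub> x | c. c \<in> carrier F}"
      unfolding is_direct_sum_def Q.line_def[symmetric] using Mx Mx_disj by (rule conjI)
    moreover note x x_nonzero C_alg A_dim[unfolded Q.sdim_def]
    ultimately show ?L by (intro conjI)
  qed
  then show ?thesis unfolding type_I_def Let_def char by simp
qed

theorem minimal_non_N2_iff: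
  assumes der3: "der G 3 \<subseteq> {\<zero>}"
  shows "(\<forall>S. alg S \<and> S \<noteq> G \<longrightarrow> N2 S) \<and> \<not> N2 G
    \<longleftrightarrow> ((\<forall>S. alg S \<and> S \<noteq> G \<longrightarrow> nba S) \<and> \<not> nba G) \<and> type_I F L"
proof -
  have S: "solv G" unfolding solv_def using der3 by blast
  let ?Q = "lie_quotient L \<Phi>" and ?f = "\<lambda>x. \<Phi> +> x"
  note I = frattini_idl[OF S]
  interpret Q: fd_lie_algebra F ?Q using quotient_fd[OF I] .
  interpret H: lie_hom F L ?Q ?f using quotient_lie_hom[OF I] .
  have \<Phi>G: "\<Phi> \<subseteq> G" using idl_subset[OF I] .
  have ker: "H.pre {\<zero>\<^bsub>?Q\<^esub>} = \<Phi>"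
    unfolding H.pre_def quotient_zero[OF I] using coset_zero_iff[OF I] \<Phi>G by blast
  \<comment> \<open>The preimage is nilpotent modulo the kernel, which is the Frattini subalgebra,
    hence nilpotent by \<open>frattini_nilp\<close>. Both directions lift nilpotency from the
    quotient in this way.\<close>
  have pre_nilp: "nilp (H.pre N)" if N: "Q.idl (carrier ?Q) N" "Q.nilp N" for N
  proof -
    have P: "idl G (H.pre N)" using H.pre_idl[OF N(1)] unfolding H.pre_whole .
    note Pc = idl_subset[OF P]
    obtain k where "Q.bpow N k N \<subseteq> {\<zero>\<^bsub>?Q\<^esub>}" using N(2) unfolding Q.nilp_def by blast
    then have "?f ` bpow (H.pre N) k (H.pre N) \<subseteq> {\<zero>\<^bsub>?Q\<^esub>}"
      unfolding H.image_bpow[OF Pc Pc] H.image_pre[OF Q.idl_subset[OF N(1)]] .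
    then have "bpow (H.pre N) k (H.pre N) \<subseteq> H.pre {\<zero>\<^bsub>?Q\<^esub>}"
      using bpow_subset[OF Pc Pc] unfolding H.pre_def by blast
    then show ?thesis using frattini_nilp[OF S P] unfolding ker by blast
  qed
  have image_le: "X \<subseteq> H.pre V" if "?f ` X \<subseteq> V" "X \<subseteq> G" for X V
    using that unfolding H.pre_def by blast
  show ?thesis
  proof
    assume "(\<forall>S. alg S \<and> S \<noteq> G \<longrightarrow> N2 S) \<and> \<not> N2 G"
    then have sub_N2: "\<And>S. alg S \<Longrightarrow> S \<noteq> G \<Longrightarrow> N2 S" and nN2: "\<not> N2 G" by auto
    have QnN2: "\<not> Q.N2 (carrier ?Q)"
    proof
      assume "Q.N2 (carrier ?Q)"
      then obtain N n where N: "Q.idl (carrier ?Q) N" "Q.nilp N" "Q.bpow (carrier ?Q) n (carrier ?Q) \<subseteq> N"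
        unfolding Q.N2_def by blast
      have "?f ` bpow G n G \<subseteq> N" unfolding H.image_bpow[OF subset_refl subset_refl] H.f_surj using N(3) .
      then have "bpow G n G \<subseteq> H.pre N" using image_le bpow_subset[OF subset_refl subset_refl] by blast
      moreover have "idl G (H.pre N)" using H.pre_idl[OF N(1)] unfolding H.pre_whole .
      ultimately have "N2 G" unfolding N2_def using pre_nilp[OF N(1,2)] by blast
      then show False using nN2 by simp
    qed
    have Qsub: "Q.N2 T" if T: "Q.alg T" "T \<noteq> carrier ?Q" for T
    proof -
      have fT: "?f ` H.pre T = T" using H.image_pre[OF Q.alg_subset[OF T(1)]] .
      then have "H.pre T \<noteq> G" using T(2) H.f_surj by metis
      then show ?thesis using H.image_N2[OF H.pre_alg[OF T(1)]] sub_N2[OF H.pre_alg[OF T(1)]] fT by simp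
    qed
    have "Q.der (carrier ?Q) 3 = ?f ` der G 3" using H.image_der by simp
    moreover have "?f ` der G 3 \<subseteq> {\<zero>\<^bsub>?Q\<^esub>}" using der3 H.f_zero by blast
    ultimately have Qder: "Q.der (carrier ?Q) 3 \<subseteq> {\<zero>\<^bsub>?Q\<^esub>}" by simp
    have struct: "(\<exists>n. [Suc n] \<cdot>\<^bsub>F\<^esub> \<one>\<^bsub>F\<^esub> = \<zero>\<^bsub>F\<^esub>) \<and> (\<exists>A C M x. type_I_splitting F ?Q A C M x)"
      by (rule Q.minimal_non_N2_structure[OF Qder frattini_quotient_trivial[OF S] QnN2]) (rule Qsub)
    then have type: "type_I F L" unfolding type_I_iff[OF S] .
    from struct obtain A C M x where "type_I_splitting F ?Q A C M x" by (elim conjE exE) (rule that)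
    then interpret type_I_splitting F ?Q A C M x .
    have "\<not> nba G" using nba_N2[OF alg_whole] nN2 by blast
    moreover have "nba T" if T: "alg T" "T \<noteq> G" for T
    proof -
      \<comment> \<open>As \<open>nba\<close> passes to smaller subalgebras, only maximal ones need
        treatment.\<close>
      obtain M' where M': "maximal_subalgebra F M' L" and TM: "T \<subseteq> M'" using ex_maximal[OF T] by blast
      note Ma = maximal_alg[OF M']
      note sM = alg_sub[OF Ma]
      have Mc: "M' \<subseteq> G" using sub_subset[OF sM] .
      let ?S = "?f ` M'"
      have preM: "H.pre ?S = M'" by (rule H.pre_image[OF sM]) (simp only: ker frattini_le[OF M'])
      have Sa: "Q.alg ?S" using H.image_alg[OF Ma] .
      have SQ: "?S \<noteq> carrier ?Q" using preM H.pre_whole maximal_ne[OF M'] by metis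
      have brM: "br M' M' \<subseteq> G" using alg_br[OF Ma] Mc by blast
      have f_br: "?f ` br M' M' = Q.br ?S ?S" using H.image_br[OF Mc Mc] .
      have "nba M'"
      proof (cases "A \<subseteq> ?S")
        case True
        have "Q.br ?S ?S \<subseteq> A" using over_A_abelian[OF Sa True SQ] .
        then have "br M' M' \<subseteq> H.pre A" using image_le[OF _ brM] f_br by simp
        then show ?thesis unfolding nba_def using pre_nilp[OF A_idl A_nilp] nilp_mono by blast
      next
        case False
        let ?E = "Q.subspace_plus A ?S"
        have Ea: "Q.alg ?E" using Q.idl_plus_alg[OF A_idl Sa Q.alg_subset[OF Sa] Q.alg_whole] .
        have AE: "A \<subseteq> ?E" and SE: "?S \<subseteq> ?E"
          using Q.plus_left[OF A_sub Q.alg_sub[OF Sa]] Q.plus_right[OF A_sub Q.alg_sub[OF Sa]] by auto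
        have fE: "?f ` H.pre ?E = ?E" using H.image_pre[OF Q.alg_subset[OF Ea]] .
        have "M' \<subseteq> H.pre ?E" using H.pre_mono[OF SE] unfolding preM .
        then have "H.pre ?E = M' \<or> H.pre ?E = G" using maximal_max[OF M' H.pre_alg[OF Ea]] by blast
        moreover have "H.pre ?E \<noteq> M'" using fE AE False by metis
        ultimately have EQ: "?E = carrier ?Q" using fE H.f_surj by metis
        obtain N n where N: "idl M' N" "nilp N" "bpow M' n M' \<subseteq> N"
          using sub_N2[OF Ma maximal_ne[OF M']] unfolding N2_def by blast
        have "Q.bpow ?S n ?S \<subseteq> ?f ` N" unfolding H.image_bpow[OF Mc Mc, symmetric] using N(3) by blast
        then have brS: "Q.br ?S ?S \<subseteq> ?f ` N" using complement_derived[OF QnN2 Sa SQ EQ] by blast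
        have \<Phi>M: "idl M' \<Phi>" using idl_restrict[OF I frattini_le[OF M'] Mc] .
        \<comment> \<open>With exponent 0 the hypothesis of \<open>frattini_nilp\<close> is the
          inclusion of the Frattini subalgebra in itself.\<close>
        have \<Phi>n: "nilp \<Phi>" using frattini_nilp[OF S I, of 0] by simp
        \<comment> \<open>The image of [M',M'] determines it only up to the kernel, so
          \<open>N\<close> is enlarged by the kernel; both are nilpotent ideals of
          \<open>M'\<close>, and so is their sum.\<close>
        let ?N = "\<Phi> \<boxplus> N"
        note s = idl_sub[OF \<Phi>M] idl_sub[OF N(1)]
        have "?f ` N \<subseteq> ?f ` ?N" using plus_right[OF s] by blast
        then have "br M' M' \<subseteq> H.pre (?f ` ?N)" using image_le[OF _ brM] f_br brS by simp
        also have "H.pre (?f ` ?N) = ?N"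
          by (rule H.pre_image[OF sub_plus[OF s]]) (simp only: ker plus_left[OF s])
        finally show ?thesis
          unfolding nba_def using nilp_plus[OF sM \<Phi>M \<Phi>n N(1,2)] nilp_mono by blast
      qed
      then show ?thesis using nba_mono TM by blast
    qed
    ultimately show "((\<forall>S. alg S \<and> S \<noteq> G \<longrightarrow> nba S) \<and> \<not> nba G) \<and> type_I F L" using type by blast
  next
    assume *: "((\<forall>S. alg S \<and> S \<noteq> G \<longrightarrow> nba S) \<and> \<not> nba G) \<and> type_I F L"
    then have "type_I F L" by (elim conjE)
    then obtain A C M x where "type_I_splitting F ?Q A C M x"
      unfolding type_I_iff[OF S] by (elim conjE exE) (rule that)
    then interpret type_I_splitting F ?Q A C M x .
    have "\<not> N2 G"
    proof
      assume "N2 G"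
      then have "Q.N2 (carrier ?Q)" using H.image_N2[OF alg_whole] unfolding H.f_surj by blast
      then have "Q.br (carrier ?Q) (carrier ?Q) \<subseteq> A" by (rule N2_abelian)
      then have "?f ` br G G \<subseteq> A" unfolding H.image_br[OF subset_refl subset_refl] H.f_surj .
      then have "br G G \<subseteq> H.pre A" using image_le alg_br[OF alg_whole] by blast
      then have "nba G" unfolding nba_def using pre_nilp[OF A_idl A_nilp] nilp_mono by blast
      then show False using * by blast
    qed
    moreover have "N2 T" if "alg T" "T \<noteq> G" for T using * nba_N2 that by blast
    ultimately show "(\<forall>S. alg S \<and> S \<noteq> G \<longrightarrow> N2 S) \<and> \<not> N2 G" by blast
  qed
qed

end

theorem theorem4p9:
  fixes F :: "('f, 'r) ring_scheme" and L :: "('f, 'a, 'm) module_scheme"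
  assumes "lie_algebra F L"
    and "vectorspace.fin_dim F L"
    and "lie_solvable F L"
    and "solvability_index F L = 3"
  shows "minimal_non F (nilpotent_length_le F 2) L \<longleftrightarrow>
    minimal_non F (nilpotent_by_abelian F) L \<and> type_I F L"
proof -
  interpret fd_lie_algebra F L
    by (rule fd_lie_algebra.intro[OF assms(1)]) (rule fd_lie_algebra_axioms.intro[OF assms(2)])
  \<comment> \<open>Solvability ensures that the \<open>LEAST\<close> in the index is attained, so
    index 3 gives vanishing of the third derived algebra.\<close>
  have "derived_series F L (solvability_index F L) = {\<zero>\<^bsub>L\<^esub>}"
    unfolding solvability_index_def using assms(3) unfolding lie_solvable_def by (rule LeastI_ex)
  then have "der (carrier L) 3 \<subseteq> {\<zero>\<^bsub>L\<^esub>}" unfolding assms(4) der_derived_series by simp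
  from minimal_non_N2_iff[OF this] show ?thesis unfolding minimal_non_iff .
qed

end
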